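(* Assume that $n=p^st$ is odd. Then $$\left\{\begin{array}{c} V_{r,0},\ V_{r,0}',\ W_{2r,i},\\ D(U_1),\ D(U_2),\ D(Q_{r,j}^l)\end{array}\ \left|\ \begin{array}{c}1\leqslant r\leqslant p^s,\ 0\leqslant j\leqslant t-1,\\ 1\leqslant i\leqslant\frac{t-1}{2},\ 1\leqslant l\leqslant\frac{n-1}{2}\end{array}\right.\right\}$$ is a complete set of (finite dimensional) indecomposable Yetter-Drinfeld $kD_n$-modules up to isomorphism; that is, the listed Yetter-Drinfeld modules are indecomposable and pairwise non-isomorphic, and every finite dimensional indecomposable Yetter-Drinfeld $kD_n$-module is isomorphic to one of them.
   Context: $k$ is an algebraically closed field of odd characteristic $p$; $n=p^st$ with $s\geqslant1$ and $p\nmid t$; $\xi\in k$ is a primitive $t$-th root of unity. $D_n=\langle a,b\mid a^n=1,\ b^2=1,\ (ab)^2=1\rangle$ is the dihedral group of order $2n$, and $C_n=\langle a\rangle$. All modules are finite dimensional. Yetter-Drinfeld modules. For a finite group $G$, a Yetter-Drinfeld $kG$-module is a left $kG$-module $M$ with a right $kG$-comodule structure $\varphi:M\to M\otimes kG$, $m\mapsto\sum m_0\otimes m_1$, such that $\sum (g\cdot m)_0\otimes(g\cdot m)_1=\sum g\cdot m_0\otimes g m_1g^{-1}$ for all $g\in G$, $m\in M$. (Yetter-Drinfeld $kG$-modules are identified with left modules over the quantum double $D(kG)$.) Matrices. $A_{r,i}$ is the $r\times r$ upper triangular Jordan block with $\xi^i$ on the diagonal, $1$ on the superdiagonal, $0$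 elsewhere. $T=(t_{ij})\in M_r(k)$ is the upper triangular matrix defined by $t_{rr}=1$, $t_{ii}=-t_{i+1,i+1}$ for $i<r$, and $t_{ij}=-t_{i+1,j}-t_{i+1,j+1}$ for $1\leqslant i<j\leqslant r$, where $t_{i,r+1}:=0$. $kD_n$-modules with trivial coaction. $V_{r,0}$, $V_{r,0}'$ and $W_{2r,i}$ are the $kD_n$-modules given respectively by the matrix representations $\Phi_{r,0}$: $a\mapsto A_{r,0},\ b\mapsto T$; $\Phi_{r,0}'$: $a\mapsto A_{r,0},\ b\mapsto -T$; and $\Omega_{2r,i}$: $a\mapsto\begin{pmatrix}A_{r,i}&0\\ 0&A_{r,i}^{-1}\end{pmatrix}$, $b\mapsto\begin{pmatrix}0&I_r\\ I_r&0\end{pmatrix}$. Each is a Yetter-Drinfeld module with coaction $\varphi(v)=v\otimes 1$. Modules $D(U_j)$. For $j=1,2$, $U_j$ is the 1-dimensional $k\langle b\rangle$-module with $b\cdot u=(-1)^ju$ (here $\langle b\rangle$ is the centralizer of $b$ in $D_n$). $D(U_j)=kD_n\otimes_{k\langle b\rangle}U_j$ as a $kD_n$-module, with coaction $\varphi(a^i\otimes u)=(a^i\otimes u)\otimes a^{2i}b$, $0\leqslant i\leqslant n-1$. Modules $D(Q^l_{r,j})$. $Q_{r,j}$ is the $kC_n$-module given by the matrix representation $\rho_{r,j}$: $a\mapsto A_{r,j}$, and $Q_{r,j}^l=Q_{r,j}$ as a $kC_n$-module for each $l$. $D(Q_{r,j}^l)=kD_n\otimes_{kC_n}Q_{r,j}^l$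 as a $kD_n$-module, with coaction $\varphi(1\otimes q)=(1\otimes q)\otimes a^l$ and $\varphi(b\otimes q)=(b\otimes q)\otimes a^{n-l}$ for $q\in Q_{r,j}^l$. *)

theory Defs
  imports
    "HOL-Algebra.Generated_Groups"
    "Jordan_Normal_Form.Jordan_Normal_Form"
    "Jordan_Normal_Form.VS_Connect"
    "Jordan_Normal_Form.Gauss_Jordan_Elimination"
begin

hide_const (open) Multiset.mult Modules.module Polynomial.order

section \<open>Yetter-Drinfeld modules over a finite group\<close>

record ('g, 'k, 'v) yd_module = "('k, 'v) module" +
  action :: "'g \<Rightarrow> 'v \<Rightarrow> 'v"
  coaction :: "'v \<Rightarrow> 'g \<Rightarrow> 'v"

text \<open>For finite \<open>G\<close>, an element \<open>\<Sum>g. m g \<otimes> g\<close> of \<open>M \<otimes> kG\<close> is represented by its family of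
  coefficients \<open>m : G \<rightarrow> M\<close>.\<close>

definition tensor_kG ::
  "('g, 'a) monoid_scheme \<Rightarrow> ('k, 'v, 'b) module_scheme \<Rightarrow> ('k, 'g \<Rightarrow> 'v) module" where
  "tensor_kG G M =
    \<lparr>carrier = carrier G \<rightarrow>\<^sub>E carrier M,
     mult = undefined,
     one = undefined,
     zero = (\<lambda>g\<in>carrier G. \<zero>\<^bsub>M\<^esub>),
     add = (\<lambda>x y. \<lambda>g\<in>carrier G. x g \<oplus>\<^bsub>M\<^esub> y g),
     smult = (\<lambda>c x. \<lambda>g\<in>carrier G. c \<odot>\<^bsub>M\<^esub> x g)\<rparr>"

definition pure_tensor ::
  "('g, 'a) monoid_scheme \<Rightarrow> ('k, 'v, 'b) module_scheme \<Rightarrow> 'v \<Rightarrow> 'g \<Rightarrow> 'g \<Rightarrow> 'v" where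
  "pure_tensor G M m g = (\<lambda>h\<in>carrier G. if h = g then m else \<zero>\<^bsub>M\<^esub>)"

text \<open>A left \<open>kG\<close>-module is a linear action of \<open>G\<close>. Writing \<open>\<phi> m = \<Sum>h. \<phi> m h \<otimes> h\<close>,
  coassociativity \<open>(\<phi> \<otimes> id) \<circ> \<phi> = (id \<otimes> \<Delta>) \<circ> \<phi>\<close> is compared below at the
  coefficient of \<open>g \<otimes> h\<close>, where \<open>\<Delta> g = g \<otimes> g\<close>; the counit is \<open>\<epsilon> g = 1\<close>.\<close>

locale yetter_drinfeld =
  group G + vectorspace class_ring M
  for G :: "('g, 'a) monoid_scheme" (structure)
    and M :: "('g, 'k :: field, 'v, 'b) yd_module_scheme" +
  assumes finite_group: "finite (carrier G)"
    and action_linear: "g \<in> carrier G \<Longrightarrow> action M g \<in> module_hom class_ring M M"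
    and action_one: "m \<in> carrier M \<Longrightarrow> action M \<one> m = m"
    and action_mult: "\<lbrakk>g \<in> carrier G; h \<in> carrier G; m \<in> carrier M\<rbrakk>
          \<Longrightarrow> action M (g \<otimes> h) m = action M g (action M h m)"
    and coaction_linear: "coaction M \<in> module_hom class_ring M (tensor_kG G M)"
    and coaction_coassoc: "\<lbrakk>m \<in> carrier M; g \<in> carrier G; h \<in> carrier G\<rbrakk>
          \<Longrightarrow> coaction M (coaction M m h) g = (if g = h then coaction M m h else \<zero>\<^bsub>M\<^esub>)"
    and coaction_counit: "m \<in> carrier M \<Longrightarrow> finsum M (coaction M m) (carrier G) = m"
    and compatible: "\<lbrakk>g \<in> carrier G; m \<in> carrier M\<rbrakk>
          \<Longrightarrow> coaction M (action M g m) =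
              finsum (tensor_kG G M)
                (\<lambda>h. pure_tensor G M (action M g (coaction M m h)) (g \<otimes> h \<otimes> inv g)) (carrier G)"

definition yd_submodule ::
  "('g, 'a) monoid_scheme \<Rightarrow> 'v set \<Rightarrow> ('g, 'k :: field, 'v, 'b) yd_module_scheme \<Rightarrow> bool" where
  "yd_submodule G N M \<longleftrightarrow>
    VectorSpace.subspace class_ring N M \<and>
    (\<forall>g\<in>carrier G. \<forall>m\<in>N. action M g m \<in> N) \<and>
    (\<forall>m\<in>N. coaction M m \<in> carrier G \<rightarrow>\<^sub>E N)"

definition yd_indecomposable ::
  "('g, 'a) monoid_scheme \<Rightarrow> ('g, 'k :: field, 'v, 'b) yd_module_scheme \<Rightarrow> bool" where
  "yd_indecomposable G M \<longleftrightarrow>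
    yetter_drinfeld G M \<and> carrier M \<noteq> {\<zero>\<^bsub>M\<^esub>} \<and>
    (\<forall>N1 N2. yd_submodule G N1 M \<and> yd_submodule G N2 M \<and>
       module.submodule_sum M N1 N2 = carrier M \<and> N1 \<inter> N2 = {\<zero>\<^bsub>M\<^esub>} \<longrightarrow>
       N1 = {\<zero>\<^bsub>M\<^esub>} \<or> N2 = {\<zero>\<^bsub>M\<^esub>})"

text \<open>The last condition is \<open>\<psi> \<circ> f = (f \<otimes> id) \<circ> \<phi>\<close> for the coactions \<open>\<phi>\<close>, \<open>\<psi>\<close> of \<open>M\<close>, \<open>N\<close>.\<close>

definition yd_isomorphic ::
  "('g, 'a) monoid_scheme \<Rightarrow> ('g, 'k :: field, 'v, 'b) yd_module_scheme
    \<Rightarrow> ('g, 'k, 'w, 'c) yd_module_scheme \<Rightarrow> bool" where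
  "yd_isomorphic G M N \<longleftrightarrow>
    (\<exists>f. linear_map class_ring M N f \<and> bij_betw f (carrier M) (carrier N) \<and>
      (\<forall>g\<in>carrier G. \<forall>m\<in>carrier M. f (action M g m) = action N g (f m)) \<and>
      (\<forall>g\<in>carrier G. \<forall>m\<in>carrier M. coaction N (f m) g = f (coaction M m g)))"

text \<open>The space \<open>k\<^sup>d\<close> on which \<open>g\<close> acts by the matrix \<open>\<rho> g\<close> and whose coaction is
  the linear extension of \<open>e\<^sub>i \<mapsto> e\<^sub>i \<otimes> \<delta> i\<close>.\<close>

definition yd_of_rep ::
  "('g, 'a) monoid_scheme \<Rightarrow> nat \<Rightarrow> ('g \<Rightarrow> 'k :: field mat) \<Rightarrow> (nat \<Rightarrow> 'g)
    \<Rightarrow> ('g, 'k, 'k vec) yd_module" where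
  "yd_of_rep G d \<rho> \<delta> =
    module.extend (module_vec TYPE('k) d)
      (yd_module.fields
        (\<lambda>g v. \<rho> g *\<^sub>v v)
        (\<lambda>v. \<lambda>g\<in>carrier G. vec d (\<lambda>i. if \<delta> i = g then v $ i else 0)))"


section \<open>Induced modules\<close>

text \<open>Let \<open>\<rho>\<close> be a matrix representation of the subgroup \<open>H\<close> on \<open>U = k\<^sup>d\<close> and let the list \<open>xs\<close>
  enumerate representatives of the left cosets of \<open>H\<close>. As \<open>kG\<close> is a free right \<open>kH\<close>-module on
  \<open>xs\<close>, the elements \<open>xs ! i \<otimes> e\<^sub>k\<close> (\<open>k < d\<close>) form a basis of \<open>kG \<otimes>\<^sub>k\<^sub>H U\<close>;
  they are numbered by \<open>i * d + k\<close>. If \<open>g (xs ! j) = (xs ! i) h\<close> with \<open>h \<in> H\<close> then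
  \<open>g (xs ! j \<otimes> u) = xs ! i \<otimes> \<rho> h u\<close>.\<close>

definition induced_rep ::
  "('g, 'a) monoid_scheme \<Rightarrow> 'g set \<Rightarrow> 'g list \<Rightarrow> nat \<Rightarrow> ('g \<Rightarrow> 'k :: field mat) \<Rightarrow> 'g \<Rightarrow> 'k mat" where
  "induced_rep G H xs d \<rho> g =
    mat (length xs * d) (length xs * d)
      (\<lambda>(p, q). let h = inv\<^bsub>G\<^esub> (xs ! (p div d)) \<otimes>\<^bsub>G\<^esub> (g \<otimes>\<^bsub>G\<^esub> (xs ! (q div d)))
        in if h \<in> H then \<rho> h $$ (p mod d, q mod d) else 0)"


text \<open>The coordinates of \<open>g \<otimes> u\<close> in this basis. The three lemmas about it confirm that
  \<^const>\<open>induced_rep\<close> is the action of \<open>G\<close> on \<open>kG \<otimes>\<^sub>k\<^sub>H U\<close>: the tensor is balanced, the basis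
  is the stated one, and \<open>g (g' \<otimes> u) = g g' \<otimes> u\<close>.\<close>

definition induced_tensor ::
  "('g, 'a) monoid_scheme \<Rightarrow> 'g set \<Rightarrow> 'g list \<Rightarrow> nat \<Rightarrow> ('g \<Rightarrow> 'k :: field mat)
    \<Rightarrow> 'g \<Rightarrow> 'k vec \<Rightarrow> 'k vec" where
  "induced_tensor G H xs d \<rho> g u =
    vec (length xs * d)
      (\<lambda>p. let h = inv\<^bsub>G\<^esub> (xs ! (p div d)) \<otimes>\<^bsub>G\<^esub> g
        in if h \<in> H then (\<rho> h *\<^sub>v u) $ (p mod d) else 0)"

locale induced =
  group G + subgroup H G for G :: "('g, 'a) monoid_scheme" (structure) and H +
  fixes xs :: "'g list" and d :: nat and \<rho> :: "'g \<Rightarrow> 'k :: field mat"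
  assumes xs_closed: "set xs \<subseteq> carrier G"
    and transversal: "g \<in> carrier G \<Longrightarrow> \<exists>!i. i < length xs \<and> inv (xs ! i) \<otimes> g \<in> H"
    and rep_dim: "h \<in> H \<Longrightarrow> \<rho> h \<in> carrier_mat d d"
    and rep_one: "\<rho> \<one> = 1\<^sub>m d"
    and rep_mult: "\<lbrakk>h \<in> H; h' \<in> H\<rbrakk> \<Longrightarrow> \<rho> (h \<otimes> h') = \<rho> h * \<rho> h'"
begin

lemma xs_nth: "p < length xs * d \<Longrightarrow> xs ! (p div d) \<in> carrier G"
  using xs_closed by (metis less_mult_imp_div_less nth_mem subsetD)

lemma mod_less: "p < length xs * d \<Longrightarrow> p mod d < d"
  by (cases "d = 0") auto

lemma induced_tensor_balanced:
  assumes g: "g \<in> carrier G" and h: "h \<in> H" and u: "u \<in> carrier_vec d"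
  shows "induced_tensor G H xs d \<rho> (g \<otimes> h) u = induced_tensor G H xs d \<rho> g (\<rho> h *\<^sub>v u)"
proof (rule eq_vecI)
  fix p assume "p < dim_vec (induced_tensor G H xs d \<rho> g (\<rho> h *\<^sub>v u))"
  then have p: "p < length xs * d" by (simp add: induced_tensor_def)
  define x where "x = inv (xs ! (p div d)) \<otimes> g"
  have x: "x \<in> carrier G" using xs_nth[OF p] g by (simp add: x_def)
  have hc: "h \<in> carrier G" using h by (rule mem_carrier)
  have eq: "inv (xs ! (p div d)) \<otimes> (g \<otimes> h) = x \<otimes> h"
    using xs_nth[OF p] g hc by (simp add: x_def m_assoc)
  have "x \<otimes> h \<in> H \<longleftrightarrow> x \<in> H"
  proof
    assume "x \<otimes> h \<in> H"
    then have "(x \<otimes> h) \<otimes> inv h \<in> H" using h by simp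
    then show "x \<in> H" using x hc by (simp add: m_assoc)
  qed (use h in simp)
  moreover have "\<rho> (x \<otimes> h) *\<^sub>v u = \<rho> x *\<^sub>v (\<rho> h *\<^sub>v u)" if "x \<in> H"
    using that rep_mult[OF that h] rep_dim[OF that] rep_dim[OF h] u by simp
  ultimately show "induced_tensor G H xs d \<rho> (g \<otimes> h) u $ p =
      induced_tensor G H xs d \<rho> g (\<rho> h *\<^sub>v u) $ p"
    using p by (simp add: induced_tensor_def Let_def eq flip: x_def)
qed (simp add: induced_tensor_def)

lemma induced_tensor_basis:
  assumes i: "i < length xs" and k: "k < d"
  shows "induced_tensor G H xs d \<rho> (xs ! i) (unit_vec d k) = unit_vec (length xs * d) (i * d + k)"
proof (rule eq_vecI)
  fix p assume "p < dim_vec (unit_vec (length xs * d) (i * d + k) :: 'k vec)"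
  then have p: "p < length xs * d" by simp
  have i': "xs ! i \<in> carrier G" using i xs_closed by auto
  have "p div d < length xs" using p by (rule less_mult_imp_div_less)
  then have "inv (xs ! (p div d)) \<otimes> xs ! i \<in> H \<longleftrightarrow> p div d = i"
    using transversal[OF i'] i i' by auto
  moreover have "p = i * d + k \<longleftrightarrow> p div d = i \<and> p mod d = k"
  proof
    assume "p div d = i \<and> p mod d = k"
    then show "p = i * d + k" using div_mult_mod_eq[of p d] by simp
  qed (use k in simp)
  moreover have "i * d + k < length xs * d"
    using i k mult_le_mono1[of "Suc i" "length xs" d] by auto
  ultimately show "induced_tensor G H xs d \<rho> (xs ! i) (unit_vec d k) $ p =
      unit_vec (length xs * d) (i * d + k) $ p"
    using p k mod_less[OF p] i' by (auto simp: induced_tensor_def Let_def rep_one)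
qed (simp add: induced_tensor_def)

lemma induced_rep_tensor:
  assumes g: "g \<in> carrier G" and g': "g' \<in> carrier G" and u: "u \<in> carrier_vec d"
  shows "induced_rep G H xs d \<rho> g *\<^sub>v induced_tensor G H xs d \<rho> g' u =
    induced_tensor G H xs d \<rho> (g \<otimes> g') u"
proof (rule eq_vecI)
  fix p assume "p < dim_vec (induced_tensor G H xs d \<rho> (g \<otimes> g') u)"
  then have p: "p < length xs * d" by (simp add: induced_tensor_def)
  define y where "y = inv (xs ! (p div d)) \<otimes> g"
  have y: "y \<in> carrier G" using xs_nth[OF p] g by (simp add: y_def)
  obtain j where j: "j < length xs" "inv (xs ! j) \<otimes> g' \<in> H"
    and uniq: "\<And>j'. j' < length xs \<Longrightarrow> inv (xs ! j') \<otimes> g' \<in> H \<Longrightarrow> j' = j"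
    using transversal[OF g'] by blast
  define h where "h = inv (xs ! j) \<otimes> g'"
  have xj: "xs ! j \<in> carrier G" using j xs_closed by auto
  have h: "h \<in> H" "h \<in> carrier G" using j mem_carrier by (auto simp: h_def)
  define F where "F q = induced_rep G H xs d \<rho> g $$ (p, q) * induced_tensor G H xs d \<rho> g' u $ q" for q
  have "(induced_rep G H xs d \<rho> g *\<^sub>v induced_tensor G H xs d \<rho> g' u) $ p = sum F {..<length xs * d}"
    using p by (simp add: scalar_prod_def induced_rep_def induced_tensor_def F_def lessThan_atLeast0)
  also have "\<dots> = (\<Sum>i<length xs. sum F {i * d..<i * d + d})"
    by (rule sum.nat_group[symmetric])
  also have "\<dots> = (\<Sum>i<length xs. if i = j then sum F {j * d..<j * d + d} else 0)"
  proof (rule sum.cong[OF refl])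
    fix i assume i: "i \<in> {..<length xs}"
    have "F q = 0" if "i \<noteq> j" "q \<in> {i * d..<i * d + d}" for q
    proof -
      have q: "q div d = i" using that by (auto intro!: div_nat_eqI simp: mult.commute)
      have "q < length xs * d"
        using that(2) i mult_le_mono1[of "Suc i" "length xs" d] by auto
      then show ?thesis
        using q uniq[of i] i that(1) by (auto simp: F_def induced_tensor_def Let_def)
    qed
    then show "sum F {i * d..<i * d + d} = (if i = j then sum F {j * d..<j * d + d} else 0)"
      by auto
  qed
  also have "\<dots> = sum F {j * d..<j * d + d}"
    using j by simp
  also have "\<dots> = (\<Sum>k<d. F (j * d + k))"
    using sum.shift_bounds_nat_ivl[of F 0 "j * d" d] by (simp add: lessThan_atLeast0 add.commute)
  also have "\<dots> = (\<Sum>k<d. (if y \<otimes> xs ! j \<in> H then \<rho> (y \<otimes> xs ! j) $$ (p mod d, k) else 0) * (\<rho> h *\<^sub>v u) $ k)"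
  proof (rule sum.cong[OF refl])
    fix k assume k: "k \<in> {..<d}"
    have "j * d + k < length xs * d"
      using j k mult_le_mono1[of "Suc j" "length xs" d] by auto
    moreover have "(j * d + k) div d = j" "(j * d + k) mod d = k" using k by auto
    moreover have "inv (xs ! (p div d)) \<otimes> (g \<otimes> xs ! j) = y \<otimes> xs ! j"
      using xs_nth[OF p] g xj by (simp add: y_def m_assoc)
    ultimately show "F (j * d + k) =
      (if y \<otimes> xs ! j \<in> H then \<rho> (y \<otimes> xs ! j) $$ (p mod d, k) else 0) * (\<rho> h *\<^sub>v u) $ k"
      using p j by (simp add: F_def induced_rep_def induced_tensor_def Let_def h_def)
  qed
  also have "\<dots> = (if y \<otimes> xs ! j \<in> H then (\<rho> (y \<otimes> xs ! j) *\<^sub>v (\<rho> h *\<^sub>v u)) $ (p mod d) else 0)"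
    using rep_dim[of "y \<otimes> xs ! j"] rep_dim[OF h(1)] mod_less[OF p]
    by (auto simp: scalar_prod_def lessThan_atLeast0)
  also have "\<dots> = (if y \<otimes> g' \<in> H then (\<rho> (y \<otimes> g') *\<^sub>v u) $ (p mod d) else 0)"
  proof -
    define z where "z = y \<otimes> xs ! j"
    have z: "z \<in> carrier G" using y xj by (simp add: z_def)
    have "xs ! j \<otimes> h = g'"
      using xj g' by (simp add: h_def flip: m_assoc)
    then have eq: "y \<otimes> g' = z \<otimes> h"
      using m_assoc[OF y xj h(2)] by (simp add: z_def)
    have "z \<otimes> h \<in> H \<longleftrightarrow> z \<in> H"
    proof
      assume "z \<otimes> h \<in> H"
      then have "(z \<otimes> h) \<otimes> inv h \<in> H" using h by simp
      then show "z \<in> H" using z h by (simp add: m_assoc)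
    qed (use h in simp)
    moreover have "\<rho> (z \<otimes> h) *\<^sub>v u = \<rho> z *\<^sub>v (\<rho> h *\<^sub>v u)" if "z \<in> H"
      using that rep_mult[OF that h(1)] rep_dim[OF that] rep_dim[OF h(1)] u by simp
    ultimately show ?thesis by (simp add: eq flip: z_def)
  qed
  also have "\<dots> = induced_tensor G H xs d \<rho> (g \<otimes> g') u $ p"
    using p xs_nth[OF p] g g' by (simp add: induced_tensor_def Let_def y_def m_assoc)
  finally show "(induced_rep G H xs d \<rho> g *\<^sub>v induced_tensor G H xs d \<rho> g' u) $ p =
    induced_tensor G H xs d \<rho> (g \<otimes> g') u $ p" .
qed (simp add: induced_tensor_def induced_rep_def)

end


section \<open>The dihedral group\<close>

text \<open>The pair \<open>(i, e)\<close> with \<open>i < n\<close> stands for \<open>a\<^sup>i\<close> if \<open>e\<close> is false and for \<open>a\<^sup>i b\<close> if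
  it is true.\<close>

definition dihedral :: "nat \<Rightarrow> (nat \<times> bool) monoid" where
  "dihedral n =
    \<lparr>carrier = {..<n} \<times> UNIV,
     mult = (\<lambda>(i, e) (j, f). ((if e then i + (n - j) else i + j) mod n, e \<noteq> f)),
     one = (0, False)\<rparr>"

definition dih_a :: "nat \<Rightarrow> nat \<times> bool" where "dih_a n = (1 mod n, False)"

definition dih_b :: "nat \<times> bool" where "dih_b = (0, True)"

text \<open>The matrix representation determined by \<open>a \<mapsto> A\<close> and \<open>b \<mapsto> B\<close>.\<close>

definition dih_rep :: "'k :: field mat \<Rightarrow> 'k mat \<Rightarrow> nat \<times> bool \<Rightarrow> 'k mat" where
  "dih_rep A B = (\<lambda>(i, e). A ^\<^sub>m i * (if e then B else 1\<^sub>m (dim_row A)))"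

lemma dihedral_simps:
  "carrier (dihedral n) = {..<n} \<times> UNIV"
  "(i, e) \<otimes>\<^bsub>dihedral n\<^esub> (j, f) = ((if e then i + (n - j) else i + j) mod n, e \<noteq> f)"
  "\<one>\<^bsub>dihedral n\<^esub> = (0, False)"
  by (simp_all add: dihedral_def)

lemma group_dihedral:
  assumes n: "n > 0"
  shows "group (dihedral n)"
proof (rule groupI)
  have minus: "(x + int (n - j)) mod int n = (x - int j) mod int n" if "j < n" for x j
  proof -
    have "x + int (n - j) = x - int j + int n"
      using that by (simp add: of_nat_diff)
    then show ?thesis by (simp only: mod_add_self2)
  qed
  have plus: "int ((i + j) mod n) = (int i + int j) mod int n" for i j
    by (simp add: zmod_int)
  fix x y z :: "nat \<times> bool"
  assume "x \<in> carrier (dihedral n)" "y \<in> carrier (dihedral n)" "z \<in> carrier (dihedral n)"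
  then obtain i e j f k g where *: "x = (i, e)" "y = (j, f)" "z = (k, g)" "i < n" "j < n" "k < n"
    by (cases x, cases y, cases z) (auto simp: dihedral_simps)
  have "int (fst (x \<otimes>\<^bsub>dihedral n\<^esub> y \<otimes>\<^bsub>dihedral n\<^esub> z)) =
    int (fst (x \<otimes>\<^bsub>dihedral n\<^esub> (y \<otimes>\<^bsub>dihedral n\<^esub> z)))"
    unfolding *(1-3) dihedral_simps
    by (cases e; cases f)
      (simp_all only: fst_conv simp_thms if_True if_False plus minus *(4-6) n mod_less_divisor,
       simp_all add: mod_simps algebra_simps)
  then show "x \<otimes>\<^bsub>dihedral n\<^esub> y \<otimes>\<^bsub>dihedral n\<^esub> z = x \<otimes>\<^bsub>dihedral n\<^esub> (y \<otimes>\<^bsub>dihedral n\<^esub> z)"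
  proof (intro prod_eqI)
    show "snd (x \<otimes>\<^bsub>dihedral n\<^esub> y \<otimes>\<^bsub>dihedral n\<^esub> z) = snd (x \<otimes>\<^bsub>dihedral n\<^esub> (y \<otimes>\<^bsub>dihedral n\<^esub> z))"
      unfolding *(1-3) dihedral_simps snd_conv by blast
  qed (simp only: of_nat_eq_iff)
next
  fix x assume "x \<in> carrier (dihedral n)"
  then obtain i e where x: "x = (i, e)" "i < n" by (cases x) (auto simp: dihedral_simps)
  have "((if e then i else (n - i) mod n), e) \<otimes>\<^bsub>dihedral n\<^esub> x = \<one>\<^bsub>dihedral n\<^esub>"
    using x by (auto simp: dihedral_simps mod_simps)
  moreover have "((if e then i else (n - i) mod n), e) \<in> carrier (dihedral n)"
    using x by (auto simp: dihedral_simps)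
  ultimately show "\<exists>y\<in>carrier (dihedral n). y \<otimes>\<^bsub>dihedral n\<^esub> x = \<one>\<^bsub>dihedral n\<^esub>" by blast
qed (use n in \<open>auto simp: dihedral_simps\<close>)

lemma dih_a_pow: "n > 0 \<Longrightarrow> dih_a n [^]\<^bsub>dihedral n\<^esub> (i :: nat) = (i mod n, False)"
  by (induction i) (simp_all add: dihedral_simps dih_a_def mod_simps)

lemma dih_a_pow_b:
  "i < n \<Longrightarrow> dih_a n [^]\<^bsub>dihedral n\<^esub> i \<otimes>\<^bsub>dihedral n\<^esub> dih_b = (i, True)"
  by (simp add: dih_a_pow dih_b_def dihedral_simps)

lemma dihedral_relations:
  assumes n: "n > 0"
  shows "dih_a n \<in> carrier (dihedral n)" "dih_b \<in> carrier (dihedral n)"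
    "dih_a n [^]\<^bsub>dihedral n\<^esub> n = \<one>\<^bsub>dihedral n\<^esub>"
    "dih_b [^]\<^bsub>dihedral n\<^esub> (2 :: nat) = \<one>\<^bsub>dihedral n\<^esub>"
    "(dih_a n \<otimes>\<^bsub>dihedral n\<^esub> dih_b) [^]\<^bsub>dihedral n\<^esub> (2 :: nat) = \<one>\<^bsub>dihedral n\<^esub>"
    "generate (dihedral n) {dih_a n, dih_b} = carrier (dihedral n)"
    "order (dihedral n) = 2 * n"
proof -
  interpret group "dihedral n" by (rule group_dihedral[OF n])
  show ab: "dih_a n \<in> carrier (dihedral n)" "dih_b \<in> carrier (dihedral n)"
    using n by (simp_all add: dihedral_simps dih_a_def dih_b_def)
  show "dih_a n [^]\<^bsub>dihedral n\<^esub> n = \<one>\<^bsub>dihedral n\<^esub>"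
    using n by (simp add: dih_a_pow dihedral_simps)
  show "dih_b [^]\<^bsub>dihedral n\<^esub> (2 :: nat) = \<one>\<^bsub>dihedral n\<^esub>"
    by (simp add: numeral_2_eq_2 dihedral_simps dih_b_def)
  show "(dih_a n \<otimes>\<^bsub>dihedral n\<^esub> dih_b) [^]\<^bsub>dihedral n\<^esub> (2 :: nat) = \<one>\<^bsub>dihedral n\<^esub>"
    using n by (cases "n = 1") (simp_all add: numeral_2_eq_2 dihedral_simps dih_a_def dih_b_def)
  show "order (dihedral n) = 2 * n"
    by (simp add: Coset.order_def dihedral_simps card_cartesian_product)
  have pow: "dih_a n [^]\<^bsub>dihedral n\<^esub> i \<in> generate (dihedral n) {dih_a n, dih_b}" for i :: nat
    by (induction i) (auto intro: generate.intros)
  have "(i, e) \<in> generate (dihedral n) {dih_a n, dih_b}" if "i < n" for i e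
  proof (cases e)
    case True
    then show ?thesis
      using generate.eng[OF pow generate.incl, of dih_b i] that by (simp add: dih_a_pow_b)
  next
    case False
    then show ?thesis using pow[of i] that n by (simp add: dih_a_pow)
  qed
  then have "carrier (dihedral n) \<subseteq> generate (dihedral n) {dih_a n, dih_b}"
    by (auto simp: dihedral_simps)
  then show "generate (dihedral n) {dih_a n, dih_b} = carrier (dihedral n)"
    using generate_incl[of "{dih_a n, dih_b}"] ab by auto
qed


section \<open>The listed modules\<close>

text \<open>The entry \<open>t\<^sub>i\<^sub>j\<close>, indexed from 1; it is 0 outside \<open>1 \<le> i \<le> j \<le> r\<close>, in particular for \<open>j = r + 1\<close>.\<close>

function t_entry :: "nat \<Rightarrow> nat \<Rightarrow> nat \<Rightarrow> 'k :: field" where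
  "t_entry r i j =
    (if j < i \<or> r < j then 0
     else if i = j then (if i = r then 1 else - t_entry r (i + 1) (i + 1))
     else - t_entry r (i + 1) j - t_entry r (i + 1) (j + 1))"
  by auto
termination by (relation "measure (\<lambda>(r, i, j). r - i)") auto

declare t_entry.simps [simp del]

definition T_mat :: "nat \<Rightarrow> 'k :: field mat" where
  "T_mat r = mat r r (\<lambda>(i, j). t_entry r (i + 1) (j + 1))"

definition A_mat :: "'k :: field \<Rightarrow> nat \<Rightarrow> nat \<Rightarrow> 'k mat" where
  "A_mat \<xi> r i = jordan_block r (\<xi> ^ i)"

definition V_mod :: "nat \<Rightarrow> 'k :: field \<Rightarrow> nat \<Rightarrow> (nat \<times> bool, 'k, 'k vec) yd_module" where
  "V_mod n \<xi> r =
    yd_of_rep (dihedral n) r (dih_rep (A_mat \<xi> r 0) (T_mat r)) (\<lambda>_. \<one>\<^bsub>dihedral n\<^esub>)"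

definition V'_mod :: "nat \<Rightarrow> 'k :: field \<Rightarrow> nat \<Rightarrow> (nat \<times> bool, 'k, 'k vec) yd_module" where
  "V'_mod n \<xi> r =
    yd_of_rep (dihedral n) r (dih_rep (A_mat \<xi> r 0) (- T_mat r)) (\<lambda>_. \<one>\<^bsub>dihedral n\<^esub>)"

definition W_mod :: "nat \<Rightarrow> 'k :: field \<Rightarrow> nat \<Rightarrow> nat \<Rightarrow> (nat \<times> bool, 'k, 'k vec) yd_module" where
  "W_mod n \<xi> r i =
    yd_of_rep (dihedral n) (2 * r)
      (dih_rep
        (four_block_mat (A_mat \<xi> r i) (0\<^sub>m r r) (0\<^sub>m r r) (the (mat_inverse (A_mat \<xi> r i))))
        (four_block_mat (0\<^sub>m r r) (1\<^sub>m r) (1\<^sub>m r) (0\<^sub>m r r)))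
      (\<lambda>_. \<one>\<^bsub>dihedral n\<^esub>)"

text \<open>In the next two definitions \<^const>\<open>dih_rep\<close> is only evaluated on \<open>\<langle>b\<rangle>\<close> and on \<open>\<langle>a\<rangle>\<close>,
  respectively, so the first, respectively second, matrix argument plays no role.\<close>

definition DU_mod :: "nat \<Rightarrow> nat \<Rightarrow> (nat \<times> bool, 'k :: field, 'k vec) yd_module" where
  "DU_mod n j =
    yd_of_rep (dihedral n) n
      (induced_rep (dihedral n) (generate (dihedral n) {dih_b})
        (map (\<lambda>i. dih_a n [^]\<^bsub>dihedral n\<^esub> i) [0..<n])
        1 (dih_rep (1\<^sub>m 1) ((- 1) ^ j \<cdot>\<^sub>m 1\<^sub>m 1)))
      (\<lambda>i. dih_a n [^]\<^bsub>dihedral n\<^esub> (2 * i) \<otimes>\<^bsub>dihedral n\<^esub> dih_b)"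

definition DQ_mod ::
  "nat \<Rightarrow> 'k :: field \<Rightarrow> nat \<Rightarrow> nat \<Rightarrow> nat \<Rightarrow> (nat \<times> bool, 'k, 'k vec) yd_module" where
  "DQ_mod n \<xi> r j l =
    yd_of_rep (dihedral n) (2 * r)
      (induced_rep (dihedral n) (generate (dihedral n) {dih_a n})
        [\<one>\<^bsub>dihedral n\<^esub>, dih_b]
        r (dih_rep (A_mat \<xi> r j) (1\<^sub>m r)))
      (\<lambda>i. dih_a n [^]\<^bsub>dihedral n\<^esub> (if i < r then l else n - l))"

datatype yd_label = LabV nat | LabV' nat | LabW nat nat | LabDU nat | LabDQ nat nat nat

fun yd_member :: "nat \<Rightarrow> 'k :: field \<Rightarrow> yd_label \<Rightarrow> (nat \<times> bool, 'k, 'k vec) yd_module" where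
  "yd_member n \<xi> (LabV r) = V_mod n \<xi> r"
| "yd_member n \<xi> (LabV' r) = V'_mod n \<xi> r"
| "yd_member n \<xi> (LabW r i) = W_mod n \<xi> r i"
| "yd_member n \<xi> (LabDU j) = DU_mod n j"
| "yd_member n \<xi> (LabDQ r j l) = DQ_mod n \<xi> r j l"

definition yd_labels :: "nat \<Rightarrow> nat \<Rightarrow> nat \<Rightarrow> yd_label set" where
  "yd_labels p s t =
    {LabV r | r. 1 \<le> r \<and> r \<le> p ^ s} \<union>
    {LabV' r | r. 1 \<le> r \<and> r \<le> p ^ s} \<union>
    {LabW r i | r i. 1 \<le> r \<and> r \<le> p ^ s \<and> 1 \<le> i \<and> i \<le> (t - 1) div 2} \<union>
    {LabDU 1, LabDU 2} \<union>
    {LabDQ r j l | r j l. 1 \<le> r \<and> r \<le> p ^ s \<and> j \<le> t - 1 \<and> 1 \<le> l \<and> l \<le> (p ^ s * t - 1) div 2}"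

end

theory Submission
  imports
    Defs
    "HOL-Number_Theory.Cong"
    "HOL-Computational_Algebra.Formal_Power_Series"
    "HOL-Library.Function_Algebras"
begin

text \<open>
A Yetter-Drinfeld module over \<open>kD\<^sub>n\<close> is a \<open>D\<^sub>n\<close>-module \<open>M\<close> with a grading by \<open>D\<^sub>n\<close> whose components
\<open>M\<^sub>g\<close> satisfy \<open>h M\<^sub>g = M\<^sub>h\<^sub>g\<^sub>h\<^sub>'\<close> with \<open>h' = h\<^sup>-\<^sup>1\<close>. For odd \<open>n\<close> the conjugacy classes are \<open>{1}\<close>, the pairs
\<open>{a\<^sup>l, a\<^sup>-\<^sup>l}\<close> and the class of all reflections, with centralizers \<open>D\<^sub>n\<close>, \<open>\<langle>a\<rangle>\<close> and \<open>\<langle>b\<rangle>\<close>; the listed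
modules are those induced from the indecomposable modules of these centralizers.

Completeness rests on a splitting criterion (\<open>yd_isomorphic_if_split\<close>): if a homomorphism
\<open>R : M \<rightarrow> X\<close> maps some submodule \<open>S\<close> of \<open>M\<close> bijectively onto \<open>X \<noteq> 0\<close>, then \<open>M\<close> is the direct sum of
\<open>S\<close> and the kernel of \<open>R\<close>, so \<open>R\<close> is an isomorphism if \<open>M\<close> is indecomposable. Such an \<open>R\<close> amounts
to vectors \<open>u\<^sub>q\<close> that span \<open>S\<close> and functionals \<open>f\<^sub>q\<close> dual to them which transform under \<open>a\<close> and \<open>b\<close>
like the coordinates of \<open>X\<close>. So it suffices to find, in every non-zero module, such a dual pair of
families for one of the listed modules.

If a component of degree a reflection is non-zero, a power of \<open>a\<close> moves it to degree \<open>b\<close>; there \<open>b\<close>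
has an eigenvector \<open>v\<close>, and the vectors \<open>a\<^sup>i v\<close> span a copy of \<open>D(U\<^sub>1)\<close> or \<open>D(U\<^sub>2)\<close>
(\<open>splits_reflection\<close>). Otherwise some component of degree \<open>a\<^sup>l\<close> is non-zero. The power
\<open>c = a ^ p ^ s\<close> satisfies \<open>c ^ t = 1\<close>, and \<open>t\<close> is invertible in \<open>k\<close>, so averaging over the powers of
\<open>c\<close> gives projections onto its eigenspaces. On the eigenspace for \<open>\<xi> ^ (j * p ^ s)\<close> the operator
\<open>N = a - \<xi> ^ j\<close> satisfies \<open>N ^ p ^ s = c - \<xi> ^ (j * p ^ s) = 0\<close> in characteristic \<open>p\<close>. Let \<open>r\<close> be the
nilpotency index of \<open>N\<close> there, \<open>N\<^sup>r\<^sup>-\<^sup>1 v \<noteq> 0\<close>, and let \<open>f\<close> be a functional whose only non-zero value on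
the vectors \<open>N\<^sup>i v\<close> is \<open>f (N\<^sup>r\<^sup>-\<^sup>1 v) = 1\<close>. Then the functionals \<open>f N\<^sup>q\<close> are dual to the chain of the
vectors \<open>N\<^sup>r\<^sup>-\<^sup>1\<^sup>-\<^sup>q v\<close>. The element \<open>b\<close> exchanges the components \<open>(l, j)\<close> and \<open>(-l, -j)\<close>. If \<open>(l, j)\<close>
is not \<open>(0, 0)\<close>, these are different because \<open>n\<close> and \<open>t\<close> are odd, and the chain together with its
image under \<open>b\<close> yields \<open>D(Q)\<close>, or \<open>W\<close> for \<open>l = 0\<close> (\<open>splits_rotation\<close>). On the component \<open>(0, 0)\<close> the
chain has to be chosen compatible with \<open>b\<close>; this yields \<open>V\<close> or \<open>V'\<close> (\<open>splits_unipotent\<close>).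

A listed module is indecomposable because one vector lies in each of its non-zero submodules
(\<open>yd_indecomposable_if_socle\<close>). Listed modules are told apart by the dimension and by the degrees
and eigenvalues of the homogeneous vectors that are eigenvectors of \<open>a\<close> or \<open>b\<close>
(\<open>joint_eigenvector\<close>).
\<close>

section \<open>Arithmetic modulo \<open>n\<close> and roots of unity\<close>

text \<open>With \<open>m = p ^ s * t\<close>, the identity \<open>d * (m choose d) = m * ((m - 1) choose (d - 1))\<close> shows that
  \<open>p ^ s\<close> divides the left-hand side, and \<open>d\<close> alone cannot absorb it. The lemma gives both the
  Frobenius identity \<open>(a - \<mu>) ^ p ^ s = a ^ p ^ s - \<mu> ^ p ^ s\<close> and the powers of Jordan blocks of size
  at most \<open>p ^ s\<close>.\<close>

lemma of_nat_choose_eq_0: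
  assumes p: "CHAR('k::field) = p" "prime p" and d: "0 < d" "d < p ^ s"
  shows "(of_nat ((p ^ s * t) choose d) :: 'k) = 0"
proof -
  have "\<not> p ^ s dvd d" using d by (auto dest: dvd_imp_le)
  moreover have "p ^ s dvd d * ((p ^ s * t) choose d)"
  proof (cases "p ^ s * t = 0")
    case False
    then obtain m e where m: "p ^ s * t = Suc m" "d = Suc e"
      using d by (metis Suc_pred gr_zeroI)
    have "d * ((p ^ s * t) choose d) = p ^ s * t * (m choose e)"
      using Suc_times_binomial[of e m] m by simp
    then show ?thesis by (simp add: mult.assoc)
  next
    case True
    then show ?thesis using d p(2) by (cases d) (auto simp: prime_gt_0_nat)
  qed
  ultimately have "p dvd ((p ^ s * t) choose d)"
    using p(2) by (metis coprime_dvd_mult_left_iff coprime_power_left_iff prime_imp_coprime)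
  then show ?thesis using p(1) by (simp add: of_nat_eq_0_iff_char_dvd)
qed

lemma sum_cyclic_shift:
  fixes g :: "nat \<Rightarrow> 'a::ab_group_add"
  assumes "g t = g 0"
  shows "(\<Sum>i<t. g (Suc i)) = (\<Sum>i<t. g i)"
  using sum.lessThan_Suc_shift[of g t] assms by simp

lemma primitive_root_power_eq_1_iff:
  fixes \<xi> :: "'k::field"
  assumes "\<xi> ^ t = 1" "\<And>m. 0 < m \<Longrightarrow> m < t \<Longrightarrow> \<xi> ^ m \<noteq> 1" "0 < t"
  shows "\<xi> ^ m = 1 \<longleftrightarrow> t dvd m"
proof -
  have "\<xi> ^ m = (\<xi> ^ t) ^ (m div t) * \<xi> ^ (m mod t)"
    by (metis mult_div_mod_eq power_add power_mult)
  then have "\<xi> ^ m = \<xi> ^ (m mod t)" using assms(1) by simp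
  then show ?thesis using assms(2)[of "m mod t"] assms(3) by (cases "m mod t = 0") (auto simp: dvd_eq_mod_eq_0)
qed

lemma neg_mod_unique:
  fixes n k r :: nat
  assumes "0 < n" "n dvd r + k"
  shows "(n - k mod n) mod n = r mod n"
proof -
  have "(r + k mod n) mod n = 0" using assms(2) by (simp add: mod_simps)
  moreover have "n - k mod n + k mod n = n" using assms(1) by simp
  ultimately have "[n - k mod n + k mod n = r + k mod n] (mod n)" by (simp only: cong_def mod_self)
  then show ?thesis by (simp only: cong_add_rcancel_nat) (simp add: cong_def)
qed

lemma geometric_sum_root_of_unity:
  fixes \<omega> :: "'k::field"
  assumes "\<omega> ^ t = 1"
  shows "(\<Sum>i<t. \<omega> ^ i) = (if \<omega> = 1 then of_nat t else 0)"
  using assms by (auto simp: geometric_sum)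

lemma power_inj_below_order:
  fixes x :: "'k::field"
  assumes order: "\<And>m. x ^ m = 1 \<longleftrightarrow> t dvd m" and "j < t" "k < t"
  shows "x ^ j = x ^ k \<longleftrightarrow> j = k"
  using assms(2,3)
proof (induction j k rule: linorder_wlog)
  case (le j k)
  have "x \<noteq> 0" using order[of t] le by (metis dvd_refl not_less_zero power_0_left zero_neq_one)
  moreover have "x ^ k = x ^ j * x ^ (k - j)" using le by (simp flip: power_add)
  ultimately have "x ^ j = x ^ k \<longleftrightarrow> t dvd k - j" by (simp flip: order)
  then show ?case using le by (auto dest: dvd_imp_le)
qed auto

text \<open>This is why the basis vectors of \<open>D(U\<^sub>j)\<close>, of degrees \<open>a\<^sup>2\<^sup>i b\<close>, lie in different components.\<close>

lemma double_mod_inj: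
  assumes "odd n" "i < n" "j < n"
  shows "(2 * i) mod n = (2 * j) mod n \<longleftrightarrow> i = (j :: nat)"
proof
  assume "(2 * i) mod n = (2 * j) mod n"
  then have "[2 * i = 2 * j] (mod n)" by (simp add: cong_def)
  moreover have "coprime 2 n" using assms(1) by simp
  ultimately have "[i = j] (mod n)" by (simp add: cong_mult_lcancel_nat coprime_commute)
  then show "i = j" using assms by (simp add: cong_def)
qed simp

locale modular_dihedral =
  fixes p s t n :: nat and \<xi> :: "'k::field"
  assumes char_p: "CHAR('k) = p" and odd_p: "odd p" and s_pos: "s \<ge> 1" and not_dvd: "\<not> p dvd t"
    and n_eq: "n = p ^ s * t" and odd_n: "odd n" and root: "\<xi> ^ t = 1"
    and primitive: "\<And>m. 0 < m \<Longrightarrow> m < t \<Longrightarrow> \<xi> ^ m \<noteq> 1"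
begin

lemma prime_p: "prime p"
  using prime_CHAR_semidom[where 'a = 'k] char_p odd_p by (simp add: odd_pos)

lemma t_pos: "0 < t"
  using not_dvd by (cases t) auto

lemma odd_t: "odd t"
  using odd_n n_eq by simp

lemma n_gt_1: "1 < n"
proof -
  have "1 < p" by (rule prime_gt_1_nat[OF prime_p])
  then have "1 < p ^ s" using s_pos by (intro one_less_power) auto
  moreover have "p ^ s \<le> n" using t_pos by (simp add: n_eq)
  ultimately show ?thesis by simp
qed

lemma two_neq_0: "(2 :: 'k) \<noteq> 0"
proof
  assume "(2 :: 'k) = 0"
  then have "p dvd 2" using of_nat_eq_0_iff_char_dvd[where 'a = 'k, of 2] char_p by simp
  then show False using prime_p odd_p by (metis even_numeral primes_dvd_imp_eq two_is_prime_nat)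
qed

lemma one_neq_minus_one: "(1 :: 'k) \<noteq> - 1"
  using two_neq_0 by (metis add.inverse_unique add.right_inverse one_add_one)

lemma \<xi>_power_eq_1_iff: "\<xi> ^ m = 1 \<longleftrightarrow> t dvd m"
  by (rule primitive_root_power_eq_1_iff[OF root primitive t_pos])

lemma \<xi>_nz: "\<xi> \<noteq> 0"
  using root t_pos by (metis power_0_left not_gr0 zero_neq_one)

lemma \<xi>_power_inj: "j < t \<Longrightarrow> k < t \<Longrightarrow> \<xi> ^ j = \<xi> ^ k \<longleftrightarrow> j = k"
  by (rule power_inj_below_order[OF \<xi>_power_eq_1_iff])

end


section \<open>Linear algebra of one nilpotent operator\<close>

context vector_space begin

lemma linear_opI:
  assumes "\<And>x y. f (x + y) = f x + f y" "\<And>c x. f (scale c x) = scale c (f x)"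
  shows "Vector_Spaces.linear scale scale f"
  using assms vector_space_axioms by (simp add: Vector_Spaces.linear_iff)

lemma functionalI:
  assumes "\<And>x y. f (x + y) = f x + f y" "\<And>c x. f (scale c x) = c * f x"
  shows "Vector_Spaces.linear scale (*) f"
proof -
  have "vector_space ((*) :: 'a \<Rightarrow> 'a \<Rightarrow> 'a)" by unfold_locales (simp_all add: algebra_simps)
  with assms vector_space_axioms show ?thesis by (simp add: Vector_Spaces.linear_iff)
qed

lemma binomial_funpow:
  assumes B: "Vector_Spaces.linear scale scale B" and A: "\<And>x. A x = B x + scale \<mu> x"
  shows "(A ^^ k) x = (\<Sum>i\<le>k. scale (of_nat (k choose i) * \<mu> ^ (k - i)) ((B ^^ i) x))"
proof (induction k)
  case (Suc k)
  interpret B: Vector_Spaces.linear scale scale B by (rule B)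
  have "(A ^^ Suc k) x = (\<Sum>i\<le>k. scale (of_nat (k choose i) * \<mu> ^ (k - i)) ((B ^^ Suc i) x))
      + (\<Sum>i\<le>k. scale (of_nat (k choose i) * \<mu> ^ (Suc k - i)) ((B ^^ i) x))"
    by (simp add: A Suc B.sum B.scale scale_sum_right Suc_diff_le mult_ac)
  also have "(\<Sum>i\<le>k. scale (of_nat (k choose i) * \<mu> ^ (k - i)) ((B ^^ Suc i) x))
      = (\<Sum>i\<le>Suc k. scale (of_nat (if i = 0 then 0 else k choose (i - 1)) * \<mu> ^ (Suc k - i)) ((B ^^ i) x))"
    by (simp only: sum.atMost_Suc_shift[where n = k]) simp
  also have "(\<Sum>i\<le>k. scale (of_nat (k choose i) * \<mu> ^ (Suc k - i)) ((B ^^ i) x))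
      = (\<Sum>i\<le>Suc k. scale (of_nat (k choose i) * \<mu> ^ (Suc k - i)) ((B ^^ i) x))"
    by (simp add: binomial_eq_0)
  finally show ?case
    unfolding sum.distrib[symmetric] scale_left_distrib[symmetric] distrib_right[symmetric] of_nat_add[symmetric]
    by (simp only: choose_reduce_nat[of "Suc k"] diff_Suc_1 zero_less_Suc)
       (rule sum.cong, auto simp: gr0_conv_Suc)
qed simp

lemma linear_funpow:
  assumes "Vector_Spaces.linear scale scale B"
  shows "Vector_Spaces.linear scale scale (B ^^ k)"
proof (induction k)
  case (Suc k)
  then show ?case using Vector_Spaces.linear_compose[OF Suc assms] by (simp add: comp_def)
next
  case 0
  show ?case using linear_id by (simp add: id_def)
qed

lemma ex_functional:
  assumes "w \<noteq> 0"
  shows "\<exists>g. Vector_Spaces.linear scale (*) g \<and> g w = 1"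
proof -
  interpret vp: vector_space_pair scale "(*)" by unfold_locales (simp_all add: algebra_simps)
  have "independent {w}" using assms by simp
  from vp.linear_independent_extend[OF this, of "\<lambda>_. 1"] show ?thesis by auto
qed

text \<open>The functional is sought as \<open>\<Sum>k<r. c\<^sub>k g N\<^sup>k\<close>, where \<open>g\<close> takes the value 1 at \<open>N\<^sup>r\<^sup>-\<^sup>1 v\<close>. The
  required values are the coefficients of a product of power series, and they are correct if
  \<open>\<Sum> c\<^sub>k X\<^sup>k\<close> is inverse to the series with coefficients \<open>g (N\<^sup>r\<^sup>-\<^sup>1\<^sup>-\<^sup>m v)\<close>, whose constant term is 1.\<close>

lemma ex_dual_functional:
  assumes N: "Vector_Spaces.linear scale scale N" and r: "0 < r"
    and v: "(N ^^ r) v = 0" "(N ^^ (r - 1)) v \<noteq> 0"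
  shows "\<exists>f. Vector_Spaces.linear scale (*) f \<and> (\<forall>i. f ((N ^^ i) v) = of_bool (i = r - 1))"
proof -
  interpret N: Vector_Spaces.linear scale scale N by (rule N)
  obtain g where g: "Vector_Spaces.linear scale (*) g" "g ((N ^^ (r - 1)) v) = 1"
    using ex_functional[OF v(2)] by blast
  interpret g: Vector_Spaces.linear scale "(*)" g by (rule g)
  have N0: "(N ^^ i) v = 0" if "i \<ge> r" for i
    using that by (induction rule: dec_induct) (simp_all add: v(1))
  have lin: "Vector_Spaces.linear scale scale (N ^^ k)" for k
    by (rule linear_funpow[OF N])
  note Nk = module_hom.add[OF Vector_Spaces.linear.axioms(3)[OF lin]] module_hom.scale[OF
    Vector_Spaces.linear.axioms(3)[OF lin]]
    module_hom.zero[OF Vector_Spaces.linear.axioms(3)[OF lin]]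
  define S where "S = Abs_fps (\<lambda>m. if m < r then g ((N ^^ (r - 1 - m)) v) else 0)"
  define c where "c = fps_nth (inverse S)"
  have "fps_nth S 0 \<noteq> 0" using r g(2) by (simp add: S_def)
  then have "S * inverse S = 1" by (rule inverse_mult_eq_1')
  define f where "f x = (\<Sum>k<r. c k * g ((N ^^ k) x))" for x
  have fN: "f ((N ^^ i) v) = of_bool (i = r - 1)" for i
  proof (cases "i < r")
    case True
    have "f ((N ^^ i) v) = (\<Sum>k<r. c k * g ((N ^^ (k + i)) v))"
      by (simp add: f_def funpow_add)
    also have "\<dots> = (\<Sum>k\<le>r - 1 - i. c k * g ((N ^^ (k + i)) v))"
      using True by (intro sum.mono_neutral_right) (auto simp: N0)
    also have "\<dots> = (\<Sum>k\<le>r - 1 - i. c k * fps_nth S (r - 1 - i - k))"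
      using True by (intro sum.cong) (auto simp: S_def algebra_simps intro!: arg_cong[of _ _ "\<lambda>j. _ * g ((N ^^ j) v)"])
    also have "\<dots> = fps_nth (inverse S * S) (r - 1 - i)"
      by (simp add: fps_mult_nth c_def atMost_atLeast0)
    also have "\<dots> = of_bool (i = r - 1)"
      using True \<open>S * inverse S = 1\<close> by (auto simp: mult.commute)
    finally show ?thesis .
  next
    case False
    then show ?thesis using r by (auto simp: f_def N0 Nk)
  qed
  have "Vector_Spaces.linear scale (*) f"
  proof (rule functionalI)
    show "f (x + y) = f x + f y" for x y
      by (simp add: f_def Nk g.add sum.distrib distrib_left)
    show "f (scale c' x) = c' * f x" for c' x
      by (simp only: f_def Nk g.scale sum_distrib_left mult.left_commute)
  qed
  with fN show ?thesis by blast
qed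

lemma linear_span_into:
  assumes "Vector_Spaces.linear scale scale T" "\<And>x. x \<in> B \<Longrightarrow> T x \<in> span B'" "x \<in> span B"
  shows "T x \<in> span B'"
proof -
  have "span B \<subseteq> {x. T x \<in> span B'}"
  proof (rule span_minimal)
    show "subspace {x. T x \<in> span B'}"
      using assms(1) by (auto simp: Vector_Spaces.linear_iff subspace_def span_add span_scale)
        (metis scale_zero_left span_zero)
  qed (use assms(2) in auto)
  then show ?thesis using assms(3) by auto
qed

end


section \<open>Vector spaces with a dihedral action and grading\<close>

text \<open>A module over \<open>D\<^sub>n\<close> with homogeneous projections \<open>P g\<close>, lying in an ambient vector space on which
  all operators are defined and linear. The ambient space makes the theory of linear maps between
  whole types applicable; the relations of the group and of the grading are only required on \<open>M\<close>.
  Conjugation by \<open>a\<close> fixes \<open>a\<^sup>i\<close> and sends \<open>a\<^sup>i b\<close> to \<open>a\<^sup>i\<^sup>+\<^sup>2 b\<close>; conjugation by \<open>b\<close> negates the exponent.\<close>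

locale dihedral_grading = vector_space scale
  for scale :: "'k::field \<Rightarrow> 'w::ab_group_add \<Rightarrow> 'w" (infixr \<open>*s\<close> 75) +
  fixes n :: nat and a b :: "'w \<Rightarrow> 'w" and P :: "nat \<times> bool \<Rightarrow> 'w \<Rightarrow> 'w" and M :: "'w set"
  assumes odd_n: "odd n"
    and subspace_M: "subspace M"
    and linear_a: "Vector_Spaces.linear scale scale a"
    and linear_b: "Vector_Spaces.linear scale scale b"
    and linear_P: "Vector_Spaces.linear scale scale (P g)"
    and a_M: "x \<in> M \<Longrightarrow> a x \<in> M" and b_M: "x \<in> M \<Longrightarrow> b x \<in> M" and P_M: "x \<in> M \<Longrightarrow> P g x \<in> M"
    and a_n: "x \<in> M \<Longrightarrow> (a ^^ n) x = x" and b_b: "x \<in> M \<Longrightarrow> b (b x) = x"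
    and a_b_a: "x \<in> M \<Longrightarrow> a (b (a x)) = b x"
    and P_P: "x \<in> M \<Longrightarrow> g \<in> {..<n} \<times> UNIV \<Longrightarrow> h \<in> {..<n} \<times> UNIV \<Longrightarrow>
      P g (P h x) = (if g = h then P h x else 0)"
    and sum_P: "x \<in> M \<Longrightarrow> (\<Sum>g\<in>{..<n} \<times> UNIV. P g x) = x"
    and a_P_rot: "x \<in> M \<Longrightarrow> i < n \<Longrightarrow> a (P (i, False) x) = P (i, False) (a x)"
    and a_P_refl: "x \<in> M \<Longrightarrow> i < n \<Longrightarrow> a (P (i, True) x) = P ((i + 2) mod n, True) (a x)"
    and b_P: "x \<in> M \<Longrightarrow> i < n \<Longrightarrow> b (P (i, e) x) = P ((n - i) mod n, e) (b x)"
begin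

lemma n_pos: "0 < n"
  using odd_n by (rule odd_pos)

lemma add_scale_simps:
  "a (x + y) = a x + a y" "a (c *s x) = c *s a x" "a 0 = 0" "a (x - y) = a x - a y" "a (sum h I) = (\<Sum>i\<in>I. a (h i))"
  "b (x + y) = b x + b y" "b (c *s x) = c *s b x" "b 0 = 0" "b (x - y) = b x - b y"
  "P g (x + y) = P g x + P g y" "P g (c *s x) = c *s P g x" "P g 0 = 0" "P g (x - y) = P g x - P g y"
  "P g (sum h I) = (\<Sum>i\<in>I. P g (h i))"
proof -
  interpret a: Vector_Spaces.linear scale scale a by (rule linear_a)
  interpret b: Vector_Spaces.linear scale scale b by (rule linear_b)
  interpret P: Vector_Spaces.linear scale scale "P g" by (rule linear_P)
  show "a (x + y) = a x + a y" "a (c *s x) = c *s a x" "a 0 = 0" "a (x - y) = a x - a y"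
    "a (sum h I) = (\<Sum>i\<in>I. a (h i))"
    by (rule a.add a.scale a.zero a.diff a.sum)+
  show "b (x + y) = b x + b y" "b (c *s x) = c *s b x" "b 0 = 0" "b (x - y) = b x - b y"
    by (rule b.add b.scale b.zero b.diff)+
  show "P g (x + y) = P g x + P g y" "P g (c *s x) = c *s P g x" "P g 0 = 0" "P g (x - y) = P g x - P g y"
    "P g (sum h I) = (\<Sum>i\<in>I. P g (h i))"
    by (rule P.add P.scale P.zero P.diff P.sum)+
qed

lemma a_pow_simps:
  "(a ^^ k) (x + y) = (a ^^ k) x + (a ^^ k) y" "(a ^^ k) (c *s x) = c *s (a ^^ k) x"
  "(a ^^ k) 0 = 0" "(a ^^ k) (x - y) = (a ^^ k) x - (a ^^ k) y"
  by (induction k) (simp_all add: add_scale_simps)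

lemma a_pow_add: "(a ^^ j) ((a ^^ k) x) = (a ^^ (j + k)) x"
  by (simp add: funpow_add)

lemma a_pow_M: "x \<in> M \<Longrightarrow> (a ^^ k) x \<in> M"
  by (induction k) (simp_all add: a_M)

lemma a_pow_mod: "x \<in> M \<Longrightarrow> (a ^^ (k mod n)) x = (a ^^ k) x"
  using a_n by (simp add: funpow_mod_eq)

lemma a_pow_cong: "x \<in> M \<Longrightarrow> k mod n = k' mod n \<Longrightarrow> (a ^^ k) x = (a ^^ k') x"
  by (metis a_pow_mod)

lemma b_a: "x \<in> M \<Longrightarrow> b (a x) = (a ^^ (n - 1)) (b x)"
proof -
  assume x: "x \<in> M"
  have "b (a x) = (a ^^ n) (b (a x))" using a_n[of "b (a x)"] x by (simp add: a_M b_M)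
  also have "\<dots> = (a ^^ (n - 1)) (a (b (a x)))"
    using n_pos by (metis Suc_diff_1 comp_apply funpow_Suc_right)
  finally show ?thesis using x by (simp add: a_b_a)
qed

lemma b_a_pow: "x \<in> M \<Longrightarrow> k \<le> n \<Longrightarrow> b ((a ^^ k) x) = (a ^^ (n - k)) (b x)"
proof (induction k)
  case 0
  then show ?case by (simp add: a_n b_M)
next
  case (Suc k)
  then have "b ((a ^^ Suc k) x) = (a ^^ (n - 1)) ((a ^^ (n - k)) (b x))"
    by (simp add: b_a a_pow_M)
  also have "\<dots> = (a ^^ (n - 1 + (n - k))) (b x)" by (rule a_pow_add)
  also have "n - 1 + (n - k) = n + (n - Suc k)" using Suc.prems by simp
  also have "(a ^^ (n + (n - Suc k))) (b x) = (a ^^ (n - Suc k)) (b x)"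
    using Suc.prems by (intro a_pow_cong) (simp_all add: b_M del: diff_Suc_Suc Nat.add_diff_assoc)
  finally show ?case .
qed

text \<open>The part of a retraction onto a \<open>d\<close>-dimensional Yetter-Drinfeld module \<open>X\<close> with basis vectors of
  degrees \<open>\<delta>\<close> that depends on \<open>X\<close> through \<open>\<delta>\<close> only: the vectors \<open>u q\<close> span a submodule, the
  functionals \<open>f q\<close> are its coordinates, and together they form a graded map to \<open>X\<close>. How the
  functionals behave under \<open>a\<close> and \<open>b\<close> is stated with each construction of such families.\<close>

definition splits :: "nat \<Rightarrow> (nat \<Rightarrow> nat \<times> bool) \<Rightarrow> (nat \<Rightarrow> 'w) \<Rightarrow> (nat \<Rightarrow> 'w \<Rightarrow> 'k) \<Rightarrow> bool" where
  "splits d \<delta> u f \<longleftrightarrow>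
    (\<forall>q<d. u q \<in> M \<and> Vector_Spaces.linear scale (*) (f q) \<and>
       a (u q) \<in> span (u ` {..<d}) \<and> b (u q) \<in> span (u ` {..<d}) \<and>
       (\<forall>g\<in>{..<n} \<times> UNIV. P g (u q) \<in> span (u ` {..<d})) \<and>
       (\<forall>p<d. f p (u q) = of_bool (p = q)) \<and>
       (\<forall>g\<in>{..<n} \<times> UNIV. \<forall>m\<in>M. f q (P g m) = (if \<delta> q = g then f q m else 0)))"

lemma a_pow_P_refl:
  "x \<in> M \<Longrightarrow> i < n \<Longrightarrow> (a ^^ k) (P (i, True) x) = P ((i + 2 * k) mod n, True) ((a ^^ k) x)"
proof (induction k)
  case (Suc k)
  then show ?case using a_P_refl[of "(a ^^ k) x" "(i + 2 * k) mod n"] n_pos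
    by (simp add: a_pow_M mod_simps add.commute add.left_commute)
qed simp

lemma a_pow_P_rot: "x \<in> M \<Longrightarrow> i < n \<Longrightarrow> (a ^^ k) (P (i, False) x) = P (i, False) ((a ^^ k) x)"
  by (induction k) (simp_all add: a_P_rot a_pow_M)

text \<open>As \<open>2 v = (v + b v) + (v - b v)\<close> and both summands are eigenvectors of \<open>b\<close>, the map \<open>L\<close> cannot
  vanish on both.\<close>

lemma sign_eigenvector:
  assumes C: "\<And>x. x \<in> C \<Longrightarrow> b x \<in> C" "subspace C" "C \<subseteq> M" and L: "Vector_Spaces.linear scale scale L"
    and v: "v \<in> C" "L v \<noteq> 0" and two: "(2::'k) \<noteq> 0"
  shows "\<exists>\<sigma> w. \<sigma> \<in> {1, -1} \<and> w \<in> C \<and> L w \<noteq> 0 \<and> b w = \<sigma> *s w"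
proof (rule ccontr)
  assume "\<not> ?thesis"
  then have *: "\<And>\<sigma> w. \<sigma> \<in> {1, -1} \<Longrightarrow> w \<in> C \<Longrightarrow> b w = \<sigma> *s w \<Longrightarrow> L w = 0" by blast
  have bb: "b (b v) = v" using v C b_b by auto
  have "v + b v \<in> C" "v - b v \<in> C" using C v by (auto simp: subspace_add subspace_diff)
  then have "L (v + b v) = 0" "L (v - b v) = 0"
    using *[of 1 "v + b v"] *[of "-1" "v - b v"] bb by (simp_all add: add_scale_simps add.commute)
  moreover have L_add: "L (x + y) = L x + L y" for x y using L by (simp add: Vector_Spaces.linear_iff)
  ultimately have "L ((v + b v) + (v - b v)) = 0" by (simp only: L_add[of "v + b v"] add_0)
  moreover have "(v + b v) + (v - b v) = 2 *s v" by (simp add: scale_left_distrib[of 1 1 v, simplified])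
  ultimately show False using L v(2) two by (simp add: Vector_Spaces.linear_iff)
qed

text \<open>The centralizer \<open>\<langle>b\<rangle>\<close> acts semisimply on the component of degree \<open>b\<close>, so an eigenvector \<open>v\<close> of \<open>b\<close>
  there has a dual functional that \<open>b\<close> scales by the same sign; both are then translated by the
  powers of \<open>a\<close>.\<close>

lemma splits_reflection:
  assumes two: "(2::'k) \<noteq> 0" and y: "y \<in> M" "i < n" "P (i, True) y \<noteq> 0"
  shows "\<exists>\<sigma>\<in>{1, -1}. \<exists>u f. splits n (\<lambda>i. ((2 * i) mod n, True)) u f \<and>
    (\<forall>m\<in>M. \<forall>i<n. f i (a m) = f ((i + n - 1) mod n) m \<and> f i (b m) = \<sigma> * f ((n - i) mod n) m)"
proof -
  define C where "C = {x \<in> M. P (0, True) x = x}"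
  have sub: "subspace C" using subspace_M by (auto simp: C_def subspace_def add_scale_simps)
  have bC: "b x \<in> C" if "x \<in> C" for x
    using that b_P[of x 0 True] n_pos by (auto simp: C_def b_M)
  define k where "k = (n - i) * ((n + 1) div 2)"
  \<comment> \<open>\<open>(n + 1) div 2\<close> is the inverse of 2 modulo \<open>n\<close>; hence \<open>i + 2 k = 0\<close> modulo \<open>n\<close>\<close>
  have "2 * ((n + 1) div 2) = n + 1" using odd_n by simp
  then have "2 * k = (n - i) * (n + 1)" by (simp only: k_def mult.left_commute[of 2])
  then have "i + 2 * k = (i + (n - i)) + n * (n - i)" by (simp only: distrib_left mult_1_right mult.commute[of n] add_ac)
  then have "i + 2 * k = n * (1 + (n - i))" using y(2) by (simp add: distrib_left)
  then have ik: "(i + 2 * k) mod n = 0" by (metis mod_mult_self1_is_0)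
  define x where "x = P (0, True) ((a ^^ k) y)"
  have xC: "x \<in> C" using y n_pos by (simp add: C_def x_def P_M a_pow_M P_P)
  have x: "x = (a ^^ k) (P (i, True) y)" using a_pow_P_refl[of y i k] y ik by (simp add: x_def)
  have "x \<noteq> 0"
  proof
    assume "x = 0"
    then have "(a ^^ (n * k - k)) ((a ^^ k) (P (i, True) y)) = 0" using x by (simp add: a_pow_simps)
    moreover have "(a ^^ (n * k - k)) ((a ^^ k) (P (i, True) y)) = (a ^^ (n * k)) (P (i, True) y)"
      using n_pos by (simp add: a_pow_add)
    moreover have "(a ^^ (n * k)) (P (i, True) y) = (a ^^ 0) (P (i, True) y)"
      using y by (intro a_pow_cong) (simp_all add: P_M)
    ultimately show False using y(3) by simp
  qed
  then obtain \<sigma> v where \<sigma>: "\<sigma> \<in> {1, -1}" and v: "v \<in> C" "v \<noteq> 0" "b v = \<sigma> *s v"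
    using sign_eigenvector[OF bC sub _ linear_ident xC _ two] by (auto simp: C_def)
  have \<sigma>\<sigma>: "\<sigma> * \<sigma> = 1" using \<sigma> by auto
  have vM: "v \<in> M" and Pv: "P (0, True) v = v" using v by (auto simp: C_def)
  obtain g where g: "Vector_Spaces.linear scale (*) g" "g v = 1" using ex_functional[OF v(2)] by blast
  have g_simps: "g (x + y) = g x + g y" "g (c *s x) = c * g x" for x y c
    using g(1) by (simp_all add: Vector_Spaces.linear_iff)
  define h where "h x = (g x + \<sigma> * g (b x)) / 2" for x
  have hb: "h (b x) = \<sigma> * h x" if "x \<in> M" for x
    using that \<sigma>\<sigma> by (simp add: h_def b_b algebra_simps)
  have hv: "h v = 1" using v(3) g \<sigma>\<sigma> two by (simp add: h_def Vector_Spaces.linear_iff)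
  have h_simps: "h (x + y) = h x + h y" "h (c *s x) = c * h x" "h 0 = 0" for x y c
    using g_simps g_simps(2)[of 0] by (simp_all add: h_def add_scale_simps add_divide_distrib distrib_left)
  define f where "f i x = h (P (0, True) ((a ^^ (n - i)) x))" for i x
  define u where "u i = (a ^^ i) v" for i
  have fk: "h (P (0, True) ((a ^^ k) x)) = f ((n - k mod n) mod n) x" if "x \<in> M" for k x
  proof -
    have "(a ^^ (n - (n - k mod n) mod n)) x = (a ^^ k) x"
    proof (rule a_pow_cong[OF that])
      have "(k + (n - k mod n)) mod n = (k mod n + (n - k mod n)) mod n" by (simp only: mod_add_left_eq)
      also have "k mod n + (n - k mod n) = n" using n_pos by simp
      finally have "n dvd k + (n - k mod n)" by (simp add: dvd_eq_mod_eq_0)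
      from neg_mod_unique[OF n_pos this] show "(n - (n - k mod n) mod n) mod n = k mod n" .
    qed
    then show ?thesis by (simp add: f_def)
  qed
  have uM: "u q \<in> M" for q using vM by (simp add: u_def a_pow_M)
  have Pu: "P (2 * q mod n, True) (u q) = u q" for q
    using a_pow_P_refl[OF vM n_pos, of q] Pv by (simp add: u_def)
  have u_in: "u q \<in> span (u ` {..<n})" for q
  proof -
    have "u q = u (q mod n)" using vM by (simp add: u_def a_pow_mod)
    then show ?thesis using n_pos by (auto intro: span_base)
  qed
  have "splits n (\<lambda>i. ((2 * i) mod n, True)) u f"
    unfolding splits_def
  proof (intro allI impI conjI ballI)
    fix q assume q: "q < n"
    show "u q \<in> M" by (rule uM)
    show "Vector_Spaces.linear scale (*) (f q)"
      by (rule functionalI) (simp_all add: f_def a_pow_simps add_scale_simps h_simps)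
    show "a (u q) \<in> span (u ` {..<n})" using u_in[of "Suc q"] by (simp add: u_def)
    show "b (u q) \<in> span (u ` {..<n})"
      using u_in[of "n - q"] q b_a_pow[OF vM, of q] v(3) by (simp add: u_def a_pow_simps span_scale)
    show "P g (u q) \<in> span (u ` {..<n})" if "g \<in> {..<n} \<times> UNIV" for g
    proof -
      have "P g (u q) = P g (P (2 * q mod n, True) (u q))" by (simp add: Pu)
      also have "\<dots> \<in> {u q, 0}" using that n_pos Pu[of q] by (subst P_P) (auto simp: uM)
      finally show ?thesis using u_in[of q] span_zero by auto
    qed
    show "f p (u q) = of_bool (p = q)" if p: "p < n" for p
    proof -
      define k where "k = n - p + q"
      have "(2 * q + 2 * (n - p)) mod n = 0 \<longleftrightarrow> p = q"
      proof -
        have "(2 * q + 2 * (n - p)) mod n = 0 \<longleftrightarrow> (2 * q + 2 * (n - p) + 2 * p) mod n = (0 + 2 * p) mod n"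
          using Cong.cong_add_rcancel_nat[of "2 * q + 2 * (n - p)" "2 * p" 0 n] by (simp add: cong_def)
        also have "2 * q + 2 * (n - p) + 2 * p = 2 * q + n * 2" using p by simp
        finally show ?thesis using double_mod_inj[OF odd_n q p] by auto
      qed
      then have *: "((2 * q) mod n + 2 * (n - p)) mod n = 0 \<longleftrightarrow> p = q" by (simp add: mod_simps)
      have "(a ^^ (n - p)) (u q) = P (((2 * q) mod n + 2 * (n - p)) mod n, True) ((a ^^ (n - p)) (u q))"
        using a_pow_P_refl[OF uM, of "2 * q mod n" "n - p" q] n_pos Pu[of q] by simp
      then have "P (0, True) ((a ^^ (n - p)) (u q)) =
          P (0, True) (P (((2 * q) mod n + 2 * (n - p)) mod n, True) ((a ^^ (n - p)) (u q)))" by simp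
      also have "\<dots> = (if p = q then (a ^^ (n - p)) (u q) else 0)"
        using * n_pos a_pow_P_refl[OF uM, of "2 * q mod n" "n - p" q] Pu[of q]
        by (subst P_P) (auto simp: uM a_pow_M)
      also have "(if p = q then (a ^^ (n - p)) (u q) else 0) = (if p = q then v else 0)"
        using q a_n[OF vM] by (auto simp: u_def a_pow_add)
      finally show ?thesis by (simp add: f_def hv h_simps)
    qed
    show "f q (P g m) = (if (2 * q mod n, True) = g then f q m else 0)"
      if g: "g \<in> {..<n} \<times> UNIV" and m: "m \<in> M" for g m
    proof -
      obtain i e where g': "g = (i, e)" "i < n" using g by auto
      show ?thesis
      proof (cases e)
        case True
        have "(i + 2 * (n - q)) mod n = 0 \<longleftrightarrow> (i + 2 * (n - q) + 2 * q) mod n = (0 + 2 * q) mod n"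
          using cong_add_rcancel_nat[of "i + 2 * (n - q)" "2 * q" 0 n] by (simp add: cong_def)
        also have "i + 2 * (n - q) + 2 * q = i + n * 2" using q by simp
        finally have "(i + 2 * (n - q)) mod n = 0 \<longleftrightarrow> 2 * q mod n = i" using g'(2) by auto
        then show ?thesis using True g' m n_pos
          by (auto simp: f_def a_pow_P_refl P_P a_pow_M h_simps)
      next
        case False
        then show ?thesis using g' m n_pos by (simp add: f_def a_pow_P_rot P_P a_pow_M h_simps)
      qed
    qed
  qed
  moreover have "f i (a m) = f ((i + n - 1) mod n) m" "f i (b m) = \<sigma> * f ((n - i) mod n) m"
    if m: "m \<in> M" and i: "i < n" for m i
  proof -
    have "f i (a m) = h (P (0, True) ((a ^^ Suc (n - i)) m))"
      by (simp add: f_def funpow_swap1)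
    also have "\<dots> = f ((n - Suc (n - i) mod n) mod n) m" by (rule fk[OF m])
    also have "(n - Suc (n - i) mod n) mod n = (i + n - 1) mod n"
      using i n_pos by (intro neg_mod_unique) auto
    finally show "f i (a m) = f ((i + n - 1) mod n) m" .
    have "(a ^^ (n - i)) (b m) = b ((a ^^ i) m)" using b_a_pow[OF m, of i] i by simp
    then have "f i (b m) = h (P (0, True) (b ((a ^^ i) m)))" by (simp add: f_def)
    also have "P (0, True) (b ((a ^^ i) m)) = b (P (0, True) ((a ^^ i) m))"
      using b_P[of "(a ^^ i) m" 0 True] n_pos m by (simp add: a_pow_M)
    also have "h \<dots> = \<sigma> * f ((n - i mod n) mod n) m"
      using hb m fk[OF m, of i] by (simp add: a_pow_M P_M)
    finally show "f i (b m) = \<sigma> * f ((n - i) mod n) m" using i by simp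
  qed
  ultimately show ?thesis using \<sigma> by blast
qed

end


section \<open>Components of degree a rotation\<close>

locale modular_dihedral_grading =
  dihedral_grading scale n a b P M + modular_dihedral p s t n \<xi>
  for scale :: "'k::field \<Rightarrow> 'w::ab_group_add \<Rightarrow> 'w" (infixr \<open>*s\<close> 75)
    and n a b P M and p s t :: nat and \<xi> :: 'k
begin

lemma of_nat_t: "(of_nat t :: 'k) \<noteq> 0"
  using not_dvd char_p by (simp add: of_nat_eq_0_iff_char_dvd)

lemma p_pow_le: "p ^ s \<le> n"
  using t_pos by (simp add: n_eq)

text \<open>The eigenvalues of \<open>c = a ^ p ^ s\<close> are the powers of \<open>\<eta>\<close>, which again is a primitive \<open>t\<close>-th root of
  unity because \<open>p ^ s\<close> is coprime to \<open>t\<close>.\<close>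

definition \<eta> where "\<eta> = \<xi> ^ (p ^ s)"

lemma \<eta>_nz: "\<eta> \<noteq> 0"
  using \<xi>_nz by (simp add: \<eta>_def)

lemma \<eta>_t: "\<eta> ^ t = 1"
proof -
  have "\<eta> ^ t = (\<xi> ^ t) ^ (p ^ s)" by (simp add: \<eta>_def mult.commute flip: power_mult)
  then show ?thesis by (simp add: root)
qed

lemma \<eta>_pow_eq_1: "\<eta> ^ m = 1 \<longleftrightarrow> t dvd m"
proof -
  have "\<eta> ^ m = 1 \<longleftrightarrow> t dvd p ^ s * m"
    using primitive_root_power_eq_1_iff[OF root primitive t_pos] by (simp add: \<eta>_def flip: power_mult)
  moreover have "coprime t (p ^ s)"
    using prime_p not_dvd by (simp add: coprime_commute prime_imp_coprime)
  ultimately show ?thesis by (simp add: coprime_dvd_mult_right_iff)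
qed

lemma \<eta>_pow_inj: "j < t \<Longrightarrow> k < t \<Longrightarrow> \<eta> ^ j = \<eta> ^ k \<longleftrightarrow> j = k"
  by (rule power_inj_below_order[OF \<eta>_pow_eq_1])

definition c where "c = a ^^ (p ^ s)"

lemma c_pow: "c ^^ i = a ^^ (p ^ s * i)"
  by (simp add: c_def funpow_mult)

lemma c_pow_t: "x \<in> M \<Longrightarrow> (c ^^ t) x = x"
  by (simp add: c_pow a_n flip: n_eq)

lemma c_simps: "c (x + y) = c x + c y" "c (k *s x) = k *s c x" "c 0 = 0"
  by (simp_all add: c_def a_pow_simps)

lemma c_sum: "c (sum h I) = (\<Sum>i\<in>I. c (h i))"
  by (induction I rule: infinite_finite_induct) (simp_all add: c_simps)

text \<open>The projection onto the eigenspace of \<open>c\<close> for \<open>\<eta> ^ j\<close>, as a weighted average over the group \<open>\<langle>c\<rangle>\<close>, whose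
  order divides \<open>t\<close>.\<close>

definition E where "E j x = inverse (of_nat t) *s (\<Sum>i<t. (inverse (\<eta> ^ j)) ^ i *s (c ^^ i) x)"

lemma E_simps: "E j (x + y) = E j x + E j y" "E j (k *s x) = k *s E j x" "E j 0 = 0"
  by (simp_all add: E_def c_pow a_pow_simps scale_right_distrib sum.distrib scale_sum_right mult_ac)

lemma E_sum: "E j (sum h I) = (\<Sum>i\<in>I. E j (h i))"
  by (induction I rule: infinite_finite_induct) (simp_all add: E_simps)

lemma E_M: "x \<in> M \<Longrightarrow> E j x \<in> M"
  using subspace_M by (auto simp: E_def c_pow intro!: subspace_scale subspace_sum a_pow_M)

lemma c_E: assumes x: "x \<in> M" shows "c (E j x) = \<eta> ^ j *s E j x"
proof -
  define g where "g i = (inverse (\<eta> ^ j)) ^ i *s (c ^^ i) x" for i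
  have "(inverse (\<eta> ^ j)) ^ t = 1"
    using \<eta>_t by (metis inverse_1 mult.commute power_inverse power_mult power_one)
  then have g: "g t = g 0" using c_pow_t[OF x] by (simp add: g_def)
  have cg: "c (g i) = \<eta> ^ j *s g (Suc i)" for i
    using \<eta>_nz by (simp add: g_def c_simps power_inverse)
  have "c (E j x) = inverse (of_nat t) *s (\<Sum>i<t. \<eta> ^ j *s g (Suc i))"
    by (simp add: E_def c_simps c_sum cg flip: g_def)
  also have "\<dots> = \<eta> ^ j *s inverse (of_nat t) *s (\<Sum>i<t. g (Suc i))"
    by (simp add: scale_sum_right mult.commute)
  also have "(\<Sum>i<t. g (Suc i)) = (\<Sum>i<t. g i)" using g by (rule sum_cyclic_shift)
  finally show ?thesis by (simp add: E_def g_def)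
qed

lemma E_eigenvector:
  assumes y: "c y = \<eta> ^ k *s y" and jk: "j < t" "k < t"
  shows "E j y = (if j = k then y else 0)"
proof -
  define \<omega> where "\<omega> = inverse (\<eta> ^ j) * \<eta> ^ k"
  have ci: "(c ^^ i) y = (\<eta> ^ k) ^ i *s y" for i
    by (induction i) (simp_all add: c_simps y mult.commute)
  have "\<omega> ^ t = inverse ((\<eta> ^ t) ^ j) * (\<eta> ^ t) ^ k"
    by (simp add: \<omega>_def power_mult_distrib power_inverse mult.commute flip: power_mult)
  then have \<omega>t: "\<omega> ^ t = 1" by (simp add: \<eta>_t)
  have "E j y = inverse (of_nat t) *s (\<Sum>i<t. \<omega> ^ i) *s y"
    by (simp add: E_def ci \<omega>_def power_mult_distrib scale_sum_left)
  moreover have "\<omega> = 1 \<longleftrightarrow> j = k"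
    using \<eta>_pow_inj[OF jk] \<eta>_nz by (auto simp: \<omega>_def field_simps)
  ultimately show ?thesis using of_nat_t by (simp add: geometric_sum_root_of_unity[OF \<omega>t])
qed

lemma sum_E: assumes x: "x \<in> M" shows "(\<Sum>j<t. E j x) = x"
proof -
  have "(\<Sum>j<t. E j x) = inverse (of_nat t) *s (\<Sum>i<t. (\<Sum>j<t. (inverse (\<eta> ^ j)) ^ i) *s (c ^^ i) x)"
    unfolding E_def scale_sum_right[symmetric] scale_sum_left by (subst sum.swap) (rule refl)
  also have "(\<Sum>i<t. (\<Sum>j<t. (inverse (\<eta> ^ j)) ^ i) *s (c ^^ i) x) = (\<Sum>i<t. if i = 0 then of_nat t *s x else 0)"
  proof (rule sum.cong[OF refl])
    fix i assume i: "i \<in> {..<t}"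
    define \<omega> where "\<omega> = inverse (\<eta> ^ i)"
    have "\<omega> ^ t = 1" by (metis \<omega>_def \<eta>_t inverse_1 mult.commute power_inverse power_mult power_one)
    moreover have "(inverse (\<eta> ^ j)) ^ i = \<omega> ^ j" for j
      by (simp add: \<omega>_def power_inverse mult.commute flip: power_mult)
    moreover have "\<omega> = 1 \<longleftrightarrow> i = 0"
      using i \<eta>_pow_eq_1[of i] by (auto simp: \<omega>_def inverse_eq_1_iff dest: dvd_imp_le)
    ultimately show "(\<Sum>j<t. (inverse (\<eta> ^ j)) ^ i) *s (c ^^ i) x = (if i = 0 then of_nat t *s x else 0)"
      by (simp add: geometric_sum_root_of_unity)
  qed
  finally show ?thesis using t_pos of_nat_t by (simp add: sum.delta)
qed

lemma a_E: "a (E j x) = E j (a x)"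
  by (simp add: E_def add_scale_simps c_pow funpow_swap1)

lemma P_E: "x \<in> M \<Longrightarrow> l < n \<Longrightarrow> P (l, False) (E j x) = E j (P (l, False) x)"
  by (simp add: E_def add_scale_simps c_pow a_pow_P_rot)

text \<open>The generalized eigenspace of \<open>a\<close> for \<open>\<xi> ^ j\<close> in degree \<open>a\<^sup>l\<close>. It is described by \<open>c\<close>, which acts
  on it as a scalar.\<close>

definition comp where "comp l j = {y \<in> M. P (l, False) y = y \<and> c y = \<eta> ^ j *s y}"

definition Q where "Q l j x = E j (P (l, False) x)"

lemma comp_M: "y \<in> comp l j \<Longrightarrow> y \<in> M"
  by (simp add: comp_def)

lemma subspace_comp: "subspace (comp l j)"
  using subspace_M
  by (auto simp: comp_def subspace_def add_scale_simps c_simps scale_right_distrib mult.commute)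

lemma Q_comp: "x \<in> M \<Longrightarrow> l < n \<Longrightarrow> Q l j x \<in> comp l j"
  by (simp add: comp_def Q_def E_M P_M c_E P_E P_P)

lemma Q_id: "y \<in> comp l j \<Longrightarrow> j < t \<Longrightarrow> Q l j y = y"
  using E_eigenvector[of y j j] by (simp add: comp_def Q_def)

lemma Q_simps: "Q l j (x + y) = Q l j x + Q l j y" "Q l j (k *s x) = k *s Q l j x" "Q l j 0 = 0"
  by (simp_all add: Q_def E_simps add_scale_simps)

lemma Q_a: "x \<in> M \<Longrightarrow> l < n \<Longrightarrow> Q l j (a x) = a (Q l j x)"
  by (simp add: Q_def a_E flip: a_P_rot)

lemma Q_P: "x \<in> M \<Longrightarrow> l < n \<Longrightarrow> g \<in> {..<n} \<times> UNIV \<Longrightarrow>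
    Q l j (P g x) = (if g = (l, False) then Q l j x else 0)"
  by (auto simp: Q_def P_P E_simps)

lemma ex_component:
  assumes x: "x \<in> M" "x \<noteq> 0"
  shows "(\<exists>i<n. P (i, True) x \<noteq> 0) \<or> (\<exists>l<n. \<exists>j<t. Q l j x \<noteq> 0)"
proof (rule ccontr)
  assume *: "\<not> ?thesis"
  have "P g x = 0" if gn: "g \<in> {..<n} \<times> UNIV" for g
  proof -
    obtain i e where g: "g = (i, e)" "i < n" using gn by auto
    show ?thesis
    proof (cases e)
      case False
      have "P (i, False) x = (\<Sum>j<t. Q i j x)"
        unfolding Q_def by (rule sum_E[symmetric]) (rule P_M[OF x(1)])
      then show ?thesis using * g False by simp
    qed (use * g in auto)
  qed
  then show False using sum_P[OF x(1)] x(2) by simp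
qed

text \<open>Both the degree and the eigenvalue are inverted, as \<open>b a b = a\<^sup>-\<^sup>1\<close>.\<close>

lemma b_comp:
  assumes y: "y \<in> comp l j" and lj: "l < n" "j < t"
  shows "b y \<in> comp ((n - l) mod n) ((t - j) mod t)"
proof -
  have yM: "y \<in> M" using y by (rule comp_M)
  have "c (b (c y)) = (a ^^ (p ^ s)) ((a ^^ (n - p ^ s)) (b y))"
    using b_a_pow[OF yM p_pow_le] by (simp add: c_def)
  also have "\<dots> = b y" using p_pow_le a_n[OF b_M[OF yM]] by (simp add: a_pow_add)
  finally have 1: "\<eta> ^ j *s c (b y) = b y" using y by (simp add: comp_def add_scale_simps c_simps)
  have "\<eta> ^ ((t - j) mod t) * \<eta> ^ j = 1"
  proof -
    have "((t - j) mod t + j) mod t = 0" using lj(2) by (simp add: mod_simps)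
    then show ?thesis by (simp add: \<eta>_pow_eq_1 dvd_eq_mod_eq_0 flip: power_add)
  qed
  then have "c (b y) = \<eta> ^ ((t - j) mod t) *s \<eta> ^ j *s c (b y)" by simp
  then have "c (b y) = \<eta> ^ ((t - j) mod t) *s b y" using 1 by simp
  then show ?thesis using y b_P[OF yM lj(1), of False] by (simp add: comp_def b_M)
qed

lemma neg_mod_eq_self:
  fixes m i :: nat
  assumes "odd m" "i < m"
  shows "(m - i) mod m = i \<longleftrightarrow> i = 0"
proof (cases "i = 0")
  case False
  then have "(m - i) mod m = m - i" using assms by simp
  moreover have "m - i \<noteq> i" using assms by presburger
  ultimately show ?thesis using False by simp
qed simp

text \<open>Since \<open>n\<close> and \<open>t\<close> are odd, the components \<open>(l, j)\<close> and \<open>(-l, -j)\<close> coincide for \<open>(0, 0)\<close> only.\<close>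

lemma Q_b_0:
  assumes y: "y \<in> comp l j" and lj: "l < n" "j < t" "l \<noteq> 0 \<or> j \<noteq> 0"
  shows "Q l j (b y) = 0"
proof -
  have b_y: "b y \<in> comp ((n - l) mod n) ((t - j) mod t)" by (rule b_comp[OF y lj(1,2)])
  show ?thesis
  proof (cases "l = 0")
    case False
    then have "(n - l) mod n \<noteq> l" using neg_mod_eq_self[OF odd_n lj(1)] by simp
    moreover have "P (l, False) (b y) = P (l, False) (P ((n - l) mod n, False) (b y))"
      using b_y by (simp add: comp_def)
    ultimately have "P (l, False) (b y) = 0"
      using n_pos lj by (subst (asm) P_P) (auto intro: b_M comp_M[OF y])
    then show ?thesis by (simp add: Q_def E_simps)
  next
    case True
    then have "(t - j) mod t \<noteq> j" using neg_mod_eq_self[OF odd_t lj(2)] lj(3) by simp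
    then show ?thesis
      using b_y True lj t_pos by (auto simp: Q_def comp_def E_eigenvector[where k = "(t - j) mod t"])
  qed
qed

lemma Q_b:
  assumes x: "x \<in> M"
  shows "Q 0 0 (b x) = b (Q 0 0 x)"
proof -
  define y where "y = P (0, False) x"
  have yM: "y \<in> M" using x by (simp add: y_def P_M)
  have "b y = (\<Sum>j<t. b (E j y))"
  proof -
    have "b (sum h {..<m}) = (\<Sum>i<m. b (h i))" for h :: "nat \<Rightarrow> 'w" and m
      by (induction m) (simp_all add: add_scale_simps)
    then show ?thesis using sum_E[OF yM] by metis
  qed
  then have "E 0 (b y) = (\<Sum>j<t. E 0 (b (E j y)))" by (simp add: E_sum)
  also have "\<dots> = (\<Sum>j<t. if j = 0 then b (E 0 y) else 0)"
  proof (rule sum.cong[OF refl])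
    fix j assume j: "j \<in> {..<t}"
    have "E j y \<in> comp 0 j" using Q_comp[OF x n_pos, of j] by (simp add: Q_def y_def)
    then have "b (E j y) \<in> comp 0 ((t - j) mod t)" using b_comp[of "E j y" 0 j] j n_pos by simp
    then have "E 0 (b (E j y)) = (if 0 = (t - j) mod t then b (E j y) else 0)"
      using j t_pos by (intro E_eigenvector) (auto simp: comp_def)
    then show "E 0 (b (E j y)) = (if j = 0 then b (E 0 y) else 0)" using j by auto
  qed
  also have "\<dots> = b (E 0 y)" using t_pos by (simp add: sum.delta)
  finally have "E 0 (b y) = b (E 0 y)" .
  moreover have "P (0, False) (b x) = b y" using b_P[OF x n_pos, of False] by (simp add: y_def)
  ultimately show ?thesis by (simp add: Q_def y_def)
qed

text \<open>On \<open>comp l j\<close> this is the nilpotent part of \<open>a\<close>.\<close>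

definition N where "N j x = a x - \<xi> ^ j *s x"

lemma linear_N: "Vector_Spaces.linear scale scale (N j)"
  by (rule linear_opI) (simp_all add: N_def add_scale_simps scale_right_distrib scale_right_diff_distrib mult.commute)

lemma N_pow_simps: "(N j ^^ i) (x + y) = (N j ^^ i) x + (N j ^^ i) y" "(N j ^^ i) (k *s x) = k *s (N j ^^ i) x"
    "(N j ^^ i) 0 = 0"
  using linear_funpow[OF linear_N, of i j] by (auto simp: Vector_Spaces.linear_iff) (metis scale_zero_left)

lemma a_comp: "y \<in> comp l j \<Longrightarrow> l < n \<Longrightarrow> a y \<in> comp l j"
  by (auto simp: comp_def a_M c_def funpow_swap1 add_scale_simps simp flip: a_P_rot)
     (metis add_scale_simps(2) funpow_swap1)

lemma N_comp: "y \<in> comp l j \<Longrightarrow> l < n \<Longrightarrow> N j y \<in> comp l j"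
  unfolding N_def by (intro subspace_diff[OF subspace_comp] subspace_scale[OF subspace_comp] a_comp)

lemma N_pow_comp: "y \<in> comp l j \<Longrightarrow> l < n \<Longrightarrow> (N j ^^ i) y \<in> comp l j"
  by (induction i) (simp_all add: N_comp)

lemma a_N: "a (N j y) = N j (a y)"
  by (simp add: N_def add_scale_simps)

lemma a_pow_N_pow: "(a ^^ i) ((N j ^^ k) y) = (N j ^^ k) ((a ^^ i) y)"
proof -
  have "a ((N j ^^ k) y) = (N j ^^ k) (a y)" for y by (induction k) (simp_all add: a_N)
  then show ?thesis by (induction i) simp_all
qed

lemma N_nilpotent:
  assumes "y \<in> comp l j"
  shows "(N j ^^ (p ^ s)) y = 0"
proof -
  have q: "0 < p ^ s" using prime_p by (simp add: prime_gt_0_nat)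
  have choose_0: "(of_nat (p ^ s choose i) :: 'k) = 0" if "i \<le> p ^ s" "i \<noteq> 0" "i \<noteq> p ^ s" for i
    using of_nat_choose_eq_0[OF char_p prime_p, of i s 1] that by simp
  have "(N j ^^ (p ^ s)) y = (\<Sum>i\<le>p ^ s. (of_nat (p ^ s choose i) * (- (\<xi> ^ j)) ^ (p ^ s - i)) *s (a ^^ i) y)"
    by (rule binomial_funpow[OF linear_a]) (simp add: N_def)
  also have "\<dots> = (\<Sum>i\<in>{0, p ^ s}. (of_nat (p ^ s choose i) * (- (\<xi> ^ j)) ^ (p ^ s - i)) *s (a ^^ i) y)"
    by (intro sum.mono_neutral_right) (auto simp: choose_0)
  also have "\<dots> = (- (\<xi> ^ j)) ^ (p ^ s) *s y + c y" using q by (simp add: c_def)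
  also have "(- (\<xi> ^ j)) ^ (p ^ s) = - (\<eta> ^ j)"
    using odd_p by (simp add: \<eta>_def power_minus_odd mult.commute flip: power_mult)
  finally show ?thesis using assms by (simp add: comp_def)
qed

text \<open>The index \<open>r\<close> is the one of \<open>N\<close> on the whole component, not just on the cyclic submodule of \<open>v\<close>.
  This is what makes the chain of \<open>v\<close> a direct summand: a functional composed with \<open>N\<^sup>q\<close> for
  \<open>q \<ge> r\<close> vanishes, so the dual functionals span a subspace stable under \<open>a\<close>.\<close>

lemma ex_nilpotency_index:
  assumes y: "y \<in> comp l j" "y \<noteq> 0"
  shows "\<exists>r v. 0 < r \<and> r \<le> p ^ s \<and> v \<in> comp l j \<and> (N j ^^ (r - 1)) v \<noteq> 0 \<and> (\<forall>z\<in>comp l j. (N j ^^ r) z = 0)"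
proof -
  define r where "r = (LEAST r. \<forall>z\<in>comp l j. (N j ^^ r) z = 0)"
  have ex: "\<forall>z\<in>comp l j. (N j ^^ (p ^ s)) z = 0" using N_nilpotent by blast
  have r: "\<forall>z\<in>comp l j. (N j ^^ r) z = 0" unfolding r_def by (rule LeastI[of "\<lambda>r. \<forall>z\<in>comp l j. (N j ^^ r) z = 0", OF ex])
  have "r \<le> p ^ s" unfolding r_def by (rule Least_le[of "\<lambda>r. \<forall>z\<in>comp l j. (N j ^^ r) z = 0", OF ex])
  moreover have "0 < r" using r y by (cases r) auto
  moreover have "\<exists>v\<in>comp l j. (N j ^^ (r - 1)) v \<noteq> 0"
    using not_less_Least[of "r - 1" "\<lambda>r. \<forall>z\<in>comp l j. (N j ^^ r) z = 0"] \<open>0 < r\<close> unfolding r_def[symmetric] by auto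
  ultimately show ?thesis using r by blast
qed

lemma a_pow_inj: "x \<in> M \<Longrightarrow> (a ^^ k) x = 0 \<Longrightarrow> x = 0"
proof -
  assume x: "x \<in> M" "(a ^^ k) x = 0"
  have "x = (a ^^ 0) x" by simp
  also have "\<dots> = (a ^^ (n * k - k + k)) x" using n_pos x by (intro a_pow_cong) simp_all
  also have "\<dots> = (a ^^ (n * k - k)) ((a ^^ k) x)" by (simp add: a_pow_add)
  finally show ?thesis using x by (simp add: a_pow_simps)
qed



text \<open>The functionals \<open>f0 (N\<^sup>q (Q m))\<close> are dual to the chain of \<open>v\<close>, and composing them with \<open>b\<close> gives the
  ones dual to the image of the chain under \<open>b\<close>. The two halves do not interfere because \<open>Q\<close> kills
  this image.\<close>

lemma splits_rotation:
  assumes y: "y \<in> comp l j" "y \<noteq> 0" and lj: "l < n" "j < t" "l \<noteq> 0 \<or> j \<noteq> 0"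
  shows "\<exists>r u f. 0 < r \<and> r \<le> p ^ s \<and>
    splits (2 * r) (\<lambda>i. (if i < r then l else (n - l) mod n, False)) u f \<and>
    (\<forall>m\<in>M. \<forall>q<r. f q (a m) = \<xi> ^ j * f q m + (if Suc q < r then f (Suc q) m else 0) \<and>
      f (r + q) m = f q (b m))"
proof -
  obtain r v where r: "0 < r" "r \<le> p ^ s" and v: "v \<in> comp l j" "(N j ^^ (r - 1)) v \<noteq> 0"
    and Nr: "\<And>z. z \<in> comp l j \<Longrightarrow> (N j ^^ r) z = 0"
    using ex_nilpotency_index[OF y] by blast
  obtain f0 where f0: "Vector_Spaces.linear scale (*) f0"
    and f0v: "\<And>i. f0 ((N j ^^ i) v) = of_bool (i = r - 1)"
    using ex_dual_functional[OF linear_N r(1) Nr[OF v(1)] v(2)] by blast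
  have f0_simps: "f0 (x + y) = f0 x + f0 y" "f0 (c *s x) = c * f0 x" for x y c
    using f0 by (simp_all add: Vector_Spaces.linear_iff)
  have f0_0: "f0 0 = 0" using f0_simps(2)[of 0 0] by simp
  define w where "w q = (N j ^^ (r - 1 - q)) v" for q
  define u where "u q = (if q < r then w q else b (w (q - r)))" for q
  define f where "f q m = (if q < r then f0 ((N j ^^ q) (Q l j m)) else f0 ((N j ^^ (q - r)) (Q l j (b m))))" for q m
  have w: "w q \<in> comp l j" for q unfolding w_def by (rule N_pow_comp[OF v(1) lj(1)])
  have wM: "w q \<in> M" for q using w by (rule comp_M)
  have uM: "u q \<in> M" for q by (simp add: u_def wM b_M)
  have u_in: "u q \<in> span (u ` {..<2 * r})" if "q < 2 * r" for q
    using that by (auto intro: span_base)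
  have w_in: "w q \<in> span (w ` {..<r})" if "q < r" for q
    using that by (auto intro: span_base)
  have aw: "a (w q) \<in> span (w ` {..<r})" if q: "q < r" for q
  proof -
    have "N j (w q) \<in> span (w ` {..<r})"
    proof (cases q)
      case 0
      then have "N j (w q) = 0" using Nr[OF v(1)] r(1) by (cases r) (simp_all add: w_def)
      then show ?thesis by (simp add: span_zero)
    next
      case (Suc q')
      then have "Suc (r - 1 - q) = r - 1 - q'" using q by simp
      then have "N j (w q) = w q'" by (metis w_def comp_apply funpow.simps(2))
      then show ?thesis using w_in[of q'] Suc q by simp
    qed
    moreover have "a (w q) = N j (w q) + \<xi> ^ j *s w q" by (simp add: N_def)
    ultimately show ?thesis using w_in[OF q] by (simp add: span_add span_scale)
  qed
  have a_span: "a x \<in> span (w ` {..<r})" if "x \<in> span (w ` {..<r})" for x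
    by (rule linear_span_into[OF linear_a _ that]) (auto intro: aw)
  then have a_pow_span: "(a ^^ k) x \<in> span (w ` {..<r})" if "x \<in> span (w ` {..<r})" for k x
    using that by (induction k) auto
  have b_span: "b x \<in> span (u ` {..<2 * r})" if "x \<in> span (w ` {..<r})" for x
  proof (rule linear_span_into[OF linear_b _ that])
    fix x assume "x \<in> w ` {..<r}"
    then obtain q where "q < r" "x = w q" by auto
    then show "b x \<in> span (u ` {..<2 * r})" using u_in[of "q + r"] by (simp add: u_def)
  qed
  have "w ` {..<r} \<subseteq> u ` {..<2 * r}" by (force simp: u_def)
  then have w_u: "span (w ` {..<r}) \<subseteq> span (u ` {..<2 * r})" by (rule span_mono)
  have Pw: "P g x \<in> {x, 0}" if "x \<in> comp l' j'" "l' < n" "g \<in> {..<n} \<times> UNIV" for g x l' j'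
  proof -
    have "P g x = P g (P (l', False) x)" using that by (simp add: comp_def)
    also have "\<dots> \<in> {x, 0}" using that by (subst P_P) (auto simp: comp_def)
    finally show ?thesis .
  qed
  have "splits (2 * r) (\<lambda>i. (if i < r then l else (n - l) mod n, False)) u f"
    unfolding splits_def
  proof (intro allI impI conjI ballI)
    fix q assume q: "q < 2 * r"
    show "u q \<in> M" by (rule uM)
    show "Vector_Spaces.linear scale (*) (f q)"
      by (rule functionalI) (simp_all add: f_def N_pow_simps Q_simps add_scale_simps f0_simps)
    show "a (u q) \<in> span (u ` {..<2 * r})"
    proof (cases "q < r")
      case True
      then show ?thesis using aw[of q] w_u by (auto simp: u_def)
    next
      case False
      then have "q - r < r" using q by simp
      then have "b ((a ^^ (n - 1)) (w (q - r))) \<in> span (u ` {..<2 * r})"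
        by (intro b_span a_pow_span w_in)
      moreover have "b ((a ^^ (n - 1)) (w (q - r))) = a (b (w (q - r)))"
        using b_a_pow[OF wM, of "n - 1" "q - r"] n_pos by (simp add: Suc_leI)
      ultimately show ?thesis using False by (simp add: u_def)
    qed
    show "b (u q) \<in> span (u ` {..<2 * r})"
    proof (cases "q < r")
      case True
      then show ?thesis using b_span[OF w_in[of q]] by (simp add: u_def)
    next
      case False
      then have "b (u q) = w (q - r)" by (simp add: u_def b_b wM)
      moreover have "q - r < r" using q False by simp
      ultimately show ?thesis using w_in[of "q - r"] w_u by auto
    qed
    show "P g (u q) \<in> span (u ` {..<2 * r})" if g: "g \<in> {..<n} \<times> UNIV" for g
    proof -
      have "P g (u q) \<in> {u q, 0}"
      proof (cases "q < r")
        case True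
        then show ?thesis using Pw[OF w[of q] lj(1) g] by (simp add: u_def)
      next
        case False
        then show ?thesis using Pw[OF b_comp[OF w[of "q - r"] lj(1,2)] _ g] n_pos by (simp add: u_def)
      qed
      then show ?thesis using u_in[OF q] span_zero by auto
    qed
    show "f p (u q) = of_bool (p = q)" if p: "p < 2 * r" for p
    proof -
      have dual: "f0 ((N j ^^ i) (w k)) = of_bool (i = k)" if "i < r" "k < r" for i k
      proof -
        have "(N j ^^ i) (w k) = (N j ^^ (i + (r - 1 - k))) v" by (simp add: w_def funpow_add)
        then show ?thesis using that f0v[of "i + (r - 1 - k)"] by auto
      qed
      have [simp]: "Q l j (w k) = w k" "Q l j (b (w k)) = 0" "b (b (w k)) = w k" for k
        using Q_id[OF w lj(2)] Q_b_0[OF w lj] wM b_b by auto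
      have "q - r < r" "p - r < r" if "\<not> q < r" "\<not> p < r" using that p q by auto
      then show ?thesis using p q
        by (cases "p < r"; cases "q < r") (auto simp: f_def u_def dual N_pow_simps f0_0)
    qed
    show "f q (P g m) = (if (if q < r then l else (n - l) mod n, False) = g then f q m else 0)"
      if g: "g \<in> {..<n} \<times> UNIV" and m: "m \<in> M" for g m
    proof -
      obtain i e where g': "g = (i, e)" "i < n" using g by auto
      have "(n - i) mod n = l \<longleftrightarrow> (n - l) mod n = i"
        using g'(2) lj(1) by (cases "i = 0"; cases "l = 0") auto
      then show ?thesis using g' m lj n_pos
        by (auto simp: f_def Q_P b_P b_M N_pow_simps f0_0)
    qed
  qed
  moreover have "f q (a m) = \<xi> ^ j * f q m + (if Suc q < r then f (Suc q) m else 0)" "f (r + q) m = f q (b m)"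
    if m: "m \<in> M" and q: "q < r" for m q
  proof -
    define z where "z = Q l j m"
    have z: "z \<in> comp l j" unfolding z_def by (rule Q_comp[OF m lj(1)])
    have "(N j ^^ q) (a z) = (N j ^^ Suc q) z + \<xi> ^ j *s (N j ^^ q) z"
    proof -
      have "a z = N j z + \<xi> ^ j *s z" by (simp add: N_def)
      then show ?thesis by (simp only: N_pow_simps funpow_Suc_right comp_apply)
    qed
    then have "f q (a m) = f0 ((N j ^^ Suc q) z) + \<xi> ^ j * f q m"
      using q m lj by (simp add: f_def Q_a z_def f0_simps)
    moreover have "f0 ((N j ^^ Suc q) z) = (if Suc q < r then f (Suc q) m else 0)"
    proof (cases "Suc q < r")
      case False
      then have "Suc q = r" using q by simp
      then show ?thesis using Nr[OF z] by (simp only: f0_0) simp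
    qed (simp add: f_def z_def)
    ultimately show "f q (a m) = \<xi> ^ j * f q m + (if Suc q < r then f (Suc q) m else 0)" by simp
    show "f (r + q) m = f q (b m)" using q by (simp add: f_def)
  qed
  ultimately show ?thesis using r by blast
qed

text \<open>Iterates \<open>a b N = a b a - a b = b - a b = - N b\<close>, for \<open>N = a - 1\<close>.\<close>

lemma a_pow_b_N_pow: "y \<in> M \<Longrightarrow> (a ^^ k) (b ((N 0 ^^ k) y)) = (- 1) ^ k *s (N 0 ^^ k) (b y)"
proof (induction k arbitrary: y)
  case (Suc k)
  have NM: "N 0 y \<in> M" using Suc.prems subspace_M by (simp add: N_def a_M subspace_diff)
  have "a (b (N 0 y)) = - N 0 (b y)"
    using Suc.prems by (simp add: N_def add_scale_simps a_b_a)
  have "(a ^^ Suc k) (b ((N 0 ^^ Suc k) y)) = a ((a ^^ k) (b ((N 0 ^^ k) (N 0 y))))"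
    by (simp only: funpow_Suc_right comp_apply flip: funpow_swap1)
  also have "\<dots> = a ((- 1) ^ k *s (N 0 ^^ k) (b (N 0 y)))"
    by (simp only: Suc.IH[OF NM])
  also have "\<dots> = (- 1) ^ k *s (N 0 ^^ k) (a (b (N 0 y)))"
    using a_pow_N_pow[of 1 k 0 "b (N 0 y)"] by (simp add: add_scale_simps)
  also have "a (b (N 0 y)) = (- 1) *s N 0 (b y)"
    using Suc.prems by (simp add: N_def add_scale_simps a_b_a)
  also have "(- 1) ^ k *s (N 0 ^^ k) ((- 1) *s N 0 (b y)) = (- 1) ^ Suc k *s (N 0 ^^ Suc k) (b y)"
    by (simp only: N_pow_simps scale_scale funpow_Suc_right comp_apply power_Suc2)
  finally show ?case .
qed simp

text \<open>Here \<open>b\<close> maps the component to itself, so both the chain and the functional have to be adapted to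
  \<open>b\<close>. The chain of \<open>v\<close> is stable under \<open>b\<close> if \<open>a b v = \<sigma> v\<close>, which a square root of \<open>a\<close> (a power of
  \<open>a\<close>, as \<open>n\<close> is odd) arranges from an eigenvector of \<open>b\<close>. The functional is averaged over the
  involution \<open>J = a\<^sup>r\<^sup>-\<^sup>1 b\<close>. With \<open>g J = \<tau> g\<close>, the functional \<open>g N\<^sup>q b\<close> equals
  \<open>(-1)\<^sup>q g a\<^sup>q b N\<^sup>q = (-1)\<^sup>q \<tau> g a\<^sup>e N\<^sup>q\<close> with \<open>e = r - 1 - q\<close>, and expanding \<open>a\<^sup>e = (1 + N)\<^sup>e\<close> produces
  the binomial coefficients that are, up to sign, the entries of \<open>T\<close>.\<close>

lemma splits_unipotent:
  assumes y: "y \<in> comp 0 0" "y \<noteq> 0"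
  shows "\<exists>\<sigma>\<in>{1, -1}. \<exists>r u f. 0 < r \<and> r \<le> p ^ s \<and> splits r (\<lambda>_. (0, False)) u f \<and>
    (\<forall>m\<in>M. \<forall>q<r. f q (a m) = f q m + (if Suc q < r then f (Suc q) m else 0) \<and>
      f q (b m) = \<sigma> * (- 1) ^ (r - 1 - q) *
        (\<Sum>i<r. if q \<le> i then of_nat ((r - 1 - q) choose (i - q)) * f i m else 0))"
proof -
  let ?N = "N 0"
  obtain r v0 where r: "0 < r" "r \<le> p ^ s" and v0: "v0 \<in> comp 0 0" "(?N ^^ (r - 1)) v0 \<noteq> 0"
    and Nr: "\<And>z. z \<in> comp 0 0 \<Longrightarrow> (?N ^^ r) z = 0"
    using ex_nilpotency_index[OF y] by blast
  have b_comp0: "b x \<in> comp 0 0" if "x \<in> comp 0 0" for x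
    using b_comp[OF that n_pos t_pos] by simp
  have "\<exists>\<sigma> w. \<sigma> \<in> {1, -1} \<and> w \<in> comp 0 0 \<and> (?N ^^ (r - 1)) w \<noteq> 0 \<and> b w = \<sigma> *s w"
    by (rule sign_eigenvector[OF b_comp0 subspace_comp _ linear_funpow[OF linear_N] v0 two_neq_0])
      (auto simp: comp_M)
  then obtain \<sigma> w where \<sigma>: "\<sigma> \<in> {1, -1}" and w: "w \<in> comp 0 0" "(?N ^^ (r - 1)) w \<noteq> 0" "b w = \<sigma> *s w"
    by blast
  have wM: "w \<in> M" using w(1) by (rule comp_M)
  define h where "h = (n + 1) div 2"
  have h: "2 * h = n + 1" "0 < h" "h \<le> n" using odd_n n_pos by (auto simp: h_def)
  \<comment> \<open>\<open>a\<^sup>h\<close> is a square root of \<open>a\<close>, and \<open>a b a\<^sup>h = a\<^sup>1\<^sup>-\<^sup>h b = a\<^sup>h b\<close>\<close>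
  define v where "v = (a ^^ h) w"
  have v: "v \<in> comp 0 0"
    unfolding v_def by (induction h) (simp_all add: w(1) a_comp n_pos)
  have vM: "v \<in> M" using v by (rule comp_M)
  have abv: "a (b v) = \<sigma> *s v"
  proof -
    have "a (b v) = (a ^^ Suc (n - h)) (b w)" using b_a_pow[OF wM h(3)] by (simp add: v_def)
    also have "Suc (n - h) = h" using h by simp
    finally show ?thesis by (simp add: v_def w(3) a_pow_simps)
  qed
  have Nv: "(?N ^^ (r - 1)) v \<noteq> 0"
  proof
    assume "(?N ^^ (r - 1)) v = 0"
    then have "(a ^^ h) ((?N ^^ (r - 1)) w) = 0" by (simp add: v_def a_pow_N_pow)
    moreover have "(?N ^^ (r - 1)) w \<in> M" using N_pow_comp[OF w(1) n_pos] by (rule comp_M)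
    ultimately show False using a_pow_inj w(2) by blast
  qed
  obtain f0 where f0: "Vector_Spaces.linear scale (*) f0"
    and f0v: "\<And>i. f0 ((?N ^^ i) v) = of_bool (i = r - 1)"
    using ex_dual_functional[OF linear_N r(1) Nr[OF v] Nv] by blast
  have f0_simps: "f0 (x + y) = f0 x + f0 y" "f0 (c *s x) = c * f0 x" for x y c
    using f0 by (simp_all add: Vector_Spaces.linear_iff)
  have a_binomial: "(a ^^ k) x = (\<Sum>i\<le>k. of_nat (k choose i) *s (?N ^^ i) x)" for k x
    using binomial_funpow[OF linear_N[of 0], of a 1 k x] by (simp add: N_def)
  have functional_sum: "g (\<Sum>i\<le>k. c i *s x i) = (\<Sum>i\<le>k. c i * g (x i))"
    if "\<And>x y. g (x + y) = g x + g y" "\<And>c x. g (c *s x) = c * g x" for g :: "'w \<Rightarrow> 'k" and c x and k :: nat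
    by (induction k) (simp_all add: that)
  \<comment> \<open>the sign with which \<open>J\<close> acts on \<open>N\<^sup>r\<^sup>-\<^sup>1 v\<close>, so that averaging does not change the value there\<close>
  define \<tau> where "\<tau> = \<sigma> * (- 1) ^ (r - 1)"
  have \<tau>\<tau>: "\<tau> * \<tau> = 1" using \<sigma> by (auto simp: \<tau>_def simp flip: power_mult_distrib)
  define J where "J x = (a ^^ (r - 1)) (b x)" for x
  have rn: "r - 1 \<le> n" using r(2) p_pow_le by simp
  have JJ: "J (J x) = x" if "x \<in> M" for x
  proof -
    have "J (J x) = (a ^^ (r - 1)) ((a ^^ (n - (r - 1))) (b (b x)))"
      using that rn by (simp add: J_def b_a_pow b_M)
    also have "\<dots> = x" using that rn by (simp add: a_pow_add b_b a_n)
    finally show ?thesis .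
  qed
  define g where "g x = (f0 x + \<tau> * f0 (J x)) / 2" for x
  have g_simps: "g (x + y) = g x + g y" "g (c *s x) = c * g x" for x y c
    by (simp_all add: g_def J_def add_scale_simps a_pow_simps f0_simps add_divide_distrib distrib_left mult.left_commute)
  have g_0: "g 0 = 0" using g_simps(2)[of 0 0] by simp
  have gJ: "g (J x) = \<tau> * g x" if "x \<in> M" for x
    using that \<tau>\<tau> by (simp add: g_def JJ algebra_simps)
  have gv: "g ((?N ^^ i) v) = of_bool (i = r - 1)" for i
  proof -
    consider "i < r - 1" | "i = r - 1" | "i \<ge> r" by linarith
    then show ?thesis
    proof cases
      case 1
      \<comment> \<open>\<open>J (N\<^sup>i v)\<close> is a combination of the vectors \<open>N\<^sup>k v\<close> with \<open>k \<le> r - 2\<close>, on which \<open>f0\<close> vanishes\<close>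
      have "J ((?N ^^ i) v) = (a ^^ (r - 2 - i)) (a ((a ^^ i) (b ((?N ^^ i) v))))"
      proof -
        have "r - 1 = r - 2 - i + Suc i" using 1 by simp
        then show ?thesis unfolding J_def by (metis a_pow_add comp_apply funpow.simps(2))
      qed
      also have "a ((a ^^ i) (b ((?N ^^ i) v))) = ((- 1) ^ i * \<sigma>) *s (?N ^^ i) v"
        using a_pow_N_pow[of 1 i 0 "b v"] by (simp add: a_pow_b_N_pow[OF vM] add_scale_simps abv N_pow_simps)
      finally have "J ((?N ^^ i) v) = ((- 1) ^ i * \<sigma>) *s (a ^^ (r - 2 - i)) ((?N ^^ i) v)"
        by (simp only: a_pow_simps)
      then have "f0 (J ((?N ^^ i) v)) = ((- 1) ^ i * \<sigma>) *
          (\<Sum>k\<le>r - 2 - i. of_nat ((r - 2 - i) choose k) * f0 ((?N ^^ (k + i)) v))"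
        by (simp only: f0_simps a_binomial functional_sum[OF f0_simps] funpow_add comp_apply)
      also have "(\<Sum>k\<le>r - 2 - i. of_nat ((r - 2 - i) choose k) * f0 ((?N ^^ (k + i)) v)) = 0"
        using 1 by (intro sum.neutral) (auto simp: f0v)
      finally show ?thesis using 1 f0v[of i] by (simp add: g_def)
    next
      case 2
      define z where "z = (?N ^^ (r - 1)) (b v)"
      have "?N z = 0"
        using Nr[OF b_comp0[OF v]] r(1) by (cases r) (simp_all add: z_def)
      then have "z = a z" by (simp add: N_def)
      also have "a z = \<sigma> *s (?N ^^ (r - 1)) v"
        using a_pow_N_pow[of 1 "r - 1" 0 "b v"] by (simp add: z_def abv N_pow_simps)
      finally have "J ((?N ^^ i) v) = \<tau> *s (?N ^^ (r - 1)) v"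
        unfolding J_def 2 a_pow_b_N_pow[OF vM] by (simp add: z_def \<tau>_def mult.commute)
      then show ?thesis using 2 f0v[of i] \<tau>\<tau> two_neq_0 by (simp add: g_def f0_simps)
    next
      case 3
      then have "(?N ^^ i) v = (?N ^^ (i - r)) ((?N ^^ r) v)"
        by (metis comp_apply funpow_add le_add_diff_inverse2)
      then show ?thesis using 3 r(1) Nr[OF v] by (simp add: N_pow_simps g_0)
    qed
  qed
  define u where "u q = (?N ^^ (r - 1 - q)) v" for q
  define f where "f q m = g ((?N ^^ q) (Q 0 0 m))" for q m
  have u: "u q \<in> comp 0 0" for q unfolding u_def by (rule N_pow_comp[OF v n_pos])
  have uM: "u q \<in> M" for q using u by (rule comp_M)
  have u_in: "u q \<in> span (u ` {..<r})" if "q < r" for q using that by (auto intro: span_base)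
  have N_in: "?N x \<in> span (u ` {..<r})" if "x \<in> span (u ` {..<r})" for x
  proof (rule linear_span_into[OF linear_N _ that])
    fix x assume "x \<in> u ` {..<r}"
    then obtain q where q: "q < r" "x = u q" by auto
    show "?N x \<in> span (u ` {..<r})"
    proof (cases q)
      case 0
      then have "?N x = 0" using Nr[OF v] r(1) q by (cases r) (simp_all add: u_def)
      then show ?thesis by (simp add: span_zero)
    next
      case (Suc q')
      then have "Suc (r - 1 - q) = r - 1 - q'" using q by simp
      then have "?N x = u q'" using q by (metis u_def comp_apply funpow.simps(2))
      then show ?thesis using u_in[of q'] Suc q by simp
    qed
  qed
  have N_pow_in: "(?N ^^ k) x \<in> span (u ` {..<r})" if "x \<in> span (u ` {..<r})" for k x
    using that by (induction k) (auto intro: N_in)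
  have a_in: "a x \<in> span (u ` {..<r})" if "x \<in> span (u ` {..<r})" for x
  proof -
    have "a x = ?N x + x" by (simp add: N_def)
    then show ?thesis using N_in[OF that] that by (simp add: span_add)
  qed
  have a_pow_in: "(a ^^ k) x \<in> span (u ` {..<r})" if "x \<in> span (u ` {..<r})" for k x
    using that by (induction k) (auto intro: a_in)
  have v_in: "v \<in> span (u ` {..<r})" using u_in[of "r - 1"] r(1) by (simp add: u_def)
  have bv_in: "b v \<in> span (u ` {..<r})"
  proof -
    have "b v = (a ^^ (n - 1)) (a (b v))"
      using a_n[of "b v"] n_pos vM by (metis Suc_diff_1 b_M comp_apply funpow_Suc_right)
    then show ?thesis using a_pow_in[OF span_scale[OF v_in]] by (simp add: abv)
  qed
  have "splits r (\<lambda>_. (0, False)) u f"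
    unfolding splits_def
  proof (intro allI impI conjI ballI)
    fix q assume q: "q < r"
    show "u q \<in> M" by (rule uM)
    show "Vector_Spaces.linear scale (*) (f q)"
      by (rule functionalI) (simp_all add: f_def N_pow_simps Q_simps g_simps)
    show "a (u q) \<in> span (u ` {..<r})" by (rule a_in[OF u_in[OF q]])
    show "b (u q) \<in> span (u ` {..<r})"
    proof -
      define k where "k = r - 1 - q"
      have kn: "k \<le> n" using rn by (simp add: k_def)
      have "b (u q) = (a ^^ (n - k)) ((a ^^ k) (b (u q)))"
        using kn uM[of q] by (simp add: a_pow_add a_n b_M)
      also have "(a ^^ k) (b (u q)) = (- 1) ^ k *s (?N ^^ k) (b v)"
        unfolding u_def k_def[symmetric] by (rule a_pow_b_N_pow[OF vM])
      finally show ?thesis by (simp only: a_pow_in span_scale N_pow_in bv_in)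
    qed
    show "P g (u q) \<in> span (u ` {..<r})" if g: "g \<in> {..<n} \<times> UNIV" for g
    proof -
      have "P g (u q) = P g (P (0, False) (u q))" using u[of q] by (simp add: comp_def)
      also have "\<dots> \<in> {u q, 0}" using g n_pos u[of q] by (subst P_P) (auto simp: comp_def)
      finally show ?thesis using u_in[OF q] span_zero by auto
    qed
    show "f p (u q) = of_bool (p = q)" if p: "p < r" for p
    proof -
      have "(?N ^^ p) (u q) = (?N ^^ (p + (r - 1 - q))) v" by (simp add: u_def funpow_add)
      then show ?thesis using p q by (auto simp: f_def Q_id[OF u t_pos] gv)
    qed
    show "f q (P g m) = (if (0, False) = g then f q m else 0)"
      if g: "g \<in> {..<n} \<times> UNIV" and m: "m \<in> M" for g m
      using Q_P[OF m n_pos g] by (auto simp: f_def N_pow_simps g_0)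
  qed
  moreover have "f q (a m) = f q m + (if Suc q < r then f (Suc q) m else 0)"
    "f q (b m) = \<sigma> * (- 1) ^ (r - 1 - q) *
        (\<Sum>i<r. if q \<le> i then of_nat ((r - 1 - q) choose (i - q)) * f i m else 0)"
    if m: "m \<in> M" and q: "q < r" for m q
  proof -
    define z where "z = Q 0 0 m"
    have z: "z \<in> comp 0 0" unfolding z_def by (rule Q_comp[OF m n_pos])
    have zM: "z \<in> M" using z by (rule comp_M)
    have "(?N ^^ q) (a z) = (?N ^^ Suc q) z + (?N ^^ q) z"
    proof -
      have "a z = ?N z + z" by (simp add: N_def)
      then show ?thesis by (simp only: N_pow_simps funpow_Suc_right comp_apply)
    qed
    then have "f q (a m) = g ((?N ^^ Suc q) z) + f q m"
      using q m n_pos by (simp add: f_def Q_a z_def g_simps)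
    moreover have "g ((?N ^^ Suc q) z) = (if Suc q < r then f (Suc q) m else 0)"
    proof (cases "Suc q < r")
      case False
      then have "Suc q = r" using q by simp
      then show ?thesis using Nr[OF z] by (simp only: g_0) simp
    qed (simp add: f_def z_def)
    ultimately show "f q (a m) = f q m + (if Suc q < r then f (Suc q) m else 0)" by simp
    define e where "e = r - 1 - q"
    have en: "e \<le> n" "r - 1 = q + e" using rn q by (auto simp: e_def)
    define x where "x = (a ^^ e) ((?N ^^ q) z)"
    have NzM: "(?N ^^ q) z \<in> M" using N_pow_comp[OF z n_pos] by (rule comp_M)
    have "f q (b m) = g ((?N ^^ q) (b z))" by (simp add: f_def Q_b[OF m] z_def)
    also have "(?N ^^ q) (b z) = (- 1) ^ q *s (a ^^ q) (b ((?N ^^ q) z))"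
      by (simp add: a_pow_b_N_pow[OF zM] flip: power_mult_distrib)
    also have "(a ^^ q) (b ((?N ^^ q) z)) = J x"
    proof -
      have "J x = (a ^^ (r - 1 + (n - e))) (b ((?N ^^ q) z))"
        unfolding J_def x_def b_a_pow[OF NzM en(1)] by (rule a_pow_add)
      also have "r - 1 + (n - e) = q + n" using en by simp
      also have "(a ^^ (q + n)) (b ((?N ^^ q) z)) = (a ^^ q) (b ((?N ^^ q) z))"
        by (rule a_pow_cong) (simp_all add: b_M NzM)
      finally show ?thesis by simp
    qed
    also have "g ((- 1) ^ q *s J x) = (- 1) ^ q * \<tau> * g x"
      by (simp add: g_simps gJ x_def a_pow_M NzM)
    also have "g x = (\<Sum>k\<le>e. of_nat (e choose k) * f (q + k) m)"
      by (simp add: x_def a_binomial functional_sum[OF g_simps] f_def z_def funpow_add add.commute[of q])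
    also have "\<dots> = (\<Sum>i\<in>{q..<r}. of_nat (e choose (i - q)) * f i m)"
      by (rule sum.reindex_bij_witness[of _ "\<lambda>i. i - q" "\<lambda>k. q + k"]) (use q in \<open>auto simp: e_def\<close>)
    also have "\<dots> = (\<Sum>i<r. if q \<le> i then of_nat (e choose (i - q)) * f i m else 0)"
      by (rule sum.mono_neutral_cong_left) auto
    also have "(- 1) ^ q * \<tau> = \<sigma> * (- 1) ^ e"
      unfolding \<tau>_def en(2) by (simp add: power_add mult.left_commute flip: power_mult_distrib)
    finally show "f q (b m) = \<sigma> * (- 1) ^ (r - 1 - q) *
        (\<Sum>i<r. if q \<le> i then of_nat ((r - 1 - q) choose (i - q)) * f i m else 0)"
      by (simp only: e_def)
  qed
  ultimately show ?thesis using \<sigma> r by blast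
qed

end


section \<open>Yetter-Drinfeld modules in terms of homogeneous components\<close>

lemma module_hom_iff_class_ring:
  "f \<in> LinearCombinations.module_hom class_ring M N \<longleftrightarrow>
    f \<in> carrier M \<rightarrow> carrier N \<and>
    (\<forall>x\<in>carrier M. \<forall>y\<in>carrier M. f (x \<oplus>\<^bsub>M\<^esub> y) = f x \<oplus>\<^bsub>N\<^esub> f y) \<and>
    (\<forall>k. \<forall>x\<in>carrier M. f (k \<odot>\<^bsub>M\<^esub> x) = k \<odot>\<^bsub>N\<^esub> f x)"
  by (auto simp: LinearCombinations.module_hom_def)

lemma finsum_tensor_kG:
  assumes M: "vectorspace class_ring M" and F: "F \<in> A \<rightarrow> carrier (tensor_kG G M)" and A: "finite A"
  shows "finsum (tensor_kG G M) F A = (\<lambda>k\<in>carrier G. finsum M (\<lambda>h. F h k) A)"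
proof -
  interpret M: vectorspace class_ring M by (rule M)
  interpret T: abelian_monoid "tensor_kG G M"
  proof (rule abelian_monoidI)
    fix x y z assume "x \<in> carrier (tensor_kG G M)" "y \<in> carrier (tensor_kG G M)" "z \<in> carrier (tensor_kG G M)"
    then have xyz: "x \<in> carrier G \<rightarrow>\<^sub>E carrier M" "y \<in> carrier G \<rightarrow>\<^sub>E carrier M" "z \<in> carrier G \<rightarrow>\<^sub>E carrier M"
      by (auto simp: tensor_kG_def)
    note mem = PiE_mem[OF xyz(1)] PiE_mem[OF xyz(2)] PiE_mem[OF xyz(3)]
    show "x \<oplus>\<^bsub>tensor_kG G M\<^esub> y \<in> carrier (tensor_kG G M)"
      using mem by (auto simp: tensor_kG_def)
    show "x \<oplus>\<^bsub>tensor_kG G M\<^esub> y \<oplus>\<^bsub>tensor_kG G M\<^esub> z = x \<oplus>\<^bsub>tensor_kG G M\<^esub> (y \<oplus>\<^bsub>tensor_kG G M\<^esub> z)"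
      using mem by (auto simp: tensor_kG_def M.a_assoc intro!: restrict_ext)
    show "\<zero>\<^bsub>tensor_kG G M\<^esub> \<oplus>\<^bsub>tensor_kG G M\<^esub> x = x"
    proof (rule extensionalityI[where A = "carrier G"])
      show "x \<in> extensional (carrier G)" using xyz(1) by (simp add: PiE_def)
    qed (use mem in \<open>auto simp: tensor_kG_def\<close>)
    show "x \<oplus>\<^bsub>tensor_kG G M\<^esub> y = y \<oplus>\<^bsub>tensor_kG G M\<^esub> x"
      using mem by (auto simp: tensor_kG_def M.a_comm intro!: restrict_ext)
  qed (auto simp: tensor_kG_def)
  show ?thesis using A F
  proof (induction A rule: finite_induct)
    case empty
    then show ?case unfolding T.finsum_empty by (simp add: tensor_kG_def)
  next
    case (insert i A)
    have F_mem: "F h k \<in> carrier M" if "h \<in> insert i A" "k \<in> carrier G" for h k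
      using insert.prems that by (force simp: tensor_kG_def Pi_def)
    have "finsum (tensor_kG G M) F (insert i A) = F i \<oplus>\<^bsub>tensor_kG G M\<^esub> finsum (tensor_kG G M) F A"
      using insert by (intro T.finsum_insert) auto
    also have "finsum (tensor_kG G M) F A = (\<lambda>k\<in>carrier G. finsum M (\<lambda>h. F h k) A)"
      using insert by auto
    finally show ?case
      using insert.hyps F_mem by (auto simp: tensor_kG_def M.finsum_insert intro!: restrict_ext)
  qed
qed

lemma (in group) conj_eq_iff:
  assumes "g \<in> carrier G" "h \<in> carrier G" "k \<in> carrier G"
  shows "k = g \<otimes> h \<otimes> inv g \<longleftrightarrow> inv g \<otimes> k \<otimes> g = h"
proof
  assume "k = g \<otimes> h \<otimes> inv g"
  moreover have "inv g \<otimes> (g \<otimes> h \<otimes> inv g) \<otimes> g = (inv g \<otimes> g) \<otimes> h \<otimes> (inv g \<otimes> g)"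
    using assms by (simp only: m_assoc m_closed inv_closed)
  ultimately show "inv g \<otimes> k \<otimes> g = h" using assms by simp
next
  assume "inv g \<otimes> k \<otimes> g = h"
  moreover have "g \<otimes> (inv g \<otimes> k \<otimes> g) \<otimes> inv g = (g \<otimes> inv g) \<otimes> k \<otimes> (g \<otimes> inv g)"
    using assms by (simp only: m_assoc m_closed inv_closed)
  ultimately show "k = g \<otimes> h \<otimes> inv g" using assms by simp
qed

context yetter_drinfeld begin

lemma coaction_closed: "m \<in> carrier M \<Longrightarrow> g \<in> carrier G \<Longrightarrow> coaction M m g \<in> carrier M"
  using coaction_linear by (auto simp: module_hom_iff_class_ring tensor_kG_def)

lemma coaction_ext: "m \<in> carrier M \<Longrightarrow> coaction M m \<in> carrier G \<rightarrow>\<^sub>E carrier M"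
  using coaction_linear by (auto simp: module_hom_iff_class_ring tensor_kG_def)

lemma coaction_add: "x \<in> carrier M \<Longrightarrow> y \<in> carrier M \<Longrightarrow> g \<in> carrier G \<Longrightarrow>
    coaction M (x \<oplus>\<^bsub>M\<^esub> y) g = coaction M x g \<oplus>\<^bsub>M\<^esub> coaction M y g"
  using coaction_linear by (auto simp: module_hom_iff_class_ring tensor_kG_def)

lemma coaction_smult: "x \<in> carrier M \<Longrightarrow> g \<in> carrier G \<Longrightarrow>
    coaction M (k \<odot>\<^bsub>M\<^esub> x) g = k \<odot>\<^bsub>M\<^esub> coaction M x g"
  using coaction_linear by (auto simp: module_hom_iff_class_ring tensor_kG_def)

lemma action_closed: "m \<in> carrier M \<Longrightarrow> g \<in> carrier G \<Longrightarrow> action M g m \<in> carrier M"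
  using action_linear[of g] by (auto simp: module_hom_iff_class_ring)

lemma action_add: "x \<in> carrier M \<Longrightarrow> y \<in> carrier M \<Longrightarrow> g \<in> carrier G \<Longrightarrow>
    action M g (x \<oplus>\<^bsub>M\<^esub> y) = action M g x \<oplus>\<^bsub>M\<^esub> action M g y"
  using action_linear[of g] by (auto simp: module_hom_iff_class_ring)

lemma action_smult: "x \<in> carrier M \<Longrightarrow> g \<in> carrier G \<Longrightarrow>
    action M g (k \<odot>\<^bsub>M\<^esub> x) = k \<odot>\<^bsub>M\<^esub> action M g x"
  using action_linear[of g] by (auto simp: module_hom_iff_class_ring)

text \<open>In the compatibility condition, only \<open>h = g\<^sup>-\<^sup>1 k g\<close> contributes to the coefficient of \<open>k\<close>.\<close>

lemma coaction_action:
  assumes "g \<in> carrier G" "k \<in> carrier G" "m \<in> carrier M"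
  shows "coaction M (action M g m) k = action M g (coaction M m (inv g \<otimes> k \<otimes> g))"
proof -
  have vs: "vectorspace class_ring M" by (rule vectorspace_axioms)
  define F where "F h = pure_tensor G M (action M g (coaction M m h)) (g \<otimes> h \<otimes> inv g)" for h
  have "F \<in> carrier G \<rightarrow> carrier (tensor_kG G M)"
    using assms by (auto simp: F_def pure_tensor_def tensor_kG_def coaction_closed action_closed)
  then have "finsum (tensor_kG G M) F (carrier G) k = finsum M (\<lambda>h. F h k) (carrier G)"
    using assms finsum_tensor_kG[OF vs _ finite_group, of F G] by simp
  moreover have "coaction M (action M g m) = finsum (tensor_kG G M) F (carrier G)"
    unfolding F_def[abs_def] by (rule compatible[OF assms(1,3)])
  ultimately have "coaction M (action M g m) k = finsum M (\<lambda>h. F h k) (carrier G)" by simp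
  also have "\<dots> = finsum M (\<lambda>h. if inv g \<otimes> k \<otimes> g = h then action M g (coaction M m h) else \<zero>\<^bsub>M\<^esub>) (carrier G)"
    using assms by (intro finsum_cong') (auto simp: F_def pure_tensor_def conj_eq_iff coaction_closed action_closed)
  also have "\<dots> = action M g (coaction M m (inv g \<otimes> k \<otimes> g))"
    using assms by (intro finsum_singleton) (auto simp: finite_group coaction_closed action_closed)
  finally show ?thesis .
qed

end

lemma yd_of_rep_simps [simp]:
  "carrier (yd_of_rep G d \<rho> \<delta>) = carrier_vec d"
  "add (yd_of_rep G d \<rho> \<delta>) = (+)"
  "zero (yd_of_rep G d \<rho> \<delta>) = 0\<^sub>v d"
  "module.smult (yd_of_rep G d \<rho> \<delta>) = (\<cdot>\<^sub>v)"
  "action (yd_of_rep G d \<rho> \<delta>) g v = \<rho> g *\<^sub>v v"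
  "coaction (yd_of_rep G d \<rho> \<delta>) v = (\<lambda>g\<in>carrier G. vec d (\<lambda>i. if \<delta> i = g then v $ i else 0))"
  by (simp_all add: yd_of_rep_def module.defs yd_module.defs module_vec_def)

lemma vectorspace_yd_of_rep: "vectorspace class_ring (yd_of_rep G d \<rho> \<delta> :: ('g, 'k::field, 'k vec) yd_module)"
  by (rule vs_criteria[OF class_field])
    (auto simp: add_smult_distrib_vec smult_add_distrib_vec smult_smult_assoc
      intro!: bexI[of _ "- _"])

lemma linear_map_class_ringI:
  assumes "vectorspace (class_ring :: 'k::field ring) M" "vectorspace class_ring N"
    "f \<in> LinearCombinations.module_hom class_ring M N"
  shows "linear_map class_ring M N f"
  using assms
  by (simp add: linear_map_def mod_hom_def mod_hom_axioms_def vectorspace_def)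

lemma fin_dim_yd_of_rep:
  fixes \<rho> :: "'g \<Rightarrow> 'k::field mat"
  shows "vectorspace.fin_dim class_ring (yd_of_rep G d \<rho> \<delta>)" "vectorspace.dim class_ring (yd_of_rep G d \<rho> \<delta>) = d"
proof -
  interpret V: vec_space "TYPE('k)" d .
  have "linear_map class_ring (module_vec TYPE('k) d) (yd_of_rep G d \<rho> \<delta>) id"
    by (intro linear_map_class_ringI vectorspace_yd_of_rep vec_vs)
      (auto simp: module_hom_iff_class_ring module_vec_simps)
  then interpret L: linear_map class_ring "module_vec TYPE('k) d" "yd_of_rep G d \<rho> \<delta>" id .
  show "vectorspace.fin_dim class_ring (yd_of_rep G d \<rho> \<delta>)"
    by (rule L.surj_fin_dim[OF V.fin_dim]) (simp add: module_vec_simps)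
  show "vectorspace.dim class_ring (yd_of_rep G d \<rho> \<delta>) = d"
    using L.dim_eq[OF V.fin_dim] V.dim_is_n by (simp add: module_vec_simps)
qed

lemma yd_isomorphic_dim:
  fixes \<rho> \<rho>' :: "'g \<Rightarrow> 'k::field mat"
  assumes "yd_isomorphic G (yd_of_rep G d \<rho> \<delta>) (yd_of_rep G d' \<rho>' \<delta>')"
  shows "d = d'"
proof -
  obtain f where f: "linear_map class_ring (yd_of_rep G d \<rho> \<delta>) (yd_of_rep G d' \<rho>' \<delta>') f"
    "bij_betw f (carrier (yd_of_rep G d \<rho> \<delta>)) (carrier (yd_of_rep G d' \<rho>' \<delta>'))"
    using assms unfolding yd_isomorphic_def by blast
  interpret L: linear_map class_ring "yd_of_rep G d \<rho> \<delta>" "yd_of_rep G d' \<rho>' \<delta>'" f by (rule f(1))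
  show ?thesis using L.dim_eq[OF fin_dim_yd_of_rep(1)] f(2) by (simp add: fin_dim_yd_of_rep(2) bij_betw_def)
qed

text \<open>For a basis of homogeneous vectors, compatibility of action and coaction is a condition on the
  non-zero matrix entries: \<open>\<rho> g\<close> has to send the vectors of degree \<open>h\<close> to vectors of degree \<open>g h g\<^sup>-\<^sup>1\<close>.\<close>

lemma yetter_drinfeld_yd_of_rep:
  fixes \<rho> :: "'g \<Rightarrow> 'k::field mat"
  assumes G: "group G" "finite (carrier G)"
    and dim: "\<And>g. g \<in> carrier G \<Longrightarrow> \<rho> g \<in> carrier_mat d d"
    and one: "\<rho> \<one>\<^bsub>G\<^esub> = 1\<^sub>m d"
    and mult: "\<And>g h. g \<in> carrier G \<Longrightarrow> h \<in> carrier G \<Longrightarrow> \<rho> (g \<otimes>\<^bsub>G\<^esub> h) = \<rho> g * \<rho> h"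
    and \<delta>: "\<And>i. i < d \<Longrightarrow> \<delta> i \<in> carrier G"
    and graded: "\<And>g i j. g \<in> carrier G \<Longrightarrow> i < d \<Longrightarrow> j < d \<Longrightarrow> \<rho> g $$ (i, j) \<noteq> 0 \<Longrightarrow>
      \<delta> i = g \<otimes>\<^bsub>G\<^esub> \<delta> j \<otimes>\<^bsub>G\<^esub> inv\<^bsub>G\<^esub> g"
  shows "yetter_drinfeld G (yd_of_rep G d \<rho> \<delta>)"
proof -
  let ?M = "yd_of_rep G d \<rho> \<delta>"
  interpret G: group G by (rule G(1))
  interpret M: vectorspace class_ring ?M by (rule vectorspace_yd_of_rep)
  have finsum_index: "finsum ?M F A $ i = (\<Sum>g\<in>A. F g $ i)" "finsum ?M F A \<in> carrier_vec d"
    if "F \<in> A \<rightarrow> carrier_vec d" "finite A" "i < d" for F and A :: "'g set" and i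
  proof -
    have "finsum ?M F A $ i = (\<Sum>g\<in>A. F g $ i) \<and> finsum ?M F A \<in> carrier_vec d"
      using that(2,1)
    proof (induction A rule: finite_induct)
      case (insert g A)
      then have "finsum ?M F (insert g A) = F g + finsum ?M F A"
        using M.finsum_insert[of A g F] by auto
      then show ?case using insert that(3) by (auto simp: Pi_def)
    qed (use that(3) in auto)
    then show "finsum ?M F A $ i = (\<Sum>g\<in>A. F g $ i)" "finsum ?M F A \<in> carrier_vec d" by auto
  qed
  have co: "coaction ?M v g = vec d (\<lambda>i. if \<delta> i = g then v $ i else 0)" if "g \<in> carrier G" for v g
    using that by simp
  have act_closed: "\<rho> g *\<^sub>v v \<in> carrier_vec d" if "g \<in> carrier G" "v \<in> carrier_vec d" for g v
    using dim[OF that(1)] that(2) by auto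
  show ?thesis
  proof (unfold_locales, goal_cases)
    case 1
    show ?case by (rule G(2))
  next
    case (2 g)
    then show ?case
      using dim[OF 2] by (auto simp: module_hom_iff_class_ring mult_add_distrib_mat_vec mult_mat_vec)
  next
    case (3 m)
    then show ?case by (simp add: one)
  next
    case (4 g h m)
    then show ?case using dim[of g] dim[of h] by (simp add: mult)
  next
    case 5
    show ?case
      by (auto simp: module_hom_iff_class_ring tensor_kG_def intro!: restrict_ext eq_vecI)
  next
    case (6 m g h)
    then show ?case by (auto simp: co intro!: eq_vecI)
  next
    case (7 m)
    have "finsum ?M (coaction ?M m) (carrier G) $ i = m $ i" if "i < d" for i
      using finsum_index(1)[of "coaction ?M m" "carrier G" i] G(2) that \<delta> 7
      by (auto simp: co sum.delta' cong: sum.cong if_cong)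
    moreover have "finsum ?M (coaction ?M m) (carrier G) \<in> carrier_vec d"
      using M.finsum_closed[of "coaction ?M m" "carrier G"] by auto
    ultimately show ?case using 7 by (intro eq_vecI) auto
  next
    case (8 g m)
    define F where "F h = pure_tensor G ?M (action ?M g (coaction ?M m h)) (g \<otimes>\<^bsub>G\<^esub> h \<otimes>\<^bsub>G\<^esub> inv\<^bsub>G\<^esub> g)" for h
    have co_closed: "vec d w \<in> carrier_vec d" for w :: "nat \<Rightarrow> 'k" by simp
    have F: "F \<in> carrier G \<rightarrow> carrier (tensor_kG G ?M)"
      using 8 by (auto simp: F_def pure_tensor_def tensor_kG_def act_closed)
    have "coaction ?M (action ?M g m) = (\<lambda>k\<in>carrier G. finsum ?M (\<lambda>h. F h k) (carrier G))"
    proof (rule extensionalityI[where A = "carrier G"])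
      fix k assume k: "k \<in> carrier G"
      have Fk: "(\<lambda>h. F h k) \<in> carrier G \<rightarrow> carrier_vec d"
        using 8 k by (auto simp: F_def pure_tensor_def act_closed)
      have "coaction ?M (action ?M g m) k = finsum ?M (\<lambda>h. F h k) (carrier G)"
      proof (rule eq_vecI)
        show "dim_vec (coaction ?M (action ?M g m) k) = dim_vec (finsum ?M (\<lambda>h. F h k) (carrier G))"
          using k M.finsum_closed[of "\<lambda>h. F h k" "carrier G"] Fk by auto
        fix i assume "i < dim_vec (finsum ?M (\<lambda>h. F h k) (carrier G))"
        then have i: "i < d" using M.finsum_closed[of "\<lambda>h. F h k" "carrier G"] Fk by auto
        have entry: "F h k $ i = (\<Sum>j<d. if k = g \<otimes>\<^bsub>G\<^esub> h \<otimes>\<^bsub>G\<^esub> inv\<^bsub>G\<^esub> g \<and> \<delta> j = h then \<rho> g $$ (i, j) * m $ j else 0)"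
          if h: "h \<in> carrier G" for h
          using dim[OF 8(1)] i h k 8
          by (auto simp: F_def pure_tensor_def scalar_prod_def lessThan_atLeast0 intro!: sum.cong)
        have "finsum ?M (\<lambda>h. F h k) (carrier G) $ i
            = (\<Sum>h\<in>carrier G. \<Sum>j<d. if k = g \<otimes>\<^bsub>G\<^esub> h \<otimes>\<^bsub>G\<^esub> inv\<^bsub>G\<^esub> g \<and> \<delta> j = h then \<rho> g $$ (i, j) * m $ j else 0)"
          using finsum_index(1)[OF Fk G(2) i] entry by simp
        also have "\<dots> = (\<Sum>j<d. \<Sum>h\<in>carrier G. if h = \<delta> j then (if k = g \<otimes>\<^bsub>G\<^esub> \<delta> j \<otimes>\<^bsub>G\<^esub> inv\<^bsub>G\<^esub> g then \<rho> g $$ (i,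
          j) * m $ j else 0) else 0)"
          by (subst sum.swap) (auto intro!: sum.cong)
        also have "\<dots> = (\<Sum>j<d. if k = g \<otimes>\<^bsub>G\<^esub> \<delta> j \<otimes>\<^bsub>G\<^esub> inv\<^bsub>G\<^esub> g then \<rho> g $$ (i, j) * m $ j else 0)"
          using \<delta> by (simp add: sum.delta[OF G(2)])
        also have "\<dots> = (\<Sum>j<d. if \<delta> i = k then \<rho> g $$ (i, j) * m $ j else 0)"
          using graded[OF 8(1) i] by (intro sum.cong refl) (metis lessThan_iff mult_zero_left)
        also have "\<dots> = coaction ?M (action ?M g m) k $ i"
          using dim[OF 8(1)] i k 8 by (auto simp: scalar_prod_def lessThan_atLeast0)
        finally show "coaction ?M (action ?M g m) k $ i = finsum ?M (\<lambda>h. F h k) (carrier G) $ i" by simp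
      qed
      then show "coaction ?M (action ?M g m) k = (\<lambda>k\<in>carrier G. finsum ?M (\<lambda>h. F h k) (carrier G)) k"
        using k by simp
    qed auto
    then have "coaction ?M (action ?M g m) = finsum (tensor_kG G ?M) F (carrier G)"
      by (simp only: finsum_tensor_kG[OF vectorspace_yd_of_rep F G(2)])
    then show ?case unfolding F_def[abs_def] .
  qed
qed


section \<open>The splitting criterion and coordinates\<close>

context dihedral_grading begin

lemma splits_expand:
  assumes "splits d \<delta> u f" "x \<in> span (u ` {..<d})"
  shows "x = (\<Sum>q<d. f q x *s u q)"
proof -
  have lin: "Vector_Spaces.linear scale (*) (f q)" if "q < d" for q using assms(1) that by (simp add: splits_def)
  have dual: "f p (u q) = of_bool (p = q)" if "p < d" "q < d" for p q using assms(1) that by (simp add: splits_def)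
  have add: "f q (x + y) = f q x + f q y" and sc: "f q (k *s x) = k * f q x" if "q < d" for q x y k
    using lin[OF that] by (simp_all add: Vector_Spaces.linear_iff)
  have z: "f q 0 = 0" if "q < d" for q using sc[OF that, of 0 0] by simp
  have "span (u ` {..<d}) \<subseteq> {x. x = (\<Sum>q<d. f q x *s u q)}"
  proof (rule span_minimal)
    show "u ` {..<d} \<subseteq> {x. x = (\<Sum>q<d. f q x *s u q)}"
    proof
      fix x assume "x \<in> u ` {..<d}"
      then obtain q where q: "q < d" "x = u q" by auto
      have "(\<Sum>p<d. f p x *s u p) = (\<Sum>p<d. if p = q then u q else 0)"
        using q by (intro sum.cong) (auto simp: dual)
      then show "x \<in> {x. x = (\<Sum>q<d. f q x *s u q)}" using q by (simp add: sum.delta)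
    qed
    have "x + y = (\<Sum>q<d. f q (x + y) *s u q)" if "x = (\<Sum>q<d. f q x *s u q)" "y = (\<Sum>q<d. f q y *s u q)" for x y
    proof -
      have "(\<Sum>q<d. f q (x + y) *s u q) = (\<Sum>q<d. f q x *s u q) + (\<Sum>q<d. f q y *s u q)"
        by (simp add: add scale_left_distrib sum.distrib)
      then show ?thesis using that by simp
    qed
    moreover have "k *s x = (\<Sum>q<d. f q (k *s x) *s u q)" if "x = (\<Sum>q<d. f q x *s u q)" for x k
    proof -
      have "(\<Sum>q<d. f q (k *s x) *s u q) = k *s (\<Sum>q<d. f q x *s u q)"
        by (simp add: sc scale_sum_right)
      then show ?thesis using that by simp
    qed
    ultimately show "subspace {x. x = (\<Sum>q<d. f q x *s u q)}"
      unfolding subspace_def by (auto simp: z)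
  qed
  then show ?thesis using assms(2) by blast
qed

end

lemma (in group) inv_mult_mult_eq:
  assumes "g \<in> carrier G" "k \<in> carrier G" "h \<in> carrier G" "g \<otimes> h = k \<otimes> g"
  shows "inv g \<otimes> k \<otimes> g = h"
proof -
  have "inv g \<otimes> k \<otimes> g = inv g \<otimes> (g \<otimes> h)" using assms by (simp add: m_assoc)
  also have "\<dots> = (inv g \<otimes> g) \<otimes> h" using assms by (simp only: m_assoc inv_closed)
  finally show ?thesis using assms by simp
qed

lemma yd_submoduleI:
  assumes "vectorspace (class_ring :: 'k::field ring) M" "N \<subseteq> carrier M" "\<zero>\<^bsub>M\<^esub> \<in> N"
    "\<And>x y. x \<in> N \<Longrightarrow> y \<in> N \<Longrightarrow> x \<oplus>\<^bsub>M\<^esub> y \<in> N" "\<And>k x. x \<in> N \<Longrightarrow> k \<odot>\<^bsub>M\<^esub> x \<in> N"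
    "\<And>g x. g \<in> carrier G \<Longrightarrow> x \<in> N \<Longrightarrow> action M g x \<in> N"
    "\<And>x. x \<in> N \<Longrightarrow> coaction M x \<in> carrier G \<rightarrow>\<^sub>E N"
  shows "yd_submodule G N M"
  using assms by (auto simp: yd_submodule_def VectorSpace.subspace_def submodule_def vectorspace_def)

text \<open>The kernel of \<open>\<rho>\<close> is a submodule that is complementary to \<open>S\<close>; as \<open>S\<close> is not zero and \<open>M\<close> is
  indecomposable, the kernel is zero.\<close>

lemma yd_isomorphic_if_split:
  fixes M :: "('g, 'k::field, 'v, 'b) yd_module_scheme" and X :: "('g, 'k, 'w, 'c) yd_module_scheme"
  assumes M: "yd_indecomposable G M" and X: "yetter_drinfeld G X"
    and hom: "\<rho> \<in> LinearCombinations.module_hom class_ring M X"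
    and act: "\<And>g m. g \<in> carrier G \<Longrightarrow> m \<in> carrier M \<Longrightarrow> \<rho> (action M g m) = action X g (\<rho> m)"
    and coact: "\<And>g m. g \<in> carrier G \<Longrightarrow> m \<in> carrier M \<Longrightarrow> coaction X (\<rho> m) g = \<rho> (coaction M m g)"
    and S: "yd_submodule G S M" and inj: "\<And>x. x \<in> S \<Longrightarrow> \<rho> x = \<zero>\<^bsub>X\<^esub> \<Longrightarrow> x = \<zero>\<^bsub>M\<^esub>"
    and surj: "\<rho> ` S = carrier X" and nz: "carrier X \<noteq> {\<zero>\<^bsub>X\<^esub>}"
  shows "yd_isomorphic G M X"
proof -
  have ydM: "yetter_drinfeld G M" using M by (simp add: yd_indecomposable_def)
  interpret M: yetter_drinfeld G M by (rule ydM)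
  interpret X: yetter_drinfeld G X by (rule X)
  have lin: "linear_map class_ring M X \<rho>"
    by (rule linear_map_class_ringI[OF M.vectorspace_axioms X.vectorspace_axioms hom])
  interpret L: linear_map class_ring M X \<rho> by (rule lin)
  have S_sub: "S \<subseteq> carrier M" using S by (auto simp: yd_submodule_def VectorSpace.subspace_def submodule_def)
  define K where "K = {m \<in> carrier M. \<rho> m = \<zero>\<^bsub>X\<^esub>}"
  have add: "\<rho> (x \<oplus>\<^bsub>M\<^esub> y) = \<rho> x \<oplus>\<^bsub>X\<^esub> \<rho> y" if "x \<in> carrier M" "y \<in> carrier M" for x y
    using hom that by (simp add: module_hom_iff_class_ring)
  have smult: "\<rho> (k \<odot>\<^bsub>M\<^esub> x) = k \<odot>\<^bsub>X\<^esub> \<rho> x" if "x \<in> carrier M" for k x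
    using hom that by (simp add: module_hom_iff_class_ring)
  have closed: "\<rho> x \<in> carrier X" if "x \<in> carrier M" for x
    using hom that by (auto simp: module_hom_iff_class_ring)
  have X0: "action X g \<zero>\<^bsub>X\<^esub> = \<zero>\<^bsub>X\<^esub>" "coaction X \<zero>\<^bsub>X\<^esub> g = \<zero>\<^bsub>X\<^esub>" if "g \<in> carrier G" for g
    using X.action_smult[OF X.zero_closed that, of 0] X.coaction_smult[OF X.zero_closed that, of 0]
      X.action_closed[OF X.zero_closed that] X.coaction_closed[OF X.zero_closed that]
      X.lmult_0 by auto
  have K: "yd_submodule G K M"
  proof (rule yd_submoduleI[OF M.vectorspace_axioms])
    show "coaction M x \<in> carrier G \<rightarrow>\<^sub>E K" if "x \<in> K" for x
      using that M.coaction_ext[of x] coact[of _ x, symmetric] X0 M.coaction_closed[of x]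
      by (auto simp: K_def PiE_iff)
  qed (auto simp: K_def add smult act X0 M.action_closed)
  have sum: "module.submodule_sum M S K = carrier M"
  proof
    show "module.submodule_sum M S K \<subseteq> carrier M"
      using S_sub by (auto simp: M.submodule_sum_def K_def)
    show "carrier M \<subseteq> module.submodule_sum M S K"
    proof
      fix m assume m: "m \<in> carrier M"
      obtain x where x: "x \<in> S" "\<rho> x = \<rho> m" using surj closed[OF m] by (metis imageE)
      have xM: "x \<in> carrier M" using x S_sub by auto
      have "m \<ominus>\<^bsub>M\<^esub> x \<in> K" using m xM x closed[OF m] by (simp add: K_def)
      moreover have "m = x \<oplus>\<^bsub>M\<^esub> (m \<ominus>\<^bsub>M\<^esub> x)"
        using m xM by (simp add: M.minus_eq M.a_lcomm M.r_neg)
      ultimately show "m \<in> module.submodule_sum M S K"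
        using x(1) by (auto simp: M.submodule_sum_def image_iff)
    qed
  qed
  have z: "\<zero>\<^bsub>M\<^esub> \<in> S" "\<zero>\<^bsub>M\<^esub> \<in> K"
    using S by (auto simp: yd_submodule_def VectorSpace.subspace_def submodule_def K_def)
  have "x = \<zero>\<^bsub>M\<^esub>" if "x \<in> S" "x \<in> K" for x
    using inj[OF that(1)] that(2) unfolding K_def by blast
  then have "S \<inter> K = {\<zero>\<^bsub>M\<^esub>}" using z by blast
  with M S K sum have "S = {\<zero>\<^bsub>M\<^esub>} \<or> K = {\<zero>\<^bsub>M\<^esub>}"
    unfolding yd_indecomposable_def by blast
  moreover have "S \<noteq> {\<zero>\<^bsub>M\<^esub>}" using surj nz by auto
  ultimately have "K = {\<zero>\<^bsub>M\<^esub>}" by blast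
  have "inj_on \<rho> (carrier M)"
  proof (rule inj_onI)
    fix x y assume xy: "x \<in> carrier M" "y \<in> carrier M" "\<rho> x = \<rho> y"
    then have "x \<ominus>\<^bsub>M\<^esub> y \<in> K" using closed[of y] by (simp add: K_def)
    then have "x \<ominus>\<^bsub>M\<^esub> y = \<zero>\<^bsub>M\<^esub>" using \<open>K = {\<zero>\<^bsub>M\<^esub>}\<close> by blast
    then show "x = y" using xy by simp
  qed
  moreover have "\<rho> ` carrier M = carrier X" using surj S_sub closed by blast
  ultimately have "bij_betw \<rho> (carrier M) (carrier X)" by (simp add: bij_betw_def)
  then show ?thesis unfolding yd_isomorphic_def using lin act coact by blast
qed

lemma action_dihedral:
  assumes "yetter_drinfeld (dihedral n) M" "i < n" "m \<in> carrier M"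
  shows "action M (i, e) m = (action M (dih_a n) ^^ i) (if e then action M dih_b m else m)"
  using assms(2)
proof (induction i)
  interpret M: yetter_drinfeld "dihedral n" M by (rule assms(1))
  {
    case 0
    then show ?case using M.action_one[OF assms(3)] by (auto simp: dihedral_simps dih_b_def)
  next
    case (Suc i)
    have "(Suc i, e) = dih_a n \<otimes>\<^bsub>dihedral n\<^esub> (i, e)" using Suc.prems by (simp add: dih_a_def dihedral_simps)
    moreover have "dih_a n \<in> carrier (dihedral n)" "(i, e) \<in> carrier (dihedral n)"
      using Suc.prems by (simp_all add: dih_a_def dihedral_simps)
    ultimately have "action M (Suc i, e) m = action M (dih_a n) (action M (i, e) m)"
      using M.action_mult assms(3) by simp
    then show ?case using Suc by simp
  }
qed

lemma action_dihedral_induct: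
  assumes M: "yetter_drinfeld (dihedral n) M" and g: "g \<in> carrier (dihedral n)" and N: "N \<subseteq> carrier M"
    and a: "\<And>x. x \<in> N \<Longrightarrow> action M (dih_a n) x \<in> N" and b: "\<And>x. x \<in> N \<Longrightarrow> action M dih_b x \<in> N"
    and x: "x \<in> N"
  shows "action M g x \<in> N"
proof -
  obtain i e where g': "g = (i, e)" "i < n" using g by (cases g) (auto simp: dihedral_simps)
  have "(action M (dih_a n) ^^ i) y \<in> N" if "y \<in> N" for y using that by (induction i) (auto intro: a)
  then show ?thesis using action_dihedral[OF M g'(2), of x e] g' x N b by auto
qed

lemma equivariant_dihedralI:
  assumes M: "yetter_drinfeld (dihedral n) M" and X: "yetter_drinfeld (dihedral n) X"
    and closed: "\<And>m. m \<in> carrier M \<Longrightarrow> \<rho> m \<in> carrier X"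
    and a: "\<And>m. m \<in> carrier M \<Longrightarrow> \<rho> (action M (dih_a n) m) = action X (dih_a n) (\<rho> m)"
    and b: "\<And>m. m \<in> carrier M \<Longrightarrow> \<rho> (action M dih_b m) = action X dih_b (\<rho> m)"
    and g: "g \<in> carrier (dihedral n)" and m: "m \<in> carrier M"
  shows "\<rho> (action M g m) = action X g (\<rho> m)"
proof -
  interpret M: yetter_drinfeld "dihedral n" M by (rule M)
  obtain i e where g': "g = (i, e)" "i < n" using g by (cases g) (auto simp: dihedral_simps)
  have ab: "dih_a n \<in> carrier (dihedral n)" "dih_b \<in> carrier (dihedral n)"
    using g' by (auto simp: dihedral_simps dih_a_def dih_b_def)
  have "(action M (dih_a n) ^^ i) y \<in> carrier M \<and> \<rho> ((action M (dih_a n) ^^ i) y) = (action X (dih_a n) ^^ i) (\<rho> y)"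
    if "y \<in> carrier M" for y
    using that by (induction i) (simp_all add: a M.action_closed ab)
  then show ?thesis
    using action_dihedral[OF M g'(2) m, of e] action_dihedral[OF X g'(2) closed[OF m], of e] g' m b
    by (simp add: M.action_closed ab)
qed

text \<open>The elements of a finite basis index the coordinates, so that the type of all functions
  \<open>'v \<Rightarrow> 'k\<close> can serve as the ambient space of \<open>M\<close>. The map \<open>d\<close> forms linear combinations of the
  basis; it is defined on all functions and ignores their values elsewhere.\<close>

lemma ex_coordinates:
  fixes M :: "('k::field, 'v, 'b) module_scheme"
  assumes M: "vectorspace class_ring M" and fin: "vectorspace.fin_dim class_ring M"
  obtains c :: "'v \<Rightarrow> 'v \<Rightarrow> 'k" and d where
    "\<And>x y. x \<in> carrier M \<Longrightarrow> y \<in> carrier M \<Longrightarrow> c (x \<oplus>\<^bsub>M\<^esub> y) = c x + c y"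
    "\<And>k x. x \<in> carrier M \<Longrightarrow> c (k \<odot>\<^bsub>M\<^esub> x) = (\<lambda>v. k * c x v)"
    "\<And>f. d f \<in> carrier M" "\<And>f g. d (f + g) = d f \<oplus>\<^bsub>M\<^esub> d g"
    "\<And>k f. d (\<lambda>v. k * f v) = k \<odot>\<^bsub>M\<^esub> d f" "\<And>x. x \<in> carrier M \<Longrightarrow> d (c x) = x"
proof -
  interpret M: vectorspace class_ring M by (rule M)
  obtain A where A: "finite A" "M.basis A" using M.finite_basis_exists[OF fin] by blast
  have AM: "A \<subseteq> carrier M" using A(2) by (simp add: M.basis_def)
  have crit: "\<exists>!a. a \<in> A \<rightarrow>\<^sub>E UNIV \<and> M.lincomb a A = v" if "v \<in> carrier M" for v
    using M.basis_criterion[OF A(1) AM] A(2) that by simp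
  define d where "d x = M.lincomb x A" for x
  have d_closed: "d x \<in> carrier M" for x unfolding d_def by (rule M.lincomb_closed[OF AM]) simp
  have d_restrict: "d (restrict x A) = d x" for x
    unfolding d_def by (rule M.lincomb_cong) (auto simp: AM)
  have d_zero_ext: "d (\<lambda>v. if v \<in> A then x v else 0) = d x" for x
    unfolding d_def by (rule M.lincomb_cong) (auto simp: AM)
  have d_inj: "x = y" if "d x = d y" "\<And>v. v \<notin> A \<Longrightarrow> x v = 0" "\<And>v. v \<notin> A \<Longrightarrow> y v = 0" for x y
  proof
    have "restrict x A \<in> A \<rightarrow>\<^sub>E UNIV \<and> M.lincomb (restrict x A) A = d x"
      "restrict y A \<in> A \<rightarrow>\<^sub>E UNIV \<and> M.lincomb (restrict y A) A = d x"
      using that(1) d_restrict[of x] d_restrict[of y] by (auto simp: d_def)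
    then have "restrict x A = restrict y A"
      using crit[OF d_closed[of x]] by blast
    then show "x v = y v" for v using that(2,3) by (metis restrict_apply')
  qed
  have d_add: "d (x + y) = d x \<oplus>\<^bsub>M\<^esub> d y" for x y
    unfolding d_def M.lincomb_def using AM
    by (subst M.finsum_addf[symmetric]) (auto simp: plus_fun_def M.smult_l_distr[OF _ _ subsetD[OF AM],
      simplified] intro!: M.finsum_cong')
  have d_smult: "d (\<lambda>v. k * x v) = k \<odot>\<^bsub>M\<^esub> d x" for k x
    using M.lincomb_smult[OF AM, of x k] by (simp add: d_def)
  have "\<exists>x. d x = m \<and> (\<forall>v. v \<notin> A \<longrightarrow> x v = 0)" if m: "m \<in> carrier M" for m
  proof -
    obtain a where "M.lincomb a A = m" using crit[OF m] by blast
    then have "d (\<lambda>v. if v \<in> A then a v else 0) = m" using d_zero_ext[of a] by (simp add: d_def)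
    then show ?thesis by (intro exI conjI) auto
  qed
  then obtain c where c: "\<And>m. m \<in> carrier M \<Longrightarrow> d (c m) = m" "\<And>m v. m \<in> carrier M \<Longrightarrow> v \<notin> A \<Longrightarrow> c m v = 0"
    by metis
  have "c (x \<oplus>\<^bsub>M\<^esub> y) = c x + c y" if "x \<in> carrier M" "y \<in> carrier M" for x y
  proof (rule d_inj)
    show "d (c (x \<oplus>\<^bsub>M\<^esub> y)) = d (c x + c y)"
      unfolding d_add using that by (simp add: c(1))
  qed (use that in \<open>simp_all add: c(2)\<close>)
  moreover have "c (k \<odot>\<^bsub>M\<^esub> x) = (\<lambda>v. k * c x v)" if "x \<in> carrier M" for k x
  proof (rule d_inj)
    show "d (c (k \<odot>\<^bsub>M\<^esub> x)) = d (\<lambda>v. k * c x v)"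
      unfolding d_smult using that by (simp add: c(1))
  qed (use that in \<open>simp_all add: c(2)\<close>)
  ultimately show thesis by (rule that[OF _ _ d_closed d_add d_smult c(1)])
qed

text \<open>The embedding \<open>c\<close> and its left inverse \<open>d\<close> carry the structure of \<open>M\<close> over to operators on the
  function space, where it becomes a \<open>dihedral_grading\<close>.\<close>

locale yd_coordinates = yetter_drinfeld "dihedral n" M
  for n and M :: "(nat \<times> bool, 'k::field, 'v, 'b) yd_module_scheme" +
  fixes c :: "'v \<Rightarrow> 'v \<Rightarrow> 'k" and d
  assumes odd_n': "odd n"
    and c_add: "\<lbrakk>x \<in> carrier M; y \<in> carrier M\<rbrakk> \<Longrightarrow> c (x \<oplus>\<^bsub>M\<^esub> y) = c x + c y"
    and c_smult: "x \<in> carrier M \<Longrightarrow> c (k \<odot>\<^bsub>M\<^esub> x) = (\<lambda>v. k * c x v)"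
    and d_closed: "d f \<in> carrier M"
    and d_add: "d (f + g) = d f \<oplus>\<^bsub>M\<^esub> d g"
    and d_smult: "d (\<lambda>v. k * f v) = k \<odot>\<^bsub>M\<^esub> d f"
    and d_c: "x \<in> carrier M \<Longrightarrow> d (c x) = x"
begin

definition sc :: "'k \<Rightarrow> ('v \<Rightarrow> 'k) \<Rightarrow> 'v \<Rightarrow> 'k" where "sc k x = (\<lambda>v. k * x v)"
definition A where "A x = c (action M (dih_a n) (d x))"
definition B where "B x = c (action M dih_b (d x))"
definition Pr where "Pr g x = (if g \<in> carrier (dihedral n) then c (coaction M (d x) g) else 0)"

lemma n_pos': "0 < n" using odd_n' by (rule odd_pos)

lemma ab_carrier: "dih_a n \<in> carrier (dihedral n)" "dih_b \<in> carrier (dihedral n)"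
  by (rule dihedral_relations[OF n_pos'])+

lemma A_c: "m \<in> carrier M \<Longrightarrow> A (c m) = c (action M (dih_a n) m)"
  by (simp add: A_def d_c)

lemma B_c: "m \<in> carrier M \<Longrightarrow> B (c m) = c (action M dih_b m)"
  by (simp add: B_def d_c)

lemma Pr_c: "m \<in> carrier M \<Longrightarrow> g \<in> carrier (dihedral n) \<Longrightarrow> Pr g (c m) = c (coaction M m g)"
  by (simp add: Pr_def d_c)

lemma c_zero: "c \<zero>\<^bsub>M\<^esub> = 0"
  using c_add[of "\<zero>\<^bsub>M\<^esub>" "\<zero>\<^bsub>M\<^esub>"] by simp

lemma c_finsum: "F \<in> I \<rightarrow> carrier M \<Longrightarrow> c (finsum M F I) = (\<Sum>i\<in>I. c (F i))"
  by (induction I rule: infinite_finite_induct) (simp_all add: c_zero c_add Pi_def)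

lemma coaction_action':
  assumes "g \<in> carrier (dihedral n)" "k \<in> carrier (dihedral n)" "h \<in> carrier (dihedral n)"
    "m \<in> carrier M" "g \<otimes>\<^bsub>dihedral n\<^esub> h = k \<otimes>\<^bsub>dihedral n\<^esub> g"
  shows "coaction M (action M g m) k = action M g (coaction M m h)"
  using coaction_action[OF assms(1,2,4)]
    group.inv_mult_mult_eq[OF group_dihedral[OF n_pos'] assms(1-3,5)] by simp

sublocale W: vector_space sc
  by unfold_locales (simp_all add: sc_def fun_eq_iff algebra_simps)

lemma dihedral_grading_coordinates: "dihedral_grading sc n A B Pr (c ` carrier M)"
proof -
  have vs: "vector_space sc" by (rule W.vector_space_axioms)
  have linI: "Vector_Spaces.linear sc sc F" if "\<And>x y. F (x + y) = F x + F y" "\<And>k x. F (sc k x) = sc k (F x)" for F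
    using that vs by (simp add: Vector_Spaces.linear_iff)
  note cl = action_closed coaction_closed ab_carrier
  have carr: "carrier (dihedral n) = {..<n} \<times> UNIV" by (rule dihedral_simps)
  show ?thesis
  proof (rule dihedral_grading.intro[OF vs], rule dihedral_grading_axioms.intro, goal_cases)
    case 1 show ?case by (rule odd_n')
  next
    case 2
    have "x + y \<in> c ` carrier M" if "x \<in> c ` carrier M" "y \<in> c ` carrier M" for x y
      using that by (auto simp flip: c_add)
    moreover have "sc k x \<in> c ` carrier M" if "x \<in> c ` carrier M" for k x
      using that by (auto simp: sc_def simp flip: c_smult)
    moreover have "0 \<in> c ` carrier M" using c_zero by (metis imageI zero_closed)
    ultimately show ?case unfolding W.subspace_def by blast
  next
    case 3
    show ?case by (rule linI) (simp_all add: A_def sc_def d_add d_smult action_add action_smult c_add c_smult d_closed cl)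
  next
    case 4
    show ?case by (rule linI) (simp_all add: B_def sc_def d_add d_smult action_add action_smult c_add c_smult d_closed cl)
  next
    case (5 g)
    show ?case by (rule linI) (simp_all add: Pr_def sc_def d_add d_smult coaction_add coaction_smult c_add
      c_smult d_closed cl zero_fun_def)
  next
    case (6 x) then show ?case by (auto simp: A_c cl)
  next
    case (7 x) then show ?case by (auto simp: B_c cl)
  next
    case (8 x g)
    then show ?case using c_zero by (cases "g \<in> carrier (dihedral n)") (auto simp: Pr_c cl, auto simp: Pr_def
      intro!: image_eqI[of 0 c "\<zero>\<^bsub>M\<^esub>"])
  next
    case (9 x)
    then obtain m where m: "m \<in> carrier M" "x = c m" by auto
    have "(A ^^ i) (c m) = c (action M (dih_a n [^]\<^bsub>dihedral n\<^esub> i) m)" for i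
    proof (induction i)
      case (Suc i)
      have "dih_a n [^]\<^bsub>dihedral n\<^esub> Suc i = dih_a n \<otimes>\<^bsub>dihedral n\<^esub> dih_a n [^]\<^bsub>dihedral n\<^esub> i"
        by (rule monoid.nat_pow_Suc2[OF group.is_monoid[OF group_dihedral[OF n_pos']] ab_carrier(1)])
      then show ?case using Suc m by (simp add: A_c cl action_mult)
    qed (use m in \<open>simp add: action_one\<close>)
    from this[of n] show ?case using m dihedral_relations(3)[OF n_pos'] by (simp add: action_one)
  next
    case (10 x)
    then obtain m where m: "m \<in> carrier M" "x = c m" by auto
    have "dih_b \<otimes>\<^bsub>dihedral n\<^esub> dih_b = \<one>\<^bsub>dihedral n\<^esub>" by (simp add: dih_b_def dihedral_simps)
    then show ?case using m by (simp add: B_c cl action_one flip: action_mult)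
  next
    case (11 x)
    then obtain m where m: "m \<in> carrier M" "x = c m" by auto
    have "dih_a n \<otimes>\<^bsub>dihedral n\<^esub> (dih_b \<otimes>\<^bsub>dihedral n\<^esub> dih_a n) = dih_b"
      using n_pos' by (cases "n = 1") (auto simp: dih_b_def dih_a_def dihedral_simps)
    then show ?case using m by (simp add: B_c A_c cl flip: action_mult)
  next
    case (12 x g h)
    then obtain m where m: "m \<in> carrier M" "x = c m" by auto
    then show ?case using 12 coaction_coassoc[of m g h] by (auto simp: Pr_c cl carr c_zero)
  next
    case (13 x)
    then obtain m where m: "m \<in> carrier M" "x = c m" by auto
    have "(\<Sum>g\<in>carrier (dihedral n). Pr g x) = c (finsum M (coaction M m) (carrier (dihedral n)))"
      using m by (subst c_finsum) (auto simp: cl Pr_c)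
    then show ?case using m coaction_counit[OF m(1)] by (simp add: carr)
  next
    case (14 x i)
    then obtain m where m: "m \<in> carrier M" "x = c m" by auto
    have "coaction M (action M (dih_a n) m) (i, False) = action M (dih_a n) (coaction M m (i, False))"
      using 14 m by (intro coaction_action') (auto simp: ab_carrier, auto simp: carr dih_a_def dihedral_simps
        mod_simps add.commute)
    moreover have "(i, False) \<in> carrier (dihedral n)" using 14 by (simp add: carr)
    ultimately show ?case using m by (simp add: Pr_c A_c cl)
  next
    case (15 x i)
    then obtain m where m: "m \<in> carrier M" "x = c m" by auto
    have "coaction M (action M (dih_a n) m) ((i + 2) mod n, True) = action M (dih_a n) (coaction M m (i, True))"
    proof (rule coaction_action')
      have rot: "(i + 2 + (n - 1 mod n)) mod n = (1 + i) mod n"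
      proof (cases "n = 1")
        case False
        then have "i + 2 + (n - 1 mod n) = 1 + i + n" using n_pos' by simp
        then show ?thesis by (simp only: mod_add_self2)
      qed simp
      show "dih_a n \<otimes>\<^bsub>dihedral n\<^esub> (i, True) = ((i + 2) mod n, True) \<otimes>\<^bsub>dihedral n\<^esub> dih_a n"
        by (simp only: dih_a_def dihedral_simps mod_add_left_eq if_True if_False rot) simp
    qed (use 15 m n_pos' ab_carrier in \<open>simp_all add: carr\<close>)
    moreover have "(i, True) \<in> carrier (dihedral n)" "((i + 2) mod n, True) \<in> carrier (dihedral n)"
      using 15 n_pos' by (simp_all add: carr)
    ultimately show ?case using m by (simp add: Pr_c A_c cl)
  next
    case (16 x i e)
    then obtain m where m: "m \<in> carrier M" "x = c m" by auto
    have "coaction M (action M dih_b m) ((n - i) mod n, e) = action M dih_b (coaction M m (i, e))"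
      using 16 m n_pos' by (intro coaction_action') (auto simp: ab_carrier, auto simp: carr dih_b_def
        dihedral_simps mod_simps)
    moreover have "(i, e) \<in> carrier (dihedral n)" "((n - i) mod n, e) \<in> carrier (dihedral n)"
      using 16 n_pos' by (simp_all add: carr)
    ultimately show ?case using m by (simp add: Pr_c B_c cl)
  qed
qed

sublocale W: dihedral_grading sc n A B Pr "c ` carrier M"
  by (rule dihedral_grading_coordinates)

text \<open>The functionals form the homomorphism \<open>R\<close> of the splitting criterion and the span of the \<open>u q\<close> is
  the submodule \<open>S\<close>. Equivariance for \<open>a\<close> and \<open>b\<close> extends
  to the group that they generate.\<close>

lemma isomorphic_if_splits:
  assumes ind: "yd_indecomposable (dihedral n) M"
    and sp: "W.splits D \<delta> u f" and D: "0 < D"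
    and X: "yetter_drinfeld (dihedral n) (yd_of_rep (dihedral n) D \<rho> \<delta>')"
    and \<delta>: "\<And>q. q < D \<Longrightarrow> \<delta>' q = \<delta> q"
    and a: "\<And>m. m \<in> c ` carrier M \<Longrightarrow> vec D (\<lambda>p. f p (A m)) = \<rho> (dih_a n) *\<^sub>v vec D (\<lambda>p. f p m)"
    and b: "\<And>m. m \<in> c ` carrier M \<Longrightarrow> vec D (\<lambda>p. f p (B m)) = \<rho> dih_b *\<^sub>v vec D (\<lambda>p. f p m)"
  shows "yd_isomorphic (dihedral n) M (yd_of_rep (dihedral n) D \<rho> \<delta>')"
proof -
  let ?X = "yd_of_rep (dihedral n) D \<rho> \<delta>'"
  let ?S = "W.span (u ` {..<D})"
  have carr: "carrier (dihedral n) = {..<n} \<times> UNIV" by (rule dihedral_simps)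
  define R where "R m = vec D (\<lambda>p. f p (c m))" for m
  define S where "S = {m \<in> carrier M. c m \<in> ?S}"
  have yd: "yetter_drinfeld (dihedral n) M" using ind by (simp add: yd_indecomposable_def)
  have f_lin: "f q (x + y) = f q x + f q y" "f q (sc k x) = k * f q x" if "q < D" for q x y k
    using sp that by (simp_all add: W.splits_def Vector_Spaces.linear_iff)
  have f_0: "f q 0 = 0" if "q < D" for q using f_lin(2)[OF that, of 0 0] by simp
  have dual: "f p (u q) = of_bool (p = q)" if "p < D" "q < D" for p q
    using sp that by (simp add: W.splits_def)
  have fP: "f q (Pr g x) = (if \<delta> q = g then f q x else 0)"
    if "q < D" "g \<in> carrier (dihedral n)" "x \<in> c ` carrier M" for q g x
    using sp that unfolding W.splits_def carr by blast
  have uM: "u q \<in> c ` carrier M" if "q < D" for q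
    using sp that by (simp add: W.splits_def)
  have aS: "A x \<in> ?S" if "x \<in> ?S" for x
    by (rule W.linear_span_into[OF W.linear_a _ that]) (use sp in \<open>auto simp: W.splits_def\<close>)
  have bS: "B x \<in> ?S" if "x \<in> ?S" for x
    by (rule W.linear_span_into[OF W.linear_b _ that]) (use sp in \<open>auto simp: W.splits_def\<close>)
  have PS: "Pr g x \<in> ?S" if "g \<in> carrier (dihedral n)" "x \<in> ?S" for g x
    by (rule W.linear_span_into[OF W.linear_P _ that(2)]) (use sp that(1) in \<open>auto simp: W.splits_def carr\<close>)
  have scale_S: "(\<lambda>v. k * x v) \<in> ?S" if "x \<in> ?S" for k x
    using W.span_scale[OF that, of k] by (simp add: sc_def)
  have S_M: "?S \<subseteq> c ` carrier M"
    by (rule W.span_minimal[OF _ W.subspace_M]) (use uM in auto)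
  have RX: "R m \<in> carrier_vec D" for m by (simp add: R_def)
  show ?thesis
  proof (rule yd_isomorphic_if_split[OF ind X, of R S])
    show "R \<in> LinearCombinations.module_hom class_ring M ?X"
      by (auto simp: module_hom_iff_class_ring R_def c_add c_smult f_lin(1) f_lin(2)[unfolded sc_def])
    have Ra: "R (action M (dih_a n) m) = action ?X (dih_a n) (R m)" if "m \<in> carrier M" for m
      using that a[of "c m"] by (simp add: R_def A_c)
    have Rb: "R (action M dih_b m) = action ?X dih_b (R m)" if "m \<in> carrier M" for m
      using that b[of "c m"] by (simp add: R_def B_c)
    show "R (action M g m) = action ?X g (R m)" if "g \<in> carrier (dihedral n)" "m \<in> carrier M" for g m
      by (rule equivariant_dihedralI[OF yd X _ Ra Rb that]) (simp_all add: RX)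
    show "coaction ?X (R m) g = R (coaction M m g)" if "g \<in> carrier (dihedral n)" "m \<in> carrier M" for g m
      using that fP[of _ g "c m"] \<delta> by (auto simp: R_def Pr_c[symmetric] intro!: eq_vecI)
    show "yd_submodule (dihedral n) S M"
    proof (rule yd_submoduleI[OF vectorspace_axioms])
      show S_sub: "S \<subseteq> carrier M" by (auto simp: S_def)
      show "action M g x \<in> S" if "g \<in> carrier (dihedral n)" "x \<in> S" for g x
        by (rule action_dihedral_induct[OF yd that(1) S_sub _ _ that(2)])
          (auto simp: S_def action_closed ab_carrier simp flip: A_c B_c intro: aS bS)
      show "coaction M x \<in> carrier (dihedral n) \<rightarrow>\<^sub>E S" if "x \<in> S" for x
        using that coaction_ext[of x] by (auto simp: S_def PiE_iff coaction_closed simp flip: Pr_c intro: PS)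
    qed (auto simp: S_def c_zero c_add c_smult W.span_zero W.span_add scale_S)
    show "x = \<zero>\<^bsub>M\<^esub>" if "x \<in> S" "R x = \<zero>\<^bsub>?X\<^esub>" for x
    proof -
      have "f q (c x) = 0" if "q < D" for q
        using \<open>R x = \<zero>\<^bsub>?X\<^esub>\<close> that by (auto simp: R_def dest!: arg_cong[of _ _ "\<lambda>v. v $ q"])
      then have "c x = 0" using W.splits_expand[OF sp, of "c x"] that(1) by (simp add: S_def)
      then show ?thesis using d_c[of x] d_c[of "\<zero>\<^bsub>M\<^esub>"] that(1) c_zero by (simp add: S_def)
    qed
    show "R ` S = carrier ?X"
    proof
      show "R ` S \<subseteq> carrier ?X" using RX by auto
      show "carrier ?X \<subseteq> R ` S"
      proof
        fix y assume "y \<in> carrier ?X"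
        then have y: "y \<in> carrier_vec D" by simp
        define x where "x = (\<Sum>q<D. sc (y $ q) (u q))"
        have xS: "x \<in> ?S" unfolding x_def by (intro W.span_sum W.span_scale W.span_base) auto
        then obtain m where m: "m \<in> carrier M" "x = c m" using S_M by auto
        have "f p x = y $ p" if p: "p < D" for p
        proof -
          interpret fp: Vector_Spaces.linear sc "(*)" "f p"
            using sp p by (simp add: W.splits_def)
          have "f p (\<Sum>q\<in>I. sc (y $ q) (u q)) = (\<Sum>q\<in>I. y $ q * f p (u q))" for I
            by (simp only: fp.sum fp.scale)
          then have "f p x = (\<Sum>q<D. y $ q * f p (u q))" by (simp only: x_def)
          also have "\<dots> = (\<Sum>q<D. if q = p then y $ q else 0)"
            using p by (intro sum.cong) (auto simp: dual)
          finally have "f p x = (\<Sum>q<D. if q = p then y $ q else 0)" .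
          then show ?thesis using p by simp
        qed
        then have "R m $ p = y $ p" if "p < D" for p using that m(2) by (simp add: R_def)
        then have "R m = y" using y RX[of m] by (intro eq_vecI) auto
        moreover have "m \<in> S" using m xS by (simp add: S_def)
        ultimately show "y \<in> R ` S" by blast
      qed
    qed
    show "carrier ?X \<noteq> {\<zero>\<^bsub>?X\<^esub>}"
    proof
      assume "carrier ?X = {\<zero>\<^bsub>?X\<^esub>}"
      then have "carrier_vec D = {0\<^sub>v D :: 'k vec}" by (simp only: yd_of_rep_simps)
      then have "unit_vec D 0 = (0\<^sub>v D :: 'k vec)" using unit_vec_carrier[of D 0] by blast
      then have "unit_vec D 0 $ 0 = (0\<^sub>v D :: 'k vec) $ 0" by (rule arg_cong)
      then show False using D by simp
    qed
  qed
qed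

end


section \<open>Matrix representations of the dihedral group\<close>

lemma pow_mat_add:
  assumes A: "A \<in> carrier_mat d d"
  shows "A ^\<^sub>m (i + j) = A ^\<^sub>m i * (A ^\<^sub>m j :: 'k::semiring_1 mat)"
proof (induction j)
  case 0
  show ?case using pow_carrier_mat[OF A, of i] A by simp
next
  case (Suc j)
  have "A ^\<^sub>m (i + Suc j) = (A ^\<^sub>m i * A ^\<^sub>m j) * A" using Suc by simp
  also have "\<dots> = A ^\<^sub>m i * (A ^\<^sub>m j * A)"
    by (rule assoc_mult_mat[OF pow_carrier_mat[OF A] pow_carrier_mat[OF A] A])
  finally show ?case by simp
qed

lemma pow_mat_mult:
  fixes A :: "'k::semiring_1 mat"
  assumes A: "A \<in> carrier_mat d d"
  shows "A ^\<^sub>m (i * j) = (A ^\<^sub>m i) ^\<^sub>m j"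
proof (induction j)
  case 0
  show ?case using pow_carrier_mat[OF A, of i] A by simp
next
  case (Suc j)
  have "A ^\<^sub>m (i * Suc j) = A ^\<^sub>m (i * j + i)" by (simp add: add.commute)
  also have "\<dots> = A ^\<^sub>m (i * j) * A ^\<^sub>m i" by (rule pow_mat_add[OF A])
  finally show ?case using Suc by simp
qed

lemma pow_mat_one: "(1\<^sub>m d :: 'k::semiring_1 mat) ^\<^sub>m k = 1\<^sub>m d"
  by (induction k) simp_all

lemma pow_mat_mod:
  assumes A: "A \<in> carrier_mat d d" "A ^\<^sub>m n = 1\<^sub>m d"
  shows "A ^\<^sub>m (k mod n) = (A ^\<^sub>m k :: 'k::semiring_1 mat)"
proof -
  have "A ^\<^sub>m k = A ^\<^sub>m (n * (k div n) + k mod n)" by simp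
  also have "\<dots> = A ^\<^sub>m (n * (k div n)) * A ^\<^sub>m (k mod n)" by (rule pow_mat_add[OF A(1)])
  also have "A ^\<^sub>m (n * (k div n)) = 1\<^sub>m d"
    by (simp add: pow_mat_mult[OF A(1)] A(2) pow_mat_one)
  finally show ?thesis by (simp add: left_mult_one_mat[OF pow_carrier_mat[OF A(1)]])
qed

lemma dih_rep_gens:
  assumes "A \<in> carrier_mat d d" "B \<in> carrier_mat d d" "1 < n"
  shows "dih_rep A B (dih_a n) = A" "dih_rep A B dih_b = B"
  using assms by (auto simp: dih_rep_def dih_a_def dih_b_def)

lemma dih_rep_mult:
  fixes A B :: "'k::field mat"
  assumes A: "A \<in> carrier_mat d d" "A ^\<^sub>m n = 1\<^sub>m d" and B: "B \<in> carrier_mat d d" "B * B = 1\<^sub>m d"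
    and ABA: "A * (B * A) = B"
    and g: "g \<in> carrier (dihedral n)" and h: "h \<in> carrier (dihedral n)"
  shows "dih_rep A B (g \<otimes>\<^bsub>dihedral n\<^esub> h) = dih_rep A B g * dih_rep A B h"
proof -
  obtain i e j f where gh: "g = (i, e)" "h = (j, f)" "i < n" "j < n"
    using g h by (cases g, cases h) (auto simp: dihedral_simps)
  have Ak: "A ^\<^sub>m k \<in> carrier_mat d d" for k by (rule pow_carrier_mat[OF A(1)])
  have dimA: "dim_row A = d" using A(1) by simp
  define Bf where "Bf e = (if e then B else 1\<^sub>m d)" for e
  have Bf: "Bf e \<in> carrier_mat d d" for e using B(1) by (simp add: Bf_def)
  have rep: "dih_rep A B (k, e) = A ^\<^sub>m k * Bf e" for k e
    by (simp add: dih_rep_def Bf_def dimA)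
  show ?thesis
  proof (cases e)
    case False
    have "dih_rep A B (g \<otimes>\<^bsub>dihedral n\<^esub> h) = A ^\<^sub>m (i + j) * Bf f"
      using False by (simp add: gh dihedral_simps rep pow_mat_mod[OF A])
    also have "\<dots> = A ^\<^sub>m i * (A ^\<^sub>m j * Bf f)"
      by (simp add: pow_mat_add[OF A(1)] assoc_mult_mat[OF Ak Ak Bf])
    also have "\<dots> = A ^\<^sub>m i * Bf e * (A ^\<^sub>m j * Bf f)"
      using False right_mult_one_mat[OF Ak, of i] by (simp add: Bf_def)
    finally show ?thesis by (simp add: gh rep)
  next
    case True
    have "A ^\<^sub>m k * (B * A ^\<^sub>m k) = B" for k
    proof (induction k)
      case 0 then show ?case using B(1) dimA by simp
    next
      case (Suc k)
      have "A ^\<^sub>m Suc k * (B * A ^\<^sub>m Suc k) = A ^\<^sub>m k * A * (B * (A * A ^\<^sub>m k))"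
        using pow_mat_add[OF A(1), of 1 k] A(1) by (simp add: dimA)
      also have "\<dots> = A ^\<^sub>m k * (A * (B * A) * A ^\<^sub>m k)"
        using A(1) B(1) Ak[of k] by (simp add: assoc_mult_mat[where ?n\<^sub>1 = d and ?n\<^sub>2 = d and ?n\<^sub>3 = d and ?n\<^sub>4 = d])
      finally show ?case by (simp add: ABA Suc)
    qed
    note conj = this[of j]
    have "A ^\<^sub>m (n - j) * B = A ^\<^sub>m (n - j) * (A ^\<^sub>m j * (B * A ^\<^sub>m j))" by (simp only: conj)
    also have "\<dots> = A ^\<^sub>m (n - j) * A ^\<^sub>m j * (B * A ^\<^sub>m j)"
      by (rule assoc_mult_mat[symmetric, OF Ak Ak mult_carrier_mat[OF B(1) Ak]])
    also have "A ^\<^sub>m (n - j) * A ^\<^sub>m j = 1\<^sub>m d"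
      using gh(4) by (simp add: A(2) flip: pow_mat_add[OF A(1)])
    finally have BA: "B * A ^\<^sub>m j = A ^\<^sub>m (n - j) * B" using left_mult_one_mat[OF mult_carrier_mat[OF B(1) Ak]] by simp
    have "B * Bf f = Bf (e \<noteq> f)" using True B by (simp add: Bf_def)
    then have "dih_rep A B (g \<otimes>\<^bsub>dihedral n\<^esub> h) = A ^\<^sub>m (i + (n - j)) * (B * Bf f)"
      using True by (simp add: gh dihedral_simps rep pow_mat_mod[OF A])
    also have "\<dots> = A ^\<^sub>m i * (A ^\<^sub>m (n - j) * B) * Bf f"
      using Ak B(1) Bf mult_carrier_mat[OF Ak[of "n - j"] B(1)]
        by (simp add: pow_mat_add[OF A(1)] assoc_mult_mat[where ?n\<^sub>1 = d and ?n\<^sub>2 = d and ?n\<^sub>3 = d and ?n\<^sub>4 = d])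
    also have "\<dots> = A ^\<^sub>m i * B * (A ^\<^sub>m j * Bf f)"
      unfolding BA[symmetric]
      using Ak B(1) Bf mult_carrier_mat[OF Ak[of i] B(1)] mult_carrier_mat[OF Ak[of j] Bf[of f]]
        mult_carrier_mat[OF B(1) Ak[of j]]
      by (simp add: assoc_mult_mat[where ?n\<^sub>1 = d and ?n\<^sub>2 = d and ?n\<^sub>3 = d and ?n\<^sub>4 = d])
    finally show ?thesis using True by (simp add: gh rep Bf_def)
  qed
qed

text \<open>The condition on the non-zero entries of \<open>\<rho> g\<close> is inherited by products, so it need only be checked
  for \<open>a\<close> and \<open>b\<close>.\<close>

lemma yetter_drinfeld_dihedralI:
  fixes \<rho> :: "nat \<times> bool \<Rightarrow> 'k::field mat"
  assumes n: "0 < n"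
    and dim: "\<And>g. g \<in> carrier (dihedral n) \<Longrightarrow> \<rho> g \<in> carrier_mat d d"
    and one: "\<rho> \<one>\<^bsub>dihedral n\<^esub> = 1\<^sub>m d"
    and mult: "\<And>g h. g \<in> carrier (dihedral n) \<Longrightarrow> h \<in> carrier (dihedral n) \<Longrightarrow>
      \<rho> (g \<otimes>\<^bsub>dihedral n\<^esub> h) = \<rho> g * \<rho> h"
    and \<delta>: "\<And>i. i < d \<Longrightarrow> \<delta> i \<in> carrier (dihedral n)"
    and a: "\<And>i j. i < d \<Longrightarrow> j < d \<Longrightarrow> \<rho> (dih_a n) $$ (i, j) \<noteq> 0 \<Longrightarrow>
      \<delta> i \<otimes>\<^bsub>dihedral n\<^esub> dih_a n = dih_a n \<otimes>\<^bsub>dihedral n\<^esub> \<delta> j"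
    and b: "\<And>i j. i < d \<Longrightarrow> j < d \<Longrightarrow> \<rho> dih_b $$ (i, j) \<noteq> 0 \<Longrightarrow>
      \<delta> i \<otimes>\<^bsub>dihedral n\<^esub> dih_b = dih_b \<otimes>\<^bsub>dihedral n\<^esub> \<delta> j"
  shows "yetter_drinfeld (dihedral n) (yd_of_rep (dihedral n) d \<rho> \<delta>)"
proof -
  interpret D: group "dihedral n" by (rule group_dihedral[OF n])
  have ab: "dih_a n \<in> carrier (dihedral n)" "dih_b \<in> carrier (dihedral n)"
    by (rule dihedral_relations[OF n])+
  have graded: "\<delta> i \<otimes>\<^bsub>dihedral n\<^esub> (k, e) = (k, e) \<otimes>\<^bsub>dihedral n\<^esub> \<delta> j"
    if "k < n" "i < d" "j < d" "\<rho> (k, e) $$ (i, j) \<noteq> 0" for k e i j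
    using that
  proof (induction k arbitrary: i)
    case 0
    show ?case
    proof (cases e)
      case True
      then show ?thesis using b[of i j] 0 by (simp add: dih_b_def)
    next
      case False
      then have "i = j" using 0 one by (auto simp: dihedral_simps split: if_splits)
      then show ?thesis using False \<delta>[of j] 0 D.r_one[of "\<delta> j"] D.l_one[of "\<delta> j"] by (simp add: dihedral_simps(3))
    qed
  next
    case (Suc k)
    have ke: "(k, e) \<in> carrier (dihedral n)" using Suc.prems by (simp add: dihedral_simps)
    have S: "(Suc k, e) = dih_a n \<otimes>\<^bsub>dihedral n\<^esub> (k, e)"
      using Suc.prems by (simp add: dih_a_def dihedral_simps)
    have "(\<Sum>m<d. \<rho> (dih_a n) $$ (i, m) * \<rho> (k, e) $$ (m, j)) \<noteq> 0"
      using Suc.prems dim[OF ab(1)] dim[OF ke]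
      by (simp add: S mult[OF ab(1) ke] scalar_prod_def lessThan_atLeast0)
    then have "\<exists>m<d. \<rho> (dih_a n) $$ (i, m) * \<rho> (k, e) $$ (m, j) \<noteq> 0"
      by (metis (no_types, lifting) lessThan_iff sum.neutral)
    then obtain m where m: "m < d" "\<rho> (dih_a n) $$ (i, m) \<noteq> 0" "\<rho> (k, e) $$ (m, j) \<noteq> 0"
      by auto
    have "\<delta> i \<otimes>\<^bsub>dihedral n\<^esub> (Suc k, e) = \<delta> i \<otimes>\<^bsub>dihedral n\<^esub> dih_a n \<otimes>\<^bsub>dihedral n\<^esub> (k, e)"
      using ab(1) ke \<delta> Suc.prems by (simp only: S D.m_assoc)
    also have "\<dots> = dih_a n \<otimes>\<^bsub>dihedral n\<^esub> (\<delta> m \<otimes>\<^bsub>dihedral n\<^esub> (k, e))"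
      using ab(1) ke \<delta>[OF m(1)] by (simp only: a[OF Suc.prems(2) m(1,2)] D.m_assoc)
    also have "\<dots> = (Suc k, e) \<otimes>\<^bsub>dihedral n\<^esub> \<delta> j"
      using ab(1) ke \<delta> Suc.prems m by (simp add: Suc.IH S D.m_assoc)
    finally show ?case .
  qed
  show ?thesis
  proof (rule yetter_drinfeld_yd_of_rep[OF D.is_group _ dim one mult \<delta>])
    show "finite (carrier (dihedral n))" by (simp add: dihedral_simps)
    fix g i j assume *: "g \<in> carrier (dihedral n)" "i < d" "j < d" "\<rho> g $$ (i, j) \<noteq> 0"
    have "\<delta> i \<otimes>\<^bsub>dihedral n\<^esub> g = g \<otimes>\<^bsub>dihedral n\<^esub> \<delta> j"
      using graded[of "fst g" i j "snd g"] * by (auto simp: dihedral_simps(1))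
    then show "\<delta> i = g \<otimes>\<^bsub>dihedral n\<^esub> \<delta> j \<otimes>\<^bsub>dihedral n\<^esub> inv\<^bsub>dihedral n\<^esub> g"
      using * \<delta> by (metis D.inv_solve_right' D.m_closed)
  qed
qed

text \<open>The entry at distance \<open>d\<close> above the diagonal of a power of a Jordan block contains the binomial
  coefficient \<open>(p ^ s * t) choose d\<close>, and \<open>d < p ^ s\<close>.\<close>

lemma jordan_block_pow_scalar:
  fixes x :: "'k::field"
  assumes p: "CHAR('k) = p" "prime p" and r: "r \<le> p ^ s"
  shows "jordan_block r x ^\<^sub>m (p ^ s * t) = x ^ (p ^ s * t) \<cdot>\<^sub>m 1\<^sub>m r"
proof (rule eq_matI)
  fix i j assume "i < dim_row (x ^ (p ^ s * t) \<cdot>\<^sub>m 1\<^sub>m r)" "j < dim_col (x ^ (p ^ s * t) \<cdot>\<^sub>m 1\<^sub>m r)"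
  then have ij: "i < r" "j < r" by auto
  have "(of_nat ((p ^ s * t) choose (j - i)) :: 'k) = 0" if "i < j"
    by (rule of_nat_choose_eq_0[OF p]) (use that ij r in auto)
  then show "(jordan_block r x ^\<^sub>m (p ^ s * t)) $$ (i, j) = (x ^ (p ^ s * t) \<cdot>\<^sub>m 1\<^sub>m r) $$ (i, j)"
    using ij by (auto simp: jordan_block_pow)
qed auto

lemma jordan_block_mult_vec:
  fixes c :: "'k::field"
  assumes "x \<in> carrier_vec r" "i < r"
  shows "(jordan_block r c *\<^sub>v x) $ i = c * x $ i + (if Suc i < r then x $ Suc i else 0)"
proof -
  have "(jordan_block r c *\<^sub>v x) $ i = (\<Sum>k<r. (if i = k then c else if Suc i = k then 1 else 0) * x $ k)"
    using assms by (simp add: scalar_prod_def lessThan_atLeast0)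
  also have "\<dots> = (\<Sum>k<r. (if k = i then c * x $ i else 0) + (if k = Suc i then x $ Suc i else 0))"
    by (rule sum.cong) auto
  finally show ?thesis using assms by (simp add: sum.distrib sum.delta)
qed

text \<open>Up to sign, the recursion for the entries is Pascal's rule.\<close>

lemma t_entry_closed:
  "1 \<le> i \<Longrightarrow> i \<le> j \<Longrightarrow> j \<le> r \<Longrightarrow> t_entry r i j = ((- 1) ^ (r - i) * of_nat ((r - i) choose (j - i)) :: 'k::field)"
proof (induction "r - i" arbitrary: i j)
  case 0
  then have "i = r" "j = r" by auto
  then show ?case by (simp add: t_entry.simps)
next
  case (Suc m)
  then have m: "r - i = Suc m" "m = r - (i + 1)" "i < r" by auto
  show ?case
  proof (cases "i = j")
    case True
    have "t_entry r (i + 1) (i + 1) = ((- 1) ^ m :: 'k)" using Suc.hyps(1)[of "i + 1" "i + 1"] m by simp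
    then show ?thesis using True m by (subst t_entry.simps) simp
  next
    case False
    then have ij: "i < j" using Suc.prems by simp
    then obtain l where l: "j - i = Suc l" by (metis Suc_diff_Suc)
    have l': "j - (i + 1) = l" using l by simp
    have 1: "t_entry r (i + 1) j = ((- 1) ^ m * of_nat (m choose l) :: 'k)"
      using Suc.hyps(1)[of "i + 1" j] m ij Suc.prems unfolding l' by simp
    have 2: "t_entry r (i + 1) (j + 1) = ((- 1) ^ m * of_nat (m choose Suc l) :: 'k)"
    proof (cases "j = r")
      case True
      then have "m < Suc l" using l m by simp
      then show ?thesis using True by (subst t_entry.simps) (simp add: binomial_eq_0)
    next
      case False
      then show ?thesis using Suc.hyps(1)[of "i + 1" "j + 1"] m ij l Suc.prems by simp
    qed
    show ?thesis using ij Suc.prems m(1) l by (subst t_entry.simps) (simp add: 1[simplified] 2[simplified] algebra_simps)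
  qed
qed

lemma T_mat_carrier: "T_mat r \<in> carrier_mat r r"
  by (simp add: T_mat_def)

lemma T_mat_dim [simp]: "dim_row (T_mat r) = r" "dim_col (T_mat r) = r"
  by (simp_all add: T_mat_def)

lemma T_mat_index:
  "i < r \<Longrightarrow> j < r \<Longrightarrow> T_mat r $$ (i, j) =
    (if i \<le> j then (- 1) ^ (r - 1 - i) * of_nat ((r - 1 - i) choose (j - i)) else 0 :: 'k::field)"
proof -
  assume ij: "i < r" "j < r"
  have "(t_entry r (i + 1) (j + 1) :: 'k) = 0" if "j < i" using that by (subst t_entry.simps) simp
  then show ?thesis using ij t_entry_closed[of "i + 1" "j + 1" r]
    by (auto simp: T_mat_def)
qed

text \<open>By \<open>(m choose l) ((m - l) choose (D - l)) = (m choose D) (D choose l)\<close>, an entry of the square is a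
  multiple of the alternating sum of the numbers \<open>D choose l\<close>, which is zero unless \<open>D = 0\<close>.\<close>

lemma T_mat_square: "T_mat r * T_mat r = (1\<^sub>m r :: 'k::field mat)"
proof (rule eq_matI)
  fix i j assume "i < dim_row (1\<^sub>m r :: 'k mat)" "j < dim_col (1\<^sub>m r :: 'k mat)"
  then have ij: "i < r" "j < r" by auto
  let ?T = "T_mat r :: 'k mat"
  have "(?T * ?T) $$ (i, j) = (\<Sum>k<r. ?T $$ (i, k) * ?T $$ (k, j))"
    using ij T_mat_carrier[of r] by (simp add: scalar_prod_def lessThan_atLeast0)
  also have "\<dots> = (1\<^sub>m r :: 'k mat) $$ (i, j)"
  proof (cases "i \<le> j")
    case False
    then have "?T $$ (i, k) * ?T $$ (k, j) = 0" if "k < r" for k using ij that by (auto simp: T_mat_index)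
    then have "(\<Sum>k<r. ?T $$ (i, k) * ?T $$ (k, j)) = 0" by (intro sum.neutral) auto
    then show ?thesis using False ij by simp
  next
    case True
    define m where "m = r - 1 - i"
    define D where "D = j - i"
    have Dm: "D \<le> m" using ij True by (simp add: m_def D_def)
    have "(\<Sum>k<r. ?T $$ (i, k) * ?T $$ (k, j)) = (\<Sum>k\<in>{i..j}. ?T $$ (i, k) * ?T $$ (k, j))"
      using ij by (intro sum.mono_neutral_right) (auto simp: T_mat_index)
    also have "\<dots> = (\<Sum>l\<le>D. of_nat (m choose D) * ((- 1) ^ l * of_nat (D choose l)))"
    proof (rule sum.reindex_bij_witness[of _ "\<lambda>l. i + l" "\<lambda>k. k - i"])
      fix k assume k: "k \<in> {i..j}"
      define l where "l = k - i"
      have kl: "k = i + l" "l \<le> D" using k by (auto simp: l_def D_def)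
      have "r - Suc k = m - l" "j - k = D - l" "r - Suc i = m" by (simp_all add: m_def D_def kl)
      then have "?T $$ (i, k) * ?T $$ (k, j) =
          ((- 1) ^ m * (- 1) ^ (m - l)) * of_nat ((m choose l) * ((m - l) choose (D - l)))"
        using k ij by (simp add: T_mat_index flip: l_def)
      also have "(- 1 :: 'k) ^ m * (- 1) ^ (m - l) = (- 1) ^ l"
      proof -
        have "(- 1 :: 'k) ^ m = (- 1) ^ (m - l) * (- 1) ^ l" using kl Dm by (simp flip: power_add)
        then show ?thesis by (simp add: mult_ac flip: power_mult_distrib)
      qed
      also have "(m choose l) * ((m - l) choose (D - l)) = (m choose D) * (D choose l)"
        using choose_mult[of l D m] kl Dm by simp
      finally show "of_nat (m choose D) * ((- 1) ^ (k - i) * of_nat (D choose (k - i))) = ?T $$ (i, k) * ?T $$ (k, j)"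
        by (simp add: mult_ac flip: l_def)
    qed (use True in \<open>auto simp: D_def\<close>)
    also have "\<dots> = of_nat (m choose D) * (\<Sum>l\<le>D. (- 1) ^ l * of_nat (D choose l))"
      by (simp add: sum_distrib_left)
    also have "\<dots> = (1\<^sub>m r :: 'k mat) $$ (i, j)"
      using ij True by (cases "D = 0") (auto simp: choose_alternating_sum D_def)
    finally show ?thesis .
  qed
  finally show "(?T * ?T) $$ (i, j) = (1\<^sub>m r :: 'k mat) $$ (i, j)" .
qed (simp_all add: T_mat_def)

text \<open>The relation \<open>a b a = b\<close>, equivalent to \<open>(a b)\<^sup>2 = 1\<close> for an involution \<open>b\<close>.\<close>

lemma jordan_block_T_mat_jordan_block:
  "jordan_block r 1 * (T_mat r * jordan_block r 1) = (T_mat r :: 'k::field mat)"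
proof (rule eq_matI)
  fix i j assume "i < dim_row (T_mat r :: 'k mat)" "j < dim_col (T_mat r :: 'k mat)"
  then have ij: "i < r" "j < r" by (auto simp: T_mat_def)
  let ?T = "T_mat r :: 'k mat" and ?J = "jordan_block r 1 :: 'k mat"
  define S where "S i j = (if i < r then ?T $$ (i, j) else 0)" for i j
  have TJ: "(?T * ?J) $$ (i, j) = ?T $$ (i, j) + (if 0 < j then ?T $$ (i, j - 1) else 0)" if "i < r" "j < r" for i j
  proof -
    have "(?T * ?J) $$ (i, j) = (\<Sum>k<r. ?T $$ (i, k) * (if k = j then 1 else if Suc k = j then 1 else 0))"
      using that by (simp add: scalar_prod_def lessThan_atLeast0)
    also have "\<dots> = (\<Sum>k<r. (if k = j then ?T $$ (i, j) else 0) + (if 0 < j \<and> k = j - 1 then ?T $$ (i, j - 1) else 0))"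
      by (rule sum.cong) auto
    finally show ?thesis using that by (cases "0 < j") (auto simp: sum.distrib sum.delta)
  qed
  have carr: "?T * ?J \<in> carrier_mat r r" using T_mat_carrier by auto
  have "(?J * (?T * ?J)) $$ (i, j) = (?J *\<^sub>v col (?T * ?J) j) $ i"
    using ij carr by simp
  also have "\<dots> = (?T * ?J) $$ (i, j) + (if Suc i < r then (?T * ?J) $$ (Suc i, j) else 0)"
    using ij carr by (subst jordan_block_mult_vec) (auto intro!: carrier_vecI)
  also have "\<dots> = ?T $$ (i, j) + ((if 0 < j then ?T $$ (i, j - 1) else 0) +
      (if Suc i < r then ?T $$ (Suc i, j) + (if 0 < j then ?T $$ (Suc i, j - 1) else 0) else 0))"
    using ij by (simp add: TJ del: index_mult_mat)
  also have "(if 0 < j then ?T $$ (i, j - 1) else 0) +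
      (if Suc i < r then ?T $$ (Suc i, j) + (if 0 < j then ?T $$ (Suc i, j - 1) else 0) else 0) = 0"
  proof (cases "i < j")
    case False
    then show ?thesis using ij by (auto simp: T_mat_index)
  next
    case True
    then obtain l where l: "j = Suc (i + l)" using less_imp_Suc_add by blast
    have "Suc i < r" using ij True by simp
    then obtain m where "r = Suc (Suc i + m)" using less_imp_Suc_add by blast
    then have m: "r = Suc (Suc (i + m))" by simp
    have 1: "?T $$ (i, j - 1) = - ((- 1) ^ m * of_nat (Suc m choose l))"
      and 2: "?T $$ (Suc i, j) = (- 1) ^ m * of_nat (m choose l)"
      using ij by (simp_all add: T_mat_index l m)
    have 3: "?T $$ (Suc i, j - 1) = (case l of 0 \<Rightarrow> 0 | Suc l' \<Rightarrow> (- 1) ^ m * of_nat (m choose l'))"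
      using ij by (cases l) (simp_all add: T_mat_index l m)
    have "0 < j" "Suc i < r" by (simp_all add: l m)
    then show ?thesis unfolding 1 2 3 by (cases l) (simp_all add: distrib_left)
  qed
  finally show "(?J * (?T * ?J)) $$ (i, j) = ?T $$ (i, j)" by simp
qed (simp_all add: T_mat_def)


section \<open>The listed modules as three families\<close>

lemma inv_dihedral_rot:
  assumes "i < n"
  shows "inv\<^bsub>dihedral n\<^esub> (i, False) = ((n - i) mod n, False)"
proof -
  have n: "0 < n" using assms by simp
  interpret D: group "dihedral n" by (rule group_dihedral[OF n])
  show ?thesis
    by (rule D.inv_equality) (use assms n in \<open>auto simp: dihedral_simps mod_simps\<close>)
qed

lemma generate_dih_b:
  assumes n: "0 < n"
  shows "generate (dihedral n) {dih_b} = {(0, False), (0, True)}"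
proof
  interpret D: group "dihedral n" by (rule group_dihedral[OF n])
  have inv_b: "inv\<^bsub>dihedral n\<^esub> dih_b = dih_b"
    by (rule D.inv_equality) (use n in \<open>simp_all add: dih_b_def dihedral_simps\<close>)
  show "generate (dihedral n) {dih_b} \<subseteq> {(0, False), (0, True)}"
  proof
    fix h assume "h \<in> generate (dihedral n) {dih_b}"
    then show "h \<in> {(0, False), (0, True)}"
      by (induction rule: generate.induct) (auto simp: inv_b, auto simp: dihedral_simps dih_b_def)
  qed
  show "{(0, False), (0, True)} \<subseteq> generate (dihedral n) {dih_b}"
    using generate.one[of "dihedral n" "{dih_b}"] generate.incl[of dih_b "{dih_b}" "dihedral n"]
    by (simp add: dihedral_simps dih_b_def)
qed

lemma generate_dih_a:
  assumes n: "0 < n"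
  shows "generate (dihedral n) {dih_a n} = {..<n} \<times> {False}"
proof
  interpret D: group "dihedral n" by (rule group_dihedral[OF n])
  have inv_a: "inv\<^bsub>dihedral n\<^esub> (dih_a n) = ((n - 1 mod n) mod n, False)"
    using inv_dihedral_rot[of "1 mod n" n] n by (simp add: dih_a_def)
  show "generate (dihedral n) {dih_a n} \<subseteq> {..<n} \<times> {False}"
  proof
    fix h assume "h \<in> generate (dihedral n) {dih_a n}"
    then show "h \<in> {..<n} \<times> {False}"
    proof (induction rule: generate.induct)
      case (inv h)
      then show ?case using n by (simp add: inv_a)
    qed (use n in \<open>auto simp: dihedral_simps dih_a_def\<close>)
  qed
  have "dih_a n [^]\<^bsub>dihedral n\<^esub> i \<in> generate (dihedral n) {dih_a n}" for i :: nat
    by (induction i) (auto intro: generate.intros)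
  then show "{..<n} \<times> {False} \<subseteq> generate (dihedral n) {dih_a n}"
    using n by (auto simp: dih_a_pow) (metis mod_less)
qed

text \<open>The inverse of the Jordan block is written as its power with exponent \<open>n - 1\<close>: its \<open>n\<close>-th power is 1
  in all cases of interest.\<close>

definition rot_mat :: "nat \<Rightarrow> nat \<Rightarrow> 'k::field \<Rightarrow> 'k mat" where
  "rot_mat n r \<mu> = four_block_mat (jordan_block r \<mu>) (0\<^sub>m r r) (0\<^sub>m r r) (jordan_block r \<mu> ^\<^sub>m (n - 1))"

definition swap_mat :: "nat \<Rightarrow> 'k::field mat" where
  "swap_mat r = four_block_mat (0\<^sub>m r r) (1\<^sub>m r) (1\<^sub>m r) (0\<^sub>m r r)"

text \<open>The common form of \<open>D(Q)\<close> and, with \<open>l = 0\<close>, of \<open>W\<close>. Representations are compared on the group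
  elements only, as their values elsewhere differ from member to member.\<close>

definition rotation_data ::
    "nat \<Rightarrow> nat \<Rightarrow> nat \<Rightarrow> 'k::field \<Rightarrow> (nat \<times> bool \<Rightarrow> 'k mat) \<Rightarrow> (nat \<Rightarrow> nat \<times> bool) \<Rightarrow> bool" where
  "rotation_data n r l \<mu> \<rho> \<delta> \<longleftrightarrow>
    (\<forall>g\<in>carrier (dihedral n). \<rho> g = dih_rep (rot_mat n r \<mu>) (swap_mat r) g) \<and>
    (\<forall>i<2 * r. \<delta> i = (if i < r then l else (n - l) mod n, False))"

text \<open>The form of \<open>V\<close> for \<open>\<sigma> = 1\<close> and of \<open>V'\<close> for \<open>\<sigma> = -1\<close>.\<close>

definition unipotent_data ::
    "nat \<Rightarrow> nat \<Rightarrow> 'k::field \<Rightarrow> (nat \<times> bool \<Rightarrow> 'k mat) \<Rightarrow> (nat \<Rightarrow> nat \<times> bool) \<Rightarrow> bool" where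
  "unipotent_data n r \<sigma> \<rho> \<delta> \<longleftrightarrow>
    (\<forall>g\<in>carrier (dihedral n). \<rho> g = dih_rep (jordan_block r 1) (\<sigma> \<cdot>\<^sub>m T_mat r) g) \<and>
    (\<forall>i<r. \<delta> i = (0, False))"

text \<open>The form of \<open>D(U\<^sub>j)\<close> for \<open>\<sigma> = (-1)\<^sup>j\<close>. If \<open>g a\<^sup>q = a\<^sup>p b\<^sup>e\<close>, the vector \<open>a\<^sup>q \<otimes> u\<close> is sent by \<open>g\<close> to
  \<open>a\<^sup>p \<otimes> b\<^sup>e u\<close>, and \<open>e\<close> depends on \<open>g\<close> only.\<close>

definition reflection_data ::
    "nat \<Rightarrow> 'k::field \<Rightarrow> (nat \<times> bool \<Rightarrow> 'k mat) \<Rightarrow> (nat \<Rightarrow> nat \<times> bool) \<Rightarrow> bool" where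
  "reflection_data n \<sigma> \<rho> \<delta> \<longleftrightarrow>
    (\<forall>g\<in>carrier (dihedral n). \<rho> g = mat n n (\<lambda>(p, q).
      if p = fst (g \<otimes>\<^bsub>dihedral n\<^esub> (q, False)) then (if snd g then \<sigma> else 1) else 0)) \<and>
    (\<forall>i<n. \<delta> i = (2 * i mod n, True))"

lemma rot_mat_carrier: "rot_mat n r \<mu> \<in> carrier_mat (2 * r) (2 * r)"
  unfolding rot_mat_def mult_2 by (rule four_block_carrier_mat) auto

lemma swap_mat_carrier: "swap_mat r \<in> carrier_mat (2 * r) (2 * r)"
  unfolding swap_mat_def mult_2 by (rule four_block_carrier_mat) auto

lemma jordan_inverse:
  fixes \<mu> :: "'k::field"
  assumes "jordan_block r \<mu> ^\<^sub>m n = 1\<^sub>m r" "0 < n"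
  shows "jordan_block r \<mu> * jordan_block r \<mu> ^\<^sub>m (n - 1) = 1\<^sub>m r"
    "jordan_block r \<mu> ^\<^sub>m (n - 1) * jordan_block r \<mu> = 1\<^sub>m r"
proof -
  have J: "jordan_block r \<mu> \<in> carrier_mat r r" by simp
  show "jordan_block r \<mu> * jordan_block r \<mu> ^\<^sub>m (n - 1) = 1\<^sub>m r"
    using pow_mat_add[OF J, of 1 "n - 1"] assms by simp
  show "jordan_block r \<mu> ^\<^sub>m (n - 1) * jordan_block r \<mu> = 1\<^sub>m r"
    using pow_mat_add[OF J, of "n - 1" 1] assms by simp
qed

lemma rot_swap_relations:
  fixes \<mu> :: "'k::field"
  assumes J: "jordan_block r \<mu> ^\<^sub>m n = 1\<^sub>m r" "0 < n"
  shows "rot_mat n r \<mu> ^\<^sub>m n = 1\<^sub>m (2 * r)" "swap_mat r * swap_mat r = (1\<^sub>m (2 * r) :: 'k mat)"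
    "rot_mat n r \<mu> * (swap_mat r * rot_mat n r \<mu>) = swap_mat r"
proof -
  let ?J = "jordan_block r \<mu>" and ?J' = "jordan_block r \<mu> ^\<^sub>m (n - 1)"
  have c: "?J \<in> carrier_mat r r" "?J' \<in> carrier_mat r r" by auto
  have "?J' ^\<^sub>m n = 1\<^sub>m r"
    using pow_mat_mult[OF c(1), of "n - 1" n] pow_mat_mult[OF c(1), of n "n - 1"] J
    by (simp add: pow_mat_one mult.commute)
  then show "rot_mat n r \<mu> ^\<^sub>m n = 1\<^sub>m (2 * r)"
    unfolding rot_mat_def mult_2 by (subst pow_four_block_mat[OF c]) (simp add: J)
  show "swap_mat r * swap_mat r = (1\<^sub>m (2 * r) :: 'k mat)"
    unfolding swap_mat_def mult_2
    by (subst mult_four_block_mat[where ?nr1.0 = r and ?n1.0 = r and ?n2.0 = r and ?nr2.0 = r and ?nc1.0 = r and ?nc2.0 = r])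
      auto
  have 1: "swap_mat r * rot_mat n r \<mu> = four_block_mat (0\<^sub>m r r) ?J' ?J (0\<^sub>m r r)"
    unfolding swap_mat_def rot_mat_def
    by (subst mult_four_block_mat[where ?nr1.0 = r and ?n1.0 = r and ?n2.0 = r and ?nr2.0 = r and ?nc1.0 = r and ?nc2.0 = r])
      (use c in auto)
  show "rot_mat n r \<mu> * (swap_mat r * rot_mat n r \<mu>) = swap_mat r"
    unfolding 1 unfolding swap_mat_def rot_mat_def
    by (subst mult_four_block_mat[where ?nr1.0 = r and ?n1.0 = r and ?n2.0 = r and ?nr2.0 = r and ?nc1.0 = r and ?nc2.0 = r])
      (use c jordan_inverse[OF J] in auto)
qed

lemma rotation_yd:
  fixes \<mu> :: "'k::field"
  assumes J: "jordan_block r \<mu> ^\<^sub>m n = 1\<^sub>m r" and n: "1 < n" and l: "l < n" and data: "rotation_data n r l \<mu> \<rho> \<delta>"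
  shows "yetter_drinfeld (dihedral n) (yd_of_rep (dihedral n) (2 * r) \<rho> \<delta>)"
proof (rule yetter_drinfeld_dihedralI)
  let ?R = "rot_mat n r \<mu>" and ?S = "swap_mat r :: 'k mat"
  have n0: "0 < n" using n by simp
  interpret D: group "dihedral n" by (rule group_dihedral[OF n0])
  note ab = dihedral_relations(1,2)[OF n0]
  note rel = rot_swap_relations[OF J n0]
  have \<rho>: "\<rho> g = dih_rep ?R ?S g" if "g \<in> carrier (dihedral n)" for g
    using data that by (simp add: rotation_data_def)
  have \<delta>: "\<delta> i = (if i < r then l else (n - l) mod n, False)" if "i < 2 * r" for i
    using data that by (simp add: rotation_data_def)
  show "0 < n" by (rule n0)
  show "\<rho> g \<in> carrier_mat (2 * r) (2 * r)" if "g \<in> carrier (dihedral n)" for g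
    using that rot_mat_carrier[of n r \<mu>] mult_carrier_mat[OF pow_carrier_mat[OF rot_mat_carrier] swap_mat_carrier]
    by (cases g) (auto simp: \<rho> dih_rep_def)
  show "\<rho> \<one>\<^bsub>dihedral n\<^esub> = 1\<^sub>m (2 * r)"
    using D.one_closed rot_mat_carrier[of n r \<mu>] by (simp add: \<rho> dih_rep_def dihedral_simps)
  show "\<rho> (g \<otimes>\<^bsub>dihedral n\<^esub> h) = \<rho> g * \<rho> h" if "g \<in> carrier (dihedral n)" "h \<in> carrier (dihedral n)" for g h
    using dih_rep_mult[OF rot_mat_carrier rel(1) swap_mat_carrier rel(2,3) that] that by (simp add: \<rho>)
  show "\<delta> i \<in> carrier (dihedral n)" if "i < 2 * r" for i
    using that l n0 by (simp add: \<delta> dihedral_simps)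
  have gens: "\<rho> (dih_a n) = ?R" "\<rho> dih_b = ?S"
    using dih_rep_gens[OF rot_mat_carrier swap_mat_carrier n] ab by (simp_all add: \<rho>)
  show "\<delta> i \<otimes>\<^bsub>dihedral n\<^esub> dih_a n = dih_a n \<otimes>\<^bsub>dihedral n\<^esub> \<delta> j"
    if "i < 2 * r" "j < 2 * r" "\<rho> (dih_a n) $$ (i, j) \<noteq> 0" for i j
  proof -
    have "i < r \<longleftrightarrow> j < r" using that by (auto simp: gens rot_mat_def split: if_splits)
    then show ?thesis using that by (simp add: \<delta> dihedral_simps dih_a_def add.commute)
  qed
  show "\<delta> i \<otimes>\<^bsub>dihedral n\<^esub> dih_b = dih_b \<otimes>\<^bsub>dihedral n\<^esub> \<delta> j"
    if "i < 2 * r" "j < 2 * r" "\<rho> dih_b $$ (i, j) \<noteq> 0" for i j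
  proof -
    have "i < r \<longleftrightarrow> \<not> j < r" using that by (auto simp: gens swap_mat_def split: if_splits)
    then show ?thesis using that l by (cases "l = 0") (auto simp: \<delta> dihedral_simps dih_b_def)
  qed
qed

lemma rotation_action:
  fixes \<mu> :: "'k::field"
  assumes n: "1 < n" and data: "rotation_data n r l \<mu> \<rho> \<delta>"
    and x: "x \<in> carrier_vec r" "y \<in> carrier_vec r"
  shows "\<rho> (dih_a n) *\<^sub>v (x @\<^sub>v y) = (jordan_block r \<mu> *\<^sub>v x) @\<^sub>v (jordan_block r \<mu> ^\<^sub>m (n - 1) *\<^sub>v y)"
    "\<rho> dih_b *\<^sub>v (x @\<^sub>v y) = y @\<^sub>v x"
proof -
  have n0: "0 < n" using n by simp
  note ab = dihedral_relations(1,2)[OF n0]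
  have gens: "\<rho> (dih_a n) = rot_mat n r \<mu>" "\<rho> dih_b = swap_mat r"
    using dih_rep_gens[OF rot_mat_carrier swap_mat_carrier n] ab data by (simp_all add: rotation_data_def)
  have "jordan_block r \<mu> *\<^sub>v x \<in> carrier_vec r" "jordan_block r \<mu> ^\<^sub>m (n - 1) *\<^sub>v y \<in> carrier_vec r"
    by (auto intro!: mult_mat_vec_carrier x)
  then show "\<rho> (dih_a n) *\<^sub>v (x @\<^sub>v y) = (jordan_block r \<mu> *\<^sub>v x) @\<^sub>v (jordan_block r \<mu> ^\<^sub>m (n - 1) *\<^sub>v y)"
    unfolding gens rot_mat_def
    by (subst four_block_mat_mult_vec[where ?nr1.0 = r and ?nc1.0 = r and ?nc2.0 = r and ?nr2.0 = r]) (use x in auto)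
  show "\<rho> dih_b *\<^sub>v (x @\<^sub>v y) = y @\<^sub>v x"
    unfolding gens swap_mat_def
    by (subst four_block_mat_mult_vec[where ?nr1.0 = r and ?nc1.0 = r and ?nc2.0 = r and ?nr2.0 = r]) (use x in auto)
qed

lemma unipotent_yd:
  fixes \<sigma> :: "'k::field"
  assumes J: "jordan_block r (1::'k) ^\<^sub>m n = 1\<^sub>m r" and n: "1 < n" and \<sigma>: "\<sigma> * \<sigma> = 1"
    and data: "unipotent_data n r \<sigma> \<rho> \<delta>"
  shows "yetter_drinfeld (dihedral n) (yd_of_rep (dihedral n) r \<rho> \<delta>)"
    "\<rho> (dih_a n) = jordan_block r 1" "\<rho> dih_b = \<sigma> \<cdot>\<^sub>m T_mat r"
proof -
  let ?J = "jordan_block r (1::'k)" and ?T = "\<sigma> \<cdot>\<^sub>m T_mat r"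
  have n0: "0 < n" using n by simp
  interpret D: group "dihedral n" by (rule group_dihedral[OF n0])
  note ab = dihedral_relations(1,2)[OF n0]
  have c: "?J \<in> carrier_mat r r" "?T \<in> carrier_mat r r" "T_mat r \<in> carrier_mat r r" using T_mat_carrier by auto
  have TT: "?T * ?T = 1\<^sub>m r"
  proof -
    have "?T * ?T = \<sigma> \<cdot>\<^sub>m (\<sigma> \<cdot>\<^sub>m (T_mat r * T_mat r))"
      using c by (simp add: mult_smult_assoc_mat[OF c(3,2)] mult_smult_distrib[OF c(3,3)])
    also have "\<dots> = (\<sigma> * \<sigma>) \<cdot>\<^sub>m (1\<^sub>m r)"
      unfolding T_mat_square by (auto intro!: eq_matI)
    finally show ?thesis unfolding \<sigma> by (auto intro!: eq_matI)
  qed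
  have JTJ: "?J * (?T * ?J) = ?T"
  proof -
    have "?T * ?J = \<sigma> \<cdot>\<^sub>m (T_mat r * ?J)" by (rule mult_smult_assoc_mat[OF c(3,1)])
    moreover have "?J * (\<sigma> \<cdot>\<^sub>m (T_mat r * ?J)) = \<sigma> \<cdot>\<^sub>m (?J * (T_mat r * ?J))"
      by (rule mult_smult_distrib[OF c(1) mult_carrier_mat[OF c(3,1)]])
    ultimately show ?thesis by (simp add: jordan_block_T_mat_jordan_block)
  qed
  have \<rho>: "\<rho> g = dih_rep ?J ?T g" if "g \<in> carrier (dihedral n)" for g
    using data that by (simp add: unipotent_data_def)
  have \<delta>: "\<delta> i = \<one>\<^bsub>dihedral n\<^esub>" if "i < r" for i
    using data that by (simp add: unipotent_data_def dihedral_simps)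
  show "\<rho> (dih_a n) = jordan_block r 1" "\<rho> dih_b = \<sigma> \<cdot>\<^sub>m T_mat r"
    using dih_rep_gens[OF c(1,2) n] ab by (simp_all add: \<rho>)
  show "yetter_drinfeld (dihedral n) (yd_of_rep (dihedral n) r \<rho> \<delta>)"
  proof (rule yetter_drinfeld_dihedralI)
    show "0 < n" by (rule n0)
    show "\<rho> g \<in> carrier_mat r r" if "g \<in> carrier (dihedral n)" for g
      using that c by (cases g) (auto simp: \<rho> dih_rep_def)
    show "\<rho> \<one>\<^bsub>dihedral n\<^esub> = 1\<^sub>m r"
      using D.one_closed by (simp add: \<rho> dih_rep_def dihedral_simps)
    show "\<rho> (g \<otimes>\<^bsub>dihedral n\<^esub> h) = \<rho> g * \<rho> h" if "g \<in> carrier (dihedral n)" "h \<in> carrier (dihedral n)" for g h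
      using dih_rep_mult[OF c(1) J c(2) TT JTJ that] that by (simp add: \<rho>)
  qed (use ab in \<open>simp_all add: \<delta>\<close>)
qed

lemma reflection_action:
  fixes \<sigma> :: "'k::field"
  assumes n: "1 < n" and data: "reflection_data n \<sigma> \<rho> \<delta>" and x: "x \<in> carrier_vec n" and i: "i < n"
  shows "(\<rho> (dih_a n) *\<^sub>v x) $ i = x $ ((i + n - 1) mod n)" "(\<rho> dih_b *\<^sub>v x) $ i = \<sigma> * x $ ((n - i) mod n)"
proof -
  have n0: "0 < n" using n by simp
  note ab = dihedral_relations(1,2)[OF n0]
  have \<rho>: "\<rho> g = mat n n (\<lambda>(p, q). if p = fst (g \<otimes>\<^bsub>dihedral n\<^esub> (q, False)) then (if snd g then \<sigma> else 1) else 0)"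
    if "g \<in> carrier (dihedral n)" for g
    using data that by (simp add: reflection_data_def)
  have sum1: "(\<Sum>q<n. (if P q then z else 0) * x $ q) = z * x $ k"
    if "k < n" "\<And>q. q < n \<Longrightarrow> P q \<longleftrightarrow> q = k" for P k and z :: 'k
  proof -
    have "(\<Sum>q<n. (if P q then z else 0) * x $ q) = (\<Sum>q<n. if q = k then z * x $ k else 0)"
      using that by (intro sum.cong) auto
    then show ?thesis using that(1) by (simp add: sum.delta)
  qed
  have "(\<rho> (dih_a n) *\<^sub>v x) $ i = (\<Sum>q<n. (if i = (1 + q) mod n then 1 else 0) * x $ q)"
    using ab x i n by (simp add: \<rho> scalar_prod_def lessThan_atLeast0 dihedral_simps dih_a_def)
  also have "\<dots> = 1 * x $ ((i + n - 1) mod n)"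
  proof (rule sum1)
    show "i = (1 + q) mod n \<longleftrightarrow> q = (i + n - 1) mod n" if "q < n" for q
      using that i n by (cases "Suc q = n"; cases "i = 0") (auto simp: mod_if)
  qed (use n0 in simp)
  finally show "(\<rho> (dih_a n) *\<^sub>v x) $ i = x $ ((i + n - 1) mod n)" by simp
  have "(\<rho> dih_b *\<^sub>v x) $ i = (\<Sum>q<n. (if i = (n - q) mod n then \<sigma> else 0) * x $ q)"
    using ab x i n by (simp add: \<rho> scalar_prod_def lessThan_atLeast0 dihedral_simps dih_b_def)
  also have "\<dots> = \<sigma> * x $ ((n - i) mod n)"
  proof (rule sum1)
    show "i = (n - q) mod n \<longleftrightarrow> q = (n - i) mod n" if "q < n" for q
      using that i by (cases "q = 0"; cases "i = 0") auto
  qed (use n0 in simp)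
  finally show "(\<rho> dih_b *\<^sub>v x) $ i = \<sigma> * x $ ((n - i) mod n)" .
qed

lemma reflection_yd:
  fixes \<sigma> :: "'k::field"
  assumes n: "1 < n" and \<sigma>: "\<sigma> * \<sigma> = 1" and data: "reflection_data n \<sigma> \<rho> \<delta>"
  shows "yetter_drinfeld (dihedral n) (yd_of_rep (dihedral n) n \<rho> \<delta>)"
proof (rule yetter_drinfeld_dihedralI)
  have n0: "0 < n" using n by simp
  interpret D: group "dihedral n" by (rule group_dihedral[OF n0])
  note ab = dihedral_relations(1,2)[OF n0]
  have \<rho>: "\<rho> g = mat n n (\<lambda>(p, q). if p = fst (g \<otimes>\<^bsub>dihedral n\<^esub> (q, False)) then (if snd g then \<sigma> else 1) else 0)"
    if "g \<in> carrier (dihedral n)" for g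
    using data that by (simp add: reflection_data_def)
  have \<delta>: "\<delta> i = (2 * i mod n, True)" if "i < n" for i
    using data that by (simp add: reflection_data_def)
  show "0 < n" by (rule n0)
  show "\<rho> g \<in> carrier_mat n n" if "g \<in> carrier (dihedral n)" for g
    using that by (simp add: \<rho>)
  show "\<rho> \<one>\<^bsub>dihedral n\<^esub> = 1\<^sub>m n"
    using D.one_closed by (auto simp: \<rho> dihedral_simps intro!: eq_matI)
  show "\<rho> (g \<otimes>\<^bsub>dihedral n\<^esub> h) = \<rho> g * \<rho> h"
    if g: "g \<in> carrier (dihedral n)" and h: "h \<in> carrier (dihedral n)" for g h
  proof (rule eq_matI)
    fix i j assume "i < dim_row (\<rho> g * \<rho> h)" "j < dim_col (\<rho> g * \<rho> h)"
    then have ij: "i < n" "j < n" using g h by (auto simp: \<rho>)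
    define k where "k = fst (h \<otimes>\<^bsub>dihedral n\<^esub> (j, False))"
    have kn: "k < n" using n0 by (cases h) (simp add: k_def dihedral_simps)
    have jc: "(j, False) \<in> carrier (dihedral n)" using ij by (simp add: dihedral_simps)
    have gf: "fst (g \<otimes>\<^bsub>dihedral n\<^esub> y) = fst (g \<otimes>\<^bsub>dihedral n\<^esub> (fst y, False))" for y
      by (cases g; cases y) (simp add: dihedral_simps)
    have "(\<rho> g * \<rho> h) $$ (i, j) = (\<Sum>m<n. \<rho> g $$ (i, m) * \<rho> h $$ (m, j))"
      using ij g h by (simp add: \<rho> scalar_prod_def lessThan_atLeast0)
    also have "\<dots> = (\<Sum>m<n. if m = k then \<rho> g $$ (i, k) * (if snd h then \<sigma> else 1) else 0)"
      using ij h by (intro sum.cong) (auto simp: \<rho> k_def)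
    also have "\<dots> = \<rho> g $$ (i, k) * (if snd h then \<sigma> else 1)"
      using kn by (simp add: sum.delta)
    also have "\<dots> = \<rho> (g \<otimes>\<^bsub>dihedral n\<^esub> h) $$ (i, j)"
    proof -
      have "fst (g \<otimes>\<^bsub>dihedral n\<^esub> h \<otimes>\<^bsub>dihedral n\<^esub> (j, False)) = fst (g \<otimes>\<^bsub>dihedral n\<^esub> (k, False))"
        using gf[of "h \<otimes>\<^bsub>dihedral n\<^esub> (j, False)"] g h jc by (simp add: D.m_assoc k_def)
      moreover have "snd (g \<otimes>\<^bsub>dihedral n\<^esub> h) \<longleftrightarrow> snd g \<noteq> snd h"
        by (cases g; cases h) (simp add: dihedral_simps)
      ultimately show ?thesis using ij kn g h \<sigma> by (auto simp: \<rho>)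
    qed
    finally show "\<rho> (g \<otimes>\<^bsub>dihedral n\<^esub> h) $$ (i, j) = (\<rho> g * \<rho> h) $$ (i, j)" by simp
  qed (use g h in \<open>simp_all add: \<rho>\<close>)
  show "\<delta> i \<in> carrier (dihedral n)" if "i < n" for i
    using that n0 by (simp add: \<delta> dihedral_simps)
  show "\<delta> i \<otimes>\<^bsub>dihedral n\<^esub> dih_a n = dih_a n \<otimes>\<^bsub>dihedral n\<^esub> \<delta> j"
    if "i < n" "j < n" "\<rho> (dih_a n) $$ (i, j) \<noteq> 0" for i j
  proof -
    have i: "i = (1 + j) mod n"
      using that ab n by (auto simp: \<rho> dihedral_simps dih_a_def split: if_splits)
    have "(2 * i mod n + (n - 1)) mod n = (2 * (1 + j) + (n - 1)) mod n"
      unfolding i by (metis mod_add_left_eq mod_mult_right_eq)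
    also have "2 * (1 + j) + (n - 1) = (1 + 2 * j) + n" using n by simp
    finally have "(2 * i mod n + (n - 1)) mod n = (1 + 2 * j) mod n" by (simp only: mod_add_self2)
    then show ?thesis using that n by (simp add: \<delta> dihedral_simps dih_a_def mod_simps)
  qed
  show "\<delta> i \<otimes>\<^bsub>dihedral n\<^esub> dih_b = dih_b \<otimes>\<^bsub>dihedral n\<^esub> \<delta> j"
    if "i < n" "j < n" "\<rho> dih_b $$ (i, j) \<noteq> 0" for i j
  proof -
    have i: "i = (n - j) mod n"
      using that ab n by (auto simp: \<rho> dihedral_simps dih_b_def split: if_splits)
    have "n dvd 2 * (n - j) + 2 * j" using that by (simp flip: distrib_left)
    then have "(n - 2 * j mod n) mod n = 2 * (n - j) mod n" by (rule neg_mod_unique[OF n0])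
    then show ?thesis using that n by (simp add: \<delta> i dihedral_simps dih_b_def mod_simps)
  qed
qed

lemma DU_mod_data:
  assumes n: "1 < n"
  shows "\<exists>\<rho> \<delta>. DU_mod n j = yd_of_rep (dihedral n) n \<rho> \<delta> \<and> reflection_data n ((- 1 :: 'k::field) ^ j) \<rho> \<delta>"
proof -
  have n0: "0 < n" using n by simp
  interpret D: group "dihedral n" by (rule group_dihedral[OF n0])
  let ?xs = "map (\<lambda>i. dih_a n [^]\<^bsub>dihedral n\<^esub> i) [0..<n]"
  let ?\<rho> = "induced_rep (dihedral n) (generate (dihedral n) {dih_b}) ?xs 1
      (dih_rep (1\<^sub>m 1) ((- 1 :: 'k) ^ j \<cdot>\<^sub>m 1\<^sub>m 1))"
  have xs: "?xs ! i = (i, False)" if "i < n" for i using that n0 by (simp add: dih_a_pow)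
  have "reflection_data n ((- 1) ^ j) ?\<rho> (\<lambda>i. dih_a n [^]\<^bsub>dihedral n\<^esub> (2 * i) \<otimes>\<^bsub>dihedral n\<^esub> dih_b)"
    unfolding reflection_data_def
  proof (intro conjI ballI allI impI)
    fix i assume "i < n"
    then show "dih_a n [^]\<^bsub>dihedral n\<^esub> (2 * i) \<otimes>\<^bsub>dihedral n\<^esub> dih_b = (2 * i mod n, True)"
      using n0 by (simp add: dih_a_pow dih_b_def dihedral_simps)
  next
    fix g assume g: "g \<in> carrier (dihedral n)"
    show "?\<rho> g = mat n n (\<lambda>(p, q). if p = fst (g \<otimes>\<^bsub>dihedral n\<^esub> (q, False)) then (if snd g then (- 1) ^ j else 1) else 0)"
    proof (rule eq_matI)
      fix p q assume "p < dim_row (mat n n (\<lambda>(p, q). if p = fst (g \<otimes>\<^bsub>dihedral n\<^esub> (q, False)) then (if snd g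
        then (- 1 :: 'k) ^ j else 1) else 0))"
        "q < dim_col (mat n n (\<lambda>(p, q). if p = fst (g \<otimes>\<^bsub>dihedral n\<^esub> (q, False)) then (if snd g then (- 1 ::
          'k) ^ j else 1) else 0))"
      then have pq: "p < n" "q < n" by auto
      obtain m e where m: "g \<otimes>\<^bsub>dihedral n\<^esub> (q, False) = (m, e)" by (cases "g \<otimes>\<^bsub>dihedral n\<^esub> (q, False)")
      have mn: "m < n" "e = snd g" using m n0 by (cases g; auto simp: dihedral_simps split: if_splits)+
      have h: "inv\<^bsub>dihedral n\<^esub> (?xs ! p) \<otimes>\<^bsub>dihedral n\<^esub> (g \<otimes>\<^bsub>dihedral n\<^esub> (?xs ! q)) = (((n - p) mod n + m) mod n, e)"
        using pq by (simp only: xs m inv_dihedral_rot) (simp add: dihedral_simps)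
      have "((n - p) mod n + m) mod n = 0 \<longleftrightarrow> p = m"
      proof -
        have "((n - p) mod n + m) mod n = 0 \<longleftrightarrow> ((n - p) + m + p) mod n = (0 + p) mod n"
          using cong_add_rcancel_nat[of "n - p + m" p 0 n] by (simp add: cong_def mod_simps)
        also have "(n - p) + m + p = m + n" using pq by simp
        finally show ?thesis using pq mn by auto
      qed
      then show "?\<rho> g $$ (p, q) = mat n n (\<lambda>(p, q). if p = fst (g \<otimes>\<^bsub>dihedral n\<^esub> (q, False)) then (if snd g
        then (- 1) ^ j else 1) else 0) $$ (p, q)"
        using pq h m mn by (simp add: induced_rep_def Let_def generate_dih_b[OF n0] del: nth_map) (auto simp: dih_rep_def)
    qed (simp_all add: induced_rep_def)
  qed
  then show ?thesis unfolding DU_mod_def by blast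
qed

lemma V_mod_data:
  "\<exists>\<rho> \<delta>. V_mod n \<xi> r = yd_of_rep (dihedral n) r \<rho> \<delta> \<and> unipotent_data n r (1 :: 'k::field) \<rho> \<delta>"
proof -
  have "1 \<cdot>\<^sub>m T_mat r = (T_mat r :: 'k mat)" by (auto intro!: eq_matI)
  then have "unipotent_data n r (1 :: 'k) (dih_rep (A_mat \<xi> r 0) (T_mat r)) (\<lambda>_. \<one>\<^bsub>dihedral n\<^esub>)"
    by (simp add: unipotent_data_def A_mat_def dihedral_simps)
  then show ?thesis unfolding V_mod_def by blast
qed

lemma V'_mod_data:
  "\<exists>\<rho> \<delta>. V'_mod n \<xi> r = yd_of_rep (dihedral n) r \<rho> \<delta> \<and> unipotent_data n r (- 1 :: 'k::field) \<rho> \<delta>"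
proof -
  have "- T_mat r = ((- 1) \<cdot>\<^sub>m T_mat r :: 'k mat)" by (auto intro!: eq_matI)
  then have "unipotent_data n r (- 1 :: 'k) (dih_rep (A_mat \<xi> r 0) (- T_mat r)) (\<lambda>_. \<one>\<^bsub>dihedral n\<^esub>)"
    by (simp add: unipotent_data_def A_mat_def dihedral_simps)
  then show ?thesis unfolding V'_mod_def by blast
qed

lemma W_mod_data:
  fixes \<xi> :: "'k::field"
  assumes J: "jordan_block r (\<xi> ^ i) ^\<^sub>m n = 1\<^sub>m r" "0 < n"
  shows "\<exists>\<rho> \<delta>. W_mod n \<xi> r i = yd_of_rep (dihedral n) (2 * r) \<rho> \<delta> \<and> rotation_data n r 0 (\<xi> ^ i) \<rho> \<delta>"
proof -
  let ?J = "jordan_block r (\<xi> ^ i)" and ?J' = "jordan_block r (\<xi> ^ i) ^\<^sub>m (n - 1)"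
  have c: "?J \<in> carrier_mat r r" "?J' \<in> carrier_mat r r" by auto
  note inv = jordan_inverse[OF J]
  have "?J \<in> Units (ring_mat TYPE('k) r ())"
    using inv c by (auto simp: Units_def ring_mat_def)
  then obtain B where B: "mat_inverse ?J = Some B"
    using mat_inverse(1)[OF c(1), of "()"] by (cases "mat_inverse ?J") auto
  then have B': "?J * B = 1\<^sub>m r" "B \<in> carrier_mat r r" using mat_inverse(2)[OF c(1) B] by auto
  have "B = ?J' * ?J * B" using B' inv by simp
  also have "\<dots> = ?J' * (?J * B)" by (rule assoc_mult_mat[OF c(2,1) B'(2)])
  also have "\<dots> = ?J'" using B' c by simp
  finally have "the (mat_inverse ?J) = ?J'" using B by simp
  then have "rotation_data n r 0 (\<xi> ^ i)
      (dih_rep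
        (four_block_mat (A_mat \<xi> r i) (0\<^sub>m r r) (0\<^sub>m r r) (the (mat_inverse (A_mat \<xi> r i))))
        (four_block_mat (0\<^sub>m r r) (1\<^sub>m r) (1\<^sub>m r) (0\<^sub>m r r)))
      (\<lambda>_. \<one>\<^bsub>dihedral n\<^esub>)"
    by (simp add: rotation_data_def A_mat_def dihedral_simps rot_mat_def swap_mat_def)
  then show ?thesis unfolding W_mod_def by blast
qed

text \<open>On the coset of \<open>b\<close>, the element \<open>a\<^sup>m\<close> acts by \<open>a\<^sup>m b = b a\<^sup>-\<^sup>m\<close> as the inverse of its action on
  the trivial coset.\<close>

lemma DQ_mod_data:
  fixes \<xi> :: "'k::field"
  assumes J: "jordan_block r (\<xi> ^ j) ^\<^sub>m n = 1\<^sub>m r" and n: "1 < n" and l: "l < n"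
  shows "\<exists>\<rho> \<delta>. DQ_mod n \<xi> r j l = yd_of_rep (dihedral n) (2 * r) \<rho> \<delta> \<and> rotation_data n r l (\<xi> ^ j) \<rho> \<delta>"
proof -
  have n0: "0 < n" using n by simp
  interpret D: group "dihedral n" by (rule group_dihedral[OF n0])
  let ?J = "jordan_block r (\<xi> ^ j)"
  let ?xs = "[\<one>\<^bsub>dihedral n\<^esub>, dih_b]"
  let ?\<rho> = "induced_rep (dihedral n) (generate (dihedral n) {dih_a n}) ?xs r (dih_rep (A_mat \<xi> r j) (1\<^sub>m r))"
  have c: "?J \<in> carrier_mat r r" "?J ^\<^sub>m (n - 1) \<in> carrier_mat r r" by auto
  have inv_b: "inv\<^bsub>dihedral n\<^esub> (0, True) = (0, True)"
    by (rule D.inv_equality) (use n0 in \<open>simp_all add: dihedral_simps\<close>)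
  have pow_inv: "(?J ^\<^sub>m (n - 1)) ^\<^sub>m m = ?J ^\<^sub>m ((n - m) mod n)" if "m < n" for m
  proof -
    have "(n - 1) * m + m = n * m" using n0 by (simp add: diff_mult_distrib)
    then have "n dvd (n - 1) * m + m" by simp
    from neg_mod_unique[OF n0 this] have "((n - 1) * m) mod n = (n - m) mod n" using that by simp
    then show ?thesis
      using pow_mat_mod[OF c(1) J, of "(n - 1) * m"] pow_mat_mod[OF c(1) J, of "n - m"] pow_mat_mult[OF c(1), of "n - 1" m]
      by simp
  qed
  have dihJ: "dih_rep (A_mat \<xi> r j) (1\<^sub>m r) (k, False) = ?J ^\<^sub>m k" for k
    using right_mult_one_mat[of "?J ^\<^sub>m k" r r] by (simp add: dih_rep_def A_mat_def)
  have "rotation_data n r l (\<xi> ^ j) ?\<rho> (\<lambda>i. dih_a n [^]\<^bsub>dihedral n\<^esub> (if i < r then l else n - l))"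
    unfolding rotation_data_def
  proof (intro conjI ballI allI impI)
    fix i assume "i < 2 * r"
    show "dih_a n [^]\<^bsub>dihedral n\<^esub> (if i < r then l else n - l) = (if i < r then l else (n - l) mod n, False)"
      using n0 l by (simp add: dih_a_pow)
  next
    fix g assume "g \<in> carrier (dihedral n)"
    then obtain m e where g: "g = (m, e)" "m < n" by (cases g) (auto simp: dihedral_simps)
    let ?m' = "(n - m) mod n"
    have pow: "rot_mat n r (\<xi> ^ j) ^\<^sub>m m = four_block_mat (?J ^\<^sub>m m) (0\<^sub>m r r) (0\<^sub>m r r) (?J ^\<^sub>m ?m')"
      unfolding rot_mat_def by (subst pow_four_block_mat[OF c]) (simp only: pow_inv[OF g(2)])
    have cm: "?J ^\<^sub>m m \<in> carrier_mat r r" "?J ^\<^sub>m ?m' \<in> carrier_mat r r" by auto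
    have R: "dih_rep (rot_mat n r (\<xi> ^ j)) (swap_mat r) g = (if e
      then four_block_mat (0\<^sub>m r r) (?J ^\<^sub>m m) (?J ^\<^sub>m ?m') (0\<^sub>m r r)
      else four_block_mat (?J ^\<^sub>m m) (0\<^sub>m r r) (0\<^sub>m r r) (?J ^\<^sub>m ?m'))"
    proof (cases e)
      case True
      have "rot_mat n r (\<xi> ^ j) ^\<^sub>m m * swap_mat r = four_block_mat (0\<^sub>m r r) (?J ^\<^sub>m m) (?J ^\<^sub>m ?m') (0\<^sub>m r r)"
        unfolding pow swap_mat_def
        by (subst mult_four_block_mat[where ?nr1.0 = r and ?n1.0 = r and ?n2.0 = r and ?nr2.0 = r and ?nc1.0 =
          r and ?nc2.0 = r])
          (use cm in auto)
      then show ?thesis using True by (simp add: g dih_rep_def)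
    next
      case False
      have "rot_mat n r (\<xi> ^ j) ^\<^sub>m m * 1\<^sub>m (2 * r) = rot_mat n r (\<xi> ^ j) ^\<^sub>m m"
        by (rule right_mult_one_mat[OF pow_carrier_mat[OF rot_mat_carrier]])
      then show ?thesis using False rot_mat_carrier[of n r "\<xi> ^ j"] by (simp add: g dih_rep_def pow)
    qed
    have entry: "?\<rho> g $$ (x, y) = (let h = inv\<^bsub>dihedral n\<^esub> (if x < r then (0, False) else (0, True)) \<otimes>\<^bsub>dihedral n\<^esub>
          (g \<otimes>\<^bsub>dihedral n\<^esub> (if y < r then (0, False) else (0, True)))
        in if h \<in> {..<n} \<times> {False} then dih_rep (A_mat \<xi> r j) (1\<^sub>m r) h $$ (if x < r then x else x - r,
          if y < r then y else y - r) else 0)"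
      if xy: "x < 2 * r" "y < 2 * r" for x y
    proof -
      have r: "0 < r" using xy by simp
      have dm: "z div r = (if z < r then 0 else 1)" "z mod r = (if z < r then z else z - r)" if "z < 2 * r" for z
        using that r by (auto simp: div_if mod_if)
      show ?thesis using xy
        by (simp add: induced_rep_def generate_dih_a[OF n0] dm Let_def dihedral_simps(3) dih_b_def)
    qed
    show "?\<rho> g = dih_rep (rot_mat n r (\<xi> ^ j)) (swap_mat r) g"
    proof (rule eq_matI)
      fix x y assume "x < dim_row (dih_rep (rot_mat n r (\<xi> ^ j)) (swap_mat r) g)"
        "y < dim_col (dih_rep (rot_mat n r (\<xi> ^ j)) (swap_mat r) g)"
      then have xy: "x < 2 * r" "y < 2 * r" by (auto simp: R split: if_splits)
      have m0: "inv\<^bsub>dihedral n\<^esub> (0, False) = (0, False)" using inv_dihedral_rot[of 0 n] n0 by simp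
      show "?\<rho> g $$ (x, y) = dih_rep (rot_mat n r (\<xi> ^ j)) (swap_mat r) g $$ (x, y)"
        unfolding entry[OF xy] R using xy g n0
        by (cases "x < r"; cases "y < r"; cases e)
          (simp_all add: m0 inv_b dihedral_simps Let_def dihJ)
    qed (simp_all add: induced_rep_def R)
  qed
  then show ?thesis unfolding DQ_mod_def by blast
qed


section \<open>Minimal submodules and joint eigenvectors\<close>

text \<open>Two non-zero direct summands would both contain \<open>w\<close>.\<close>

lemma yd_indecomposable_if_socle:
  assumes X: "yetter_drinfeld G X" and w: "w \<in> carrier X" "w \<noteq> \<zero>\<^bsub>X\<^esub>"
    and socle: "\<And>N x. yd_submodule G N X \<Longrightarrow> x \<in> N \<Longrightarrow> x \<noteq> \<zero>\<^bsub>X\<^esub> \<Longrightarrow> w \<in> N"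
  shows "yd_indecomposable G X"
  unfolding yd_indecomposable_def
proof (intro conjI allI impI)
  show "yetter_drinfeld G X" by (rule X)
  show "carrier X \<noteq> {\<zero>\<^bsub>X\<^esub>}" using w by blast
  fix N1 N2
  assume *: "yd_submodule G N1 X \<and> yd_submodule G N2 X \<and> module.submodule_sum X N1 N2 = carrier X \<and> N1 \<inter> N2 = {\<zero>\<^bsub>X\<^esub>}"
  show "N1 = {\<zero>\<^bsub>X\<^esub>} \<or> N2 = {\<zero>\<^bsub>X\<^esub>}"
  proof (rule ccontr)
    assume "\<not> ?thesis"
    moreover have "\<zero>\<^bsub>X\<^esub> \<in> N1" "\<zero>\<^bsub>X\<^esub> \<in> N2" using * by auto
    ultimately obtain x y where "x \<in> N1" "x \<noteq> \<zero>\<^bsub>X\<^esub>" "y \<in> N2" "y \<noteq> \<zero>\<^bsub>X\<^esub>" by blast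
    then have "w \<in> N1 \<inter> N2" using socle * by blast
    then show False using * w by simp
  qed
qed

lemma yd_submodule_yd_of_repD:
  fixes \<rho> :: "'g \<Rightarrow> 'k::field mat"
  assumes "yd_submodule G N (yd_of_rep G d \<rho> \<delta>)"
  shows "N \<subseteq> carrier_vec d" "0\<^sub>v d \<in> N" "\<And>x y. x \<in> N \<Longrightarrow> y \<in> N \<Longrightarrow> x + y \<in> N" "\<And>c x. x \<in> N \<Longrightarrow> c \<cdot>\<^sub>v x \<in> N"
    "\<And>g x. g \<in> carrier G \<Longrightarrow> x \<in> N \<Longrightarrow> \<rho> g *\<^sub>v x \<in> N"
    "\<And>g x. g \<in> carrier G \<Longrightarrow> x \<in> N \<Longrightarrow> vec d (\<lambda>i. if \<delta> i = g then x $ i else 0) \<in> N"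
proof -
  have sub: "submodule class_ring N (yd_of_rep G d \<rho> \<delta>)"
    using assms by (simp add: yd_submodule_def VectorSpace.subspace_def)
  show "N \<subseteq> carrier_vec d" "0\<^sub>v d \<in> N" "\<And>x y. x \<in> N \<Longrightarrow> y \<in> N \<Longrightarrow> x + y \<in> N" "\<And>c x. x \<in> N \<Longrightarrow> c \<cdot>\<^sub>v x \<in> N"
    using sub by (auto simp: submodule_def)
  show "\<rho> g *\<^sub>v x \<in> N" if "g \<in> carrier G" "x \<in> N" for g x
    using assms that by (simp add: yd_submodule_def)
  show "vec d (\<lambda>i. if \<delta> i = g then x $ i else 0) \<in> N" if "g \<in> carrier G" "x \<in> N" for g x
    using assms that by (auto simp: yd_submodule_def PiE_iff)
qed

lemma unit_vec_neq_0: "i < r \<Longrightarrow> unit_vec r i \<noteq> (0\<^sub>v r :: 'k::field vec)"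
  by (metis index_unit_vec(2) index_zero_vec(1) one_neq_zero)

lemma append_unit_vec_neq_0:
  assumes "0 < r"
  shows "unit_vec r 0 @\<^sub>v v \<noteq> (0\<^sub>v d :: 'k::field vec)"
proof
  assume eq: "unit_vec r 0 @\<^sub>v v = (0\<^sub>v d :: 'k vec)"
  then have "d = r + dim_vec v" by (metis index_append_vec(2) index_unit_vec(3) index_zero_vec(2))
  then show False using arg_cong[OF eq, of "\<lambda>w. w $ 0"] assms by simp
qed

lemma ex_last_nonzero:
  assumes "x \<in> carrier_vec r" "x \<noteq> 0\<^sub>v r"
  shows "\<exists>q<r. x $ q \<noteq> 0 \<and> (\<forall>i. q < i \<longrightarrow> i < r \<longrightarrow> x $ i = 0)"
proof -
  let ?I = "{i. i < r \<and> x $ i \<noteq> 0}"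
  have "?I \<noteq> {}"
  proof
    assume "?I = {}"
    then have "x = 0\<^sub>v r" using assms(1) by (intro eq_vecI) auto
    then show False using assms(2) by simp
  qed
  then have max: "Max ?I \<in> ?I" by (intro Max_in) auto
  have "x $ i = 0" if "Max ?I < i" "i < r" for i
  proof (rule ccontr)
    assume "x $ i \<noteq> 0"
    then have "i \<le> Max ?I" using that by (intro Max_ge) auto
    then show False using that by simp
  qed
  then show ?thesis using max by blast
qed

text \<open>Subtracting \<open>\<mu>\<close> from the Jordan block gives the operator that shifts the coordinates down by one.
  Shifting until the last non-zero coordinate arrives at position 0 leaves a multiple of the first
  unit vector.\<close>

lemma jordan_block_socle:
  fixes \<mu> :: "'k::field"
  assumes N: "N \<subseteq> carrier_vec r" "\<And>x y. x \<in> N \<Longrightarrow> y \<in> N \<Longrightarrow> x + y \<in> N" "\<And>c x. x \<in> N \<Longrightarrow> c \<cdot>\<^sub>v x \<in> N"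
    and J: "\<And>x. x \<in> N \<Longrightarrow> jordan_block r \<mu> *\<^sub>v x \<in> N" and x: "x \<in> N" "x \<noteq> 0\<^sub>v r"
  shows "unit_vec r 0 \<in> N"
proof -
  have "unit_vec r 0 \<in> N"
    if "x \<in> N" "q < r" "x $ q \<noteq> 0" "\<And>i. q < i \<Longrightarrow> i < r \<Longrightarrow> x $ i = 0" for q x
    using that
  proof (induction q arbitrary: x)
    case 0
    have xc: "x \<in> carrier_vec r" using 0 N(1) by blast
    have "inverse (x $ 0) \<cdot>\<^sub>v x = unit_vec r 0"
      using 0 xc by (intro eq_vecI) auto
    then show ?case using N(3)[OF 0(1), of "inverse (x $ 0)"] by simp
  next
    case (Suc q)
    have xc: "x \<in> carrier_vec r" using Suc N(1) by blast
    define y where "y = jordan_block r \<mu> *\<^sub>v x + (- \<mu>) \<cdot>\<^sub>v x"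
    have y: "y $ i = (if Suc i < r then x $ Suc i else 0)" if "i < r" for i
      using that xc jordan_block_mult_vec[OF xc that, of \<mu>] by (simp add: y_def)
    show ?case
    proof (rule Suc.IH)
      show "y \<in> N" unfolding y_def by (intro N J Suc.prems(1))
      show "q < r" using Suc.prems by simp
      show "y $ q \<noteq> 0" using Suc.prems y[of q] by simp
      show "y $ i = 0" if "q < i" "i < r" for i using Suc.prems y[OF that(2)] that by simp
    qed
  qed
  moreover obtain q where "q < r" "x $ q \<noteq> 0" "\<forall>i. q < i \<longrightarrow> i < r \<longrightarrow> x $ i = 0"
    using ex_last_nonzero[of x r] x N(1) by blast
  ultimately show ?thesis using x(1) by blast
qed

text \<open>Both sides are compared at the last non-zero coordinate of \<open>x\<close>.\<close>

lemma jordan_block_eigenvalue: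
  fixes \<mu> :: "'k::field"
  assumes x: "x \<in> carrier_vec r" "x \<noteq> 0\<^sub>v r" and eig: "jordan_block r \<mu> *\<^sub>v x = c \<cdot>\<^sub>v x"
  shows "c = \<mu>"
proof -
  obtain q where q: "q < r" "x $ q \<noteq> 0" "\<forall>i. q < i \<longrightarrow> i < r \<longrightarrow> x $ i = 0"
    using ex_last_nonzero[OF x] by blast
  have "c * x $ q = \<mu> * x $ q + (if Suc q < r then x $ Suc q else 0)"
    using jordan_block_mult_vec[OF x(1) q(1), of \<mu>] eig q x(1) by simp
  then show ?thesis using q by (auto split: if_splits)
qed

text \<open>Existence of a homogeneous vector of degree \<open>g\<close> on which certain group elements have prescribed
  eigenvalues, the set \<open>S\<close> of pairs. It is invariant under isomorphism.\<close>

definition joint_eigenvector ::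
    "('g, 'a) monoid_scheme \<Rightarrow> ('g, 'k::field, 'v, 'b) yd_module_scheme \<Rightarrow> 'g \<Rightarrow> ('g \<times> 'k) set \<Rightarrow> bool" where
  "joint_eigenvector G X g S \<longleftrightarrow>
    (\<exists>x\<in>carrier X. x \<noteq> \<zero>\<^bsub>X\<^esub> \<and> coaction X x g = x \<and> (\<forall>(h, c)\<in>S. action X h x = c \<odot>\<^bsub>X\<^esub> x))"

lemma joint_eigenvector_transport:
  assumes iso: "yd_isomorphic G X Y" and g: "g \<in> carrier G" "fst ` S \<subseteq> carrier G" and X: "joint_eigenvector G X g S"
  shows "joint_eigenvector G Y g S"
proof -
  obtain f where f: "linear_map class_ring X Y f" "bij_betw f (carrier X) (carrier Y)"
    and act: "\<And>g m. g \<in> carrier G \<Longrightarrow> m \<in> carrier X \<Longrightarrow> f (action X g m) = action Y g (f m)"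
    and coact: "\<And>g m. g \<in> carrier G \<Longrightarrow> m \<in> carrier X \<Longrightarrow> coaction Y (f m) g = f (coaction X m g)"
    using iso unfolding yd_isomorphic_def by blast
  interpret V: vectorspace class_ring X using f(1) by (simp add: linear_map_def)
  interpret L: linear_map class_ring X Y f by (rule f(1))
  obtain x where x: "x \<in> carrier X" "x \<noteq> \<zero>\<^bsub>X\<^esub>" "coaction X x g = x" "\<And>h c. (h, c) \<in> S \<Longrightarrow> action X h x = c \<odot>\<^bsub>X\<^esub> x"
    using X unfolding joint_eigenvector_def by blast
  have "f x \<noteq> \<zero>\<^bsub>Y\<^esub>"
  proof
    assume "f x = \<zero>\<^bsub>Y\<^esub>"
    then have "f x = f \<zero>\<^bsub>X\<^esub>" by simp
    then have "x = \<zero>\<^bsub>X\<^esub>" using bij_betw_imp_inj_on[OF f(2)] x(1) by (meson V.zero_closed inj_onD)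
    then show False using x(2) by simp
  qed
  moreover have "action Y h (f x) = c \<odot>\<^bsub>Y\<^esub> f x" if "(h, c) \<in> S" for h c
  proof -
    have "h \<in> carrier G" using that g(2) by force
    then show ?thesis using act[of h x] x(1) x(4)[OF that] by simp
  qed
  moreover have "coaction Y (f x) g = f x" using coact[OF g(1) x(1)] x(3) by simp
  moreover have "f x \<in> carrier Y" using x(1) by simp
  ultimately show ?thesis unfolding joint_eigenvector_def by blast
qed

lemma unipotent_indecomposable:
  fixes \<sigma> :: "'k::field"
  assumes J: "jordan_block r (1::'k) ^\<^sub>m n = 1\<^sub>m r" and n: "1 < n" and \<sigma>: "\<sigma> * \<sigma> = 1" and r: "0 < r"
    and data: "unipotent_data n r \<sigma> \<rho> \<delta>"
  shows "yd_indecomposable (dihedral n) (yd_of_rep (dihedral n) r \<rho> \<delta>)"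
proof (rule yd_indecomposable_if_socle)
  note yd = unipotent_yd[OF J n \<sigma> data]
  show "yetter_drinfeld (dihedral n) (yd_of_rep (dihedral n) r \<rho> \<delta>)" by (rule yd(1))
  show "unit_vec r 0 \<in> carrier (yd_of_rep (dihedral n) r \<rho> \<delta>)" by simp
  show "unit_vec r 0 \<noteq> \<zero>\<^bsub>yd_of_rep (dihedral n) r \<rho> \<delta>\<^esub>"
    using r by (simp add: unit_vec_neq_0)
  fix N x assume N: "yd_submodule (dihedral n) N (yd_of_rep (dihedral n) r \<rho> \<delta>)"
    and x: "x \<in> N" "x \<noteq> \<zero>\<^bsub>yd_of_rep (dihedral n) r \<rho> \<delta>\<^esub>"
  note sub = yd_submodule_yd_of_repD[OF N]
  have "dih_a n \<in> carrier (dihedral n)" using n by (simp add: dihedral_simps dih_a_def)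
  then have J_N: "jordan_block r 1 *\<^sub>v y \<in> N" if "y \<in> N" for y
    using sub(5)[of "dih_a n" y] that unfolding yd(2) by blast
  have "x \<noteq> 0\<^sub>v r" using x(2) by simp
  show "unit_vec r 0 \<in> N"
    by (rule jordan_block_socle[of N r 1 x]) (fact sub(1) sub(3) sub(4) J_N x(1) \<open>x \<noteq> 0\<^sub>v r\<close>)+
qed

text \<open>The eigenvectors of a Jordan block are the multiples of the first unit vector. The sign with which
  \<open>b\<close> acts on it, together with \<open>r\<close>, determines \<open>\<sigma>\<close>.\<close>

lemma unipotent_joint_eigenvector:
  fixes \<sigma> :: "'k::field"
  assumes J: "jordan_block r (1::'k) ^\<^sub>m n = 1\<^sub>m r" and n: "1 < n" and \<sigma>: "\<sigma> * \<sigma> = 1" and r: "0 < r"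
    and data: "unipotent_data n r \<sigma> \<rho> \<delta>"
  defines "X \<equiv> yd_of_rep (dihedral n) r \<rho> \<delta>"
  shows "joint_eigenvector (dihedral n) X (0, False) {(dih_a n, 1), (dih_b, \<sigma> * (- 1) ^ (r - 1))}"
    and "g \<in> carrier (dihedral n) \<Longrightarrow> joint_eigenvector (dihedral n) X g S \<Longrightarrow> g = (0, False)"
    and "(dih_a n, c) \<in> S \<Longrightarrow> joint_eigenvector (dihedral n) X g S \<Longrightarrow> c = 1"
    and "(dih_a n, 1) \<in> S \<Longrightarrow> (dih_b, c) \<in> S \<Longrightarrow> joint_eigenvector (dihedral n) X g S \<Longrightarrow> c = \<sigma> * (- 1) ^ (r - 1)"
proof -
  note yd = unipotent_yd[OF J n \<sigma> data]
  have \<delta>: "\<delta> i = (0, False)" if "i < r" for i using data that by (simp add: unipotent_data_def)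
  have Tb: "((\<sigma> \<cdot>\<^sub>m T_mat r) *\<^sub>v x) $ 0 = \<sigma> * (\<Sum>k<r. (- 1) ^ (r - 1) * of_nat ((r - 1) choose k) * x $ k)"
    if "x \<in> carrier_vec r" for x
    using that r by (simp add: scalar_prod_def lessThan_atLeast0 T_mat_index sum_distrib_left mult.assoc)
  have T0: "(\<Sum>k<r. (- 1 :: 'k) ^ (r - 1) * of_nat ((r - 1) choose k) * x $ k) = (- 1) ^ (r - 1) * x $ 0"
    if "\<And>k. 0 < k \<Longrightarrow> k < r \<Longrightarrow> x $ k = 0" for x
  proof -
    have "(\<Sum>k<r. (- 1 :: 'k) ^ (r - 1) * of_nat ((r - 1) choose k) * x $ k) =
        (\<Sum>k<r. if k = 0 then (- 1) ^ (r - 1) * x $ 0 else 0)"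
      using that by (intro sum.cong) auto
    then show ?thesis using r by (simp add: sum.delta)
  qed
  show "joint_eigenvector (dihedral n) X (0, False) {(dih_a n, 1), (dih_b, \<sigma> * (- 1) ^ (r - 1))}"
    unfolding joint_eigenvector_def
  proof (intro bexI[of _ "unit_vec r 0"] conjI)
    show "unit_vec r 0 \<in> carrier X" by (simp add: X_def)
    show "unit_vec r 0 \<noteq> \<zero>\<^bsub>X\<^esub>"
      using r by (simp add: X_def unit_vec_neq_0)
    show "coaction X (unit_vec r 0) (0, False) = unit_vec r 0"
      using n by (auto simp: X_def dihedral_simps \<delta> intro!: eq_vecI)
    have "jordan_block r 1 *\<^sub>v unit_vec r 0 = (1 :: 'k) \<cdot>\<^sub>v unit_vec r 0"
    proof (rule eq_vecI)
      fix i assume "i < dim_vec ((1 :: 'k) \<cdot>\<^sub>v unit_vec r 0)"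
      then have "i < r" by simp
      then show "(jordan_block r 1 *\<^sub>v unit_vec r 0) $ i = ((1 :: 'k) \<cdot>\<^sub>v unit_vec r 0) $ i"
        by (subst jordan_block_mult_vec) auto
    qed simp
    moreover have "(\<sigma> \<cdot>\<^sub>m T_mat r) *\<^sub>v unit_vec r 0 = (\<sigma> * (- 1) ^ (r - 1)) \<cdot>\<^sub>v unit_vec r 0"
    proof (rule eq_vecI)
      fix i assume "i < dim_vec ((\<sigma> * (- 1) ^ (r - 1)) \<cdot>\<^sub>v unit_vec r 0)"
      then have i: "i < r" by simp
      have "((\<sigma> \<cdot>\<^sub>m T_mat r) *\<^sub>v unit_vec r 0) $ i = (\<sigma> \<cdot>\<^sub>m T_mat r) $$ (i, 0)"
        using i r by simp
      then show "((\<sigma> \<cdot>\<^sub>m T_mat r) *\<^sub>v unit_vec r 0) $ i = ((\<sigma> * (- 1) ^ (r - 1)) \<cdot>\<^sub>v unit_vec r 0) $ i"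
        using i r by (simp add: T_mat_index)
    qed simp
    ultimately show "\<forall>(h, c)\<in>{(dih_a n, 1), (dih_b, \<sigma> * (- 1) ^ (r - 1))}. action X h (unit_vec r 0) = c \<odot>\<^bsub>X\<^esub> unit_vec r 0"
      by (simp add: X_def yd(2,3))
  qed
  {
    assume g: "g \<in> carrier (dihedral n)" and "joint_eigenvector (dihedral n) X g S"
    then obtain x where "x \<in> carrier X" "x \<noteq> \<zero>\<^bsub>X\<^esub>" "coaction X x g = x"
      unfolding joint_eigenvector_def by blast
    then have x: "x \<in> carrier_vec r" "x \<noteq> 0\<^sub>v r" "vec r (\<lambda>i. if \<delta> i = g then x $ i else 0) = x"
      using g by (simp_all add: X_def)
    then obtain q where "q < r" "x $ q \<noteq> 0" using ex_last_nonzero by blast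
    then have "\<delta> q = g" using arg_cong[OF x(3), of "\<lambda>v. v $ q"] by (auto split: if_splits)
    then show "g = (0, False)" using \<delta> \<open>q < r\<close> by simp
  }
  {
    assume S: "(dih_a n, c) \<in> S" and "joint_eigenvector (dihedral n) X g S"
    then obtain x where "x \<in> carrier X" "x \<noteq> \<zero>\<^bsub>X\<^esub>" "action X (dih_a n) x = c \<odot>\<^bsub>X\<^esub> x"
      unfolding joint_eigenvector_def by blast
    then have x: "x \<in> carrier_vec r" "x \<noteq> 0\<^sub>v r" "jordan_block r 1 *\<^sub>v x = c \<cdot>\<^sub>v x"
      by (simp_all add: X_def yd(2))
    then show "c = 1" by (rule jordan_block_eigenvalue)
  }
  {
    assume S: "(dih_a n, 1) \<in> S" "(dih_b, c) \<in> S" and "joint_eigenvector (dihedral n) X g S"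
    then obtain x where xX: "x \<in> carrier X" "x \<noteq> \<zero>\<^bsub>X\<^esub>" and xS: "\<And>h c. (h, c) \<in> S \<Longrightarrow> action X h x = c \<odot>\<^bsub>X\<^esub> x"
      unfolding joint_eigenvector_def by blast
    have x: "x \<in> carrier_vec r" "x \<noteq> 0\<^sub>v r" using xX by (simp_all add: X_def)
    have a: "jordan_block r 1 *\<^sub>v x = 1 \<cdot>\<^sub>v x" and b: "(\<sigma> \<cdot>\<^sub>m T_mat r) *\<^sub>v x = c \<cdot>\<^sub>v x"
      using xS[OF S(1)] xS[OF S(2)] unfolding X_def yd_of_rep_simps yd(2,3) .
    have z: "x $ k = 0" if "0 < k" "k < r" for k
    proof -
      have k: "k - 1 < r" "Suc (k - 1) = k" using that by auto
      then show ?thesis using jordan_block_mult_vec[OF x(1) k(1), of 1] a x(1) that by simp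
    qed
    have "x $ 0 \<noteq> 0"
    proof -
      obtain q where "q < r" "x $ q \<noteq> 0" using ex_last_nonzero[OF x] by blast
      then show ?thesis using z by (cases "q = 0") auto
    qed
    moreover have "c * x $ 0 = \<sigma> * ((- 1) ^ (r - 1) * x $ 0)"
      using Tb[OF x(1)] T0[OF z] b x(1) r by simp
    ultimately show "c = \<sigma> * (- 1) ^ (r - 1)" by simp
  }
qed

lemma reflection_coaction:
  fixes \<sigma> :: "'k::field" and x :: "'k vec"
  assumes n: "odd n" "i < n" and data: "reflection_data n \<sigma> \<rho> \<delta>" and x: "x \<in> carrier_vec n"
  shows "vec n (\<lambda>k. if \<delta> k = (2 * i mod n, True) then x $ k else 0) = x $ i \<cdot>\<^sub>v unit_vec n i"
proof (rule eq_vecI)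
  fix k assume "k < dim_vec (x $ i \<cdot>\<^sub>v unit_vec n i)"
  then have k: "k < n" by simp
  then show "vec n (\<lambda>k. if \<delta> k = (2 * i mod n, True) then x $ k else 0) $ k = (x $ i \<cdot>\<^sub>v unit_vec n i) $ k"
    using data n double_mod_inj[OF n(1) k n(2)] by (simp add: reflection_data_def)
qed simp

text \<open>The homogeneous components are lines, permuted transitively by \<open>a\<close>, so any non-zero submodule
  contains all of them.\<close>

lemma reflection_indecomposable:
  fixes \<sigma> :: "'k::field"
  assumes n: "1 < n" "odd n" and \<sigma>: "\<sigma> * \<sigma> = 1" and data: "reflection_data n \<sigma> \<rho> \<delta>"
  shows "yd_indecomposable (dihedral n) (yd_of_rep (dihedral n) n \<rho> \<delta>)"
proof (rule yd_indecomposable_if_socle)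
  have n0: "0 < n" using n by simp
  show "yetter_drinfeld (dihedral n) (yd_of_rep (dihedral n) n \<rho> \<delta>)" by (rule reflection_yd[OF n(1) \<sigma> data])
  show "unit_vec n 0 \<in> carrier (yd_of_rep (dihedral n) n \<rho> \<delta>)" by simp
  show "unit_vec n 0 \<noteq> \<zero>\<^bsub>yd_of_rep (dihedral n) n \<rho> \<delta>\<^esub>"
    using n0 by (simp add: unit_vec_neq_0)
  fix N x assume N: "yd_submodule (dihedral n) N (yd_of_rep (dihedral n) n \<rho> \<delta>)"
    and x: "x \<in> N" "x \<noteq> \<zero>\<^bsub>yd_of_rep (dihedral n) n \<rho> \<delta>\<^esub>"
  note sub = yd_submodule_yd_of_repD[OF N]
  have xc: "x \<in> carrier_vec n" using x sub(1) by blast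
  obtain i where i: "i < n" "x $ i \<noteq> 0" using ex_last_nonzero[OF xc] x by auto
  have "x $ i \<cdot>\<^sub>v unit_vec n i \<in> N"
    using sub(6)[of "(2 * i mod n, True)" x] x n0 reflection_coaction[OF n(2) i(1) data xc] by (simp add: dihedral_simps)
  then have "inverse (x $ i) \<cdot>\<^sub>v (x $ i \<cdot>\<^sub>v unit_vec n i) \<in> N" by (rule sub(4))
  then have ei: "unit_vec n i \<in> N" using i by (simp add: smult_smult_assoc)
  have step: "unit_vec n ((k + 1) mod n) \<in> N" if "unit_vec n k \<in> N" "k < n" for k
  proof -
    have "\<rho> (dih_a n) *\<^sub>v unit_vec n k \<in> N"
      using sub(5)[of "dih_a n" "unit_vec n k"] that n0 by (simp add: dih_a_def dihedral_simps)
    moreover have "\<rho> (dih_a n) *\<^sub>v unit_vec n k = unit_vec n ((k + 1) mod n)"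
    proof (rule eq_vecI)
      have "\<rho> (dih_a n) = mat n n (\<lambda>(p, q). if p = fst (dih_a n \<otimes>\<^bsub>dihedral n\<^esub> (q, False)) then (if snd (dih_a
        n) then \<sigma> else 1) else 0)"
        using data dihedral_relations(1)[OF n0] by (simp add: reflection_data_def)
      then show "dim_vec (\<rho> (dih_a n) *\<^sub>v unit_vec n k) = dim_vec (unit_vec n ((k + 1) mod n))" by simp
      fix m assume "m < dim_vec (unit_vec n ((k + 1) mod n) :: 'k vec)"
      then have m: "m < n" by simp
      have "(m + n - 1) mod n = k \<longleftrightarrow> m = (k + 1) mod n"
        using m that n by (cases "m = 0"; cases "Suc k = n") (auto simp: mod_if)
      then show "(\<rho> (dih_a n) *\<^sub>v unit_vec n k) $ m = unit_vec n ((k + 1) mod n) $ m"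
        using reflection_action(1)[OF n(1) data _ m, of "unit_vec n k"] m n0 that by auto
    qed
    ultimately show ?thesis by simp
  qed
  have "unit_vec n ((i + k) mod n) \<in> N" for k
  proof (induction k)
    case (Suc k)
    then show ?case using step[of "(i + k) mod n"] n0 by (simp add: mod_simps)
  qed (use ei i in simp)
  from this[of "n - i"] show "unit_vec n 0 \<in> N" using i by simp
qed

lemma reflection_joint_eigenvector:
  fixes \<sigma> :: "'k::field"
  assumes n: "1 < n" "odd n" and \<sigma>: "\<sigma> * \<sigma> = 1" and data: "reflection_data n \<sigma> \<rho> \<delta>"
  defines "X \<equiv> yd_of_rep (dihedral n) n \<rho> \<delta>"
  shows "joint_eigenvector (dihedral n) X (0, True) {(dih_b, \<sigma>)}"
    and "g \<in> carrier (dihedral n) \<Longrightarrow> joint_eigenvector (dihedral n) X g S \<Longrightarrow> snd g"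
    and "(dih_b, c) \<in> S \<Longrightarrow> joint_eigenvector (dihedral n) X (0, True) S \<Longrightarrow> c = \<sigma>"
proof -
  have n0: "0 < n" using n by simp
  have \<delta>: "\<delta> i = (2 * i mod n, True)" if "i < n" for i using data that by (simp add: reflection_data_def)
  have \<rho>b: "\<rho> dih_b \<in> carrier_mat n n"
    using data dihedral_relations(2)[OF n0] by (simp add: reflection_data_def)
  show "joint_eigenvector (dihedral n) X (0, True) {(dih_b, \<sigma>)}"
    unfolding joint_eigenvector_def
  proof (intro bexI[of _ "unit_vec n 0"] conjI)
    show "unit_vec n 0 \<in> carrier X" by (simp add: X_def)
    show "unit_vec n 0 \<noteq> \<zero>\<^bsub>X\<^esub>"
      using n0 by (simp add: X_def unit_vec_neq_0)
    show "coaction X (unit_vec n 0) (0, True) = unit_vec n 0"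
      using n0 reflection_coaction[OF n(2) n0 data, of "unit_vec n 0"]
      by (simp add: X_def dihedral_simps one_smult_vec)
    have "\<rho> dih_b *\<^sub>v unit_vec n 0 = \<sigma> \<cdot>\<^sub>v unit_vec n 0"
    proof (rule eq_vecI)
      fix i assume "i < dim_vec (\<sigma> \<cdot>\<^sub>v unit_vec n 0)"
      then have i: "i < n" by simp
      have "(n - i) mod n = 0 \<longleftrightarrow> i = 0" using i by (cases "i = 0") auto
      then show "(\<rho> dih_b *\<^sub>v unit_vec n 0) $ i = (\<sigma> \<cdot>\<^sub>v unit_vec n 0) $ i"
        using reflection_action(2)[OF n(1) data _ i, of "unit_vec n 0"] i n0 by simp
    qed (use \<rho>b in simp)
    then show "\<forall>(h, c)\<in>{(dih_b, \<sigma>)}. action X h (unit_vec n 0) = c \<odot>\<^bsub>X\<^esub> unit_vec n 0"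
      by (simp add: X_def)
  qed
  {
    assume g: "g \<in> carrier (dihedral n)" and "joint_eigenvector (dihedral n) X g S"
    then obtain x where "x \<in> carrier X" "x \<noteq> \<zero>\<^bsub>X\<^esub>" "coaction X x g = x"
      unfolding joint_eigenvector_def by blast
    then have x: "x \<in> carrier_vec n" "x \<noteq> 0\<^sub>v n" "vec n (\<lambda>i. if \<delta> i = g then x $ i else 0) = x"
      using g by (simp_all add: X_def)
    then obtain q where "q < n" "x $ q \<noteq> 0" using ex_last_nonzero by blast
    then have "\<delta> q = g" using arg_cong[OF x(3), of "\<lambda>v. v $ q"] by (auto split: if_splits)
    then show "snd g" using \<delta> \<open>q < n\<close> by auto
  }
  {
    assume S: "(dih_b, c) \<in> S" and "joint_eigenvector (dihedral n) X (0, True) S"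
    then obtain x where x: "x \<in> carrier X" "x \<noteq> \<zero>\<^bsub>X\<^esub>" "coaction X x (0, True) = x" "action X dih_b x = c \<odot>\<^bsub>X\<^esub> x"
      unfolding joint_eigenvector_def by blast
    have xc: "x \<in> carrier_vec n" using x(1) by (simp add: X_def)
    have "x = x $ 0 \<cdot>\<^sub>v unit_vec n 0"
      using x(3) reflection_coaction[OF n(2) n0 data xc] n0 by (simp add: X_def dihedral_simps)
    then have "x $ 0 \<noteq> 0" using x(2) by (auto simp: X_def)
    moreover have "c * x $ 0 = \<sigma> * x $ 0"
      using arg_cong[OF x(4), of "\<lambda>v. v $ 0"] reflection_action(2)[OF n(1) data xc n0] n0 xc by (auto simp: X_def)
    ultimately show "c = \<sigma>" by simp
  }
qed

lemma mult_mat_vec_zero: "A \<in> carrier_mat m r \<Longrightarrow> A *\<^sub>v 0\<^sub>v r = (0\<^sub>v m :: 'k::field vec)"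
  by (auto intro!: eq_vecI)

lemma scalar_mat_mult_vec:
  fixes x :: "'k::field vec"
  assumes "x \<in> carrier_vec r"
  shows "(c \<cdot>\<^sub>m 1\<^sub>m r) *\<^sub>v x = c \<cdot>\<^sub>v x"
proof (rule eq_vecI)
  fix i assume "i < dim_vec (c \<cdot>\<^sub>v x)"
  then have i: "i < r" using assms by simp
  have "((c \<cdot>\<^sub>m 1\<^sub>m r) *\<^sub>v x) $ i = (c \<cdot>\<^sub>v unit_vec r i) \<bullet> x" using i by simp
  also have "\<dots> = c * (unit_vec r i \<bullet> x)" using assms by (intro smult_scalar_prod_distrib) auto
  finally show "((c \<cdot>\<^sub>m 1\<^sub>m r) *\<^sub>v x) $ i = (c \<cdot>\<^sub>v x) $ i" using i assms by simp
qed (use assms in simp)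

lemma append_vec_split:
  assumes "z \<in> carrier_vec (2 * r)"
  obtains x y where "x \<in> carrier_vec r" "y \<in> carrier_vec r" "z = x @\<^sub>v y"
proof
  show "vec_first z r \<in> carrier_vec r" "vec_last z r \<in> carrier_vec r" by auto
  show "z = vec_first z r @\<^sub>v vec_last z r" using assms by (intro vec_first_last_append[symmetric]) (simp only: mult_2)
qed

lemma append_vec_zero: "0\<^sub>v r @\<^sub>v 0\<^sub>v r = (0\<^sub>v (2 * r) :: 'k::zero vec)"
  by (intro eq_vecI) auto

text \<open>The two halves of the module are separated by their degrees or, failing that, by the scalars with
  which \<open>a ^ p ^ s\<close> acts on them. Hence a non-zero submodule contains a non-zero vector of the first
  half (after applying \<open>b\<close>, if necessary), and then the first unit vector by the lemma on Jordan blocks.\<close>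

lemma rotation_indecomposable:
  fixes \<mu> :: "'k::field"
  assumes p: "CHAR('k) = p" "prime p" and r: "0 < r" "r \<le> p ^ s"
    and J: "jordan_block r \<mu> ^\<^sub>m n = 1\<^sub>m r" and n: "1 < n" and l: "l < n"
    and distinct: "(n - l) mod n \<noteq> l \<or> \<mu> ^ (p ^ s) \<noteq> \<mu> ^ (p ^ s * (n - 1))"
    and data: "rotation_data n r l \<mu> \<rho> \<delta>"
  shows "yd_indecomposable (dihedral n) (yd_of_rep (dihedral n) (2 * r) \<rho> \<delta>)"
proof (rule yd_indecomposable_if_socle)
  have n0: "0 < n" using n by simp
  note ab = dihedral_relations(1,2)[OF n0]
  let ?J = "jordan_block r \<mu>" and ?J' = "jordan_block r \<mu> ^\<^sub>m (n - 1)"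
  have c: "?J \<in> carrier_mat r r" "?J' \<in> carrier_mat r r" by auto
  let ?w = "unit_vec r 0 @\<^sub>v 0\<^sub>v r :: 'k vec"
  show "yetter_drinfeld (dihedral n) (yd_of_rep (dihedral n) (2 * r) \<rho> \<delta>)" by (rule rotation_yd[OF J n l data])
  show "?w \<in> carrier (yd_of_rep (dihedral n) (2 * r) \<rho> \<delta>)" by (simp add: mult_2 carrier_vecI)
  show "?w \<noteq> \<zero>\<^bsub>yd_of_rep (dihedral n) (2 * r) \<rho> \<delta>\<^esub>"
    using r by (simp add: unit_vec_neq_0 append_unit_vec_neq_0)
  fix N z assume N: "yd_submodule (dihedral n) N (yd_of_rep (dihedral n) (2 * r) \<rho> \<delta>)"
    and z: "z \<in> N" "z \<noteq> \<zero>\<^bsub>yd_of_rep (dihedral n) (2 * r) \<rho> \<delta>\<^esub>"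
  note sub = yd_submodule_yd_of_repD[OF N]
  have \<delta>: "\<delta> i = (if i < r then l else (n - l) mod n, False)" if "i < 2 * r" for i
    using data that by (simp add: rotation_data_def)
  have aN: "(?J *\<^sub>v x) @\<^sub>v (?J' *\<^sub>v y) \<in> N" if "x @\<^sub>v y \<in> N" "x \<in> carrier_vec r" "y \<in> carrier_vec r" for x y
    using sub(5)[OF ab(1) that(1)] rotation_action(1)[OF n data that(2,3)] by simp
  have bN: "y @\<^sub>v x \<in> N" if "x @\<^sub>v y \<in> N" "x \<in> carrier_vec r" "y \<in> carrier_vec r" for x y
    using sub(5)[OF ab(2) that(1)] rotation_action(2)[OF n data that(2,3)] by simp
  have apN: "(?J ^\<^sub>m k *\<^sub>v x) @\<^sub>v (?J' ^\<^sub>m k *\<^sub>v y) \<in> N"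
    if "x @\<^sub>v y \<in> N" "x \<in> carrier_vec r" "y \<in> carrier_vec r" for x y k
    using that
  proof (induction k arbitrary: x y)
    case 0
    then show ?case by simp
  next
    case (Suc k)
    have Jx: "?J *\<^sub>v x \<in> carrier_vec r" "?J' *\<^sub>v y \<in> carrier_vec r"
      using mult_mat_vec_carrier[OF c(1) Suc.prems(2)] mult_mat_vec_carrier[OF c(2) Suc.prems(3)] by simp_all
    have "?J ^\<^sub>m Suc k *\<^sub>v x = ?J ^\<^sub>m k *\<^sub>v (?J *\<^sub>v x)"
      using assoc_mult_mat_vec[OF pow_carrier_mat[OF c(1)] c(1) Suc.prems(2), of k] by simp
    moreover have "?J' ^\<^sub>m Suc k *\<^sub>v y = ?J' ^\<^sub>m k *\<^sub>v (?J' *\<^sub>v y)"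
      using assoc_mult_mat_vec[OF pow_carrier_mat[OF c(2)] c(2) Suc.prems(3), of k] by simp
    ultimately show ?case using Suc.IH[OF aN[OF Suc.prems] Jx] by simp
  qed
  obtain x y where xy: "x \<in> carrier_vec r" "y \<in> carrier_vec r" "z = x @\<^sub>v y"
    using append_vec_split[of z r] sub(1) z(1) by blast
  have "\<exists>x\<in>carrier_vec r. x \<noteq> 0\<^sub>v r \<and> x @\<^sub>v 0\<^sub>v r \<in> N"
  proof (cases "x = 0\<^sub>v r")
    case True
    then have "y \<noteq> 0\<^sub>v r" using z(2) xy append_vec_zero[of r, where 'k = 'k] by auto
    moreover have "y @\<^sub>v 0\<^sub>v r \<in> N" using bN[of x y] z(1) xy True by simp
    ultimately show ?thesis using xy by blast
  next
    case x0: False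
    show ?thesis
    proof (cases "(n - l) mod n = l")
      case False
      have "vec (2 * r) (\<lambda>i. if \<delta> i = (l, False) then z $ i else 0) = x @\<^sub>v 0\<^sub>v r"
        using xy False by (intro eq_vecI) (auto simp: \<delta>)
      then have "x @\<^sub>v 0\<^sub>v r \<in> N"
        using sub(6)[of "(l, False)" z] z(1) l by (simp add: dihedral_simps)
      then show ?thesis using x0 xy by blast
    next
      case True
      define e where "e = \<mu> ^ (p ^ s)"
      define e' where "e' = \<mu> ^ (p ^ s * (n - 1))"
      have ee: "e - e' \<noteq> 0" using distinct True by (simp add: e_def e'_def)
      have "?J ^\<^sub>m (p ^ s) = e \<cdot>\<^sub>m 1\<^sub>m r"
        using jordan_block_pow_scalar[OF p r(2), of \<mu> 1] by (simp add: e_def)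
      moreover have "?J' ^\<^sub>m (p ^ s) = e' \<cdot>\<^sub>m 1\<^sub>m r"
        using jordan_block_pow_scalar[OF p r(2), of \<mu> "n - 1"] pow_mat_mult[OF c(1), of "n - 1" "p ^ s"]
        by (simp add: e'_def mult.commute)
      ultimately have "(e \<cdot>\<^sub>v x) @\<^sub>v (e' \<cdot>\<^sub>v y) \<in> N"
        using apN[of x y "p ^ s"] z(1) xy by (simp add: scalar_mat_mult_vec)
      moreover have "(- e') \<cdot>\<^sub>v (x @\<^sub>v y) \<in> N" using sub(4) z(1) xy by simp
      ultimately have "((e \<cdot>\<^sub>v x) @\<^sub>v (e' \<cdot>\<^sub>v y)) + (- e') \<cdot>\<^sub>v (x @\<^sub>v y) \<in> N" by (rule sub(3))
      moreover have "((e \<cdot>\<^sub>v x) @\<^sub>v (e' \<cdot>\<^sub>v y)) + (- e') \<cdot>\<^sub>v (x @\<^sub>v y) = ((e - e') \<cdot>\<^sub>v x) @\<^sub>v 0\<^sub>v r"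
        using xy by (intro eq_vecI) (auto simp: algebra_simps)
      moreover have "(e - e') \<cdot>\<^sub>v x \<noteq> 0\<^sub>v r"
      proof
        assume eq: "(e - e') \<cdot>\<^sub>v x = 0\<^sub>v r"
        have "x $ i = 0" if "i < r" for i
        proof -
          have "(e - e') * x $ i = ((e - e') \<cdot>\<^sub>v x) $ i" using that xy by simp
          also have "\<dots> = 0" unfolding eq using that by simp
          finally show ?thesis using ee by simp
        qed
        then have "x = 0\<^sub>v r" using xy by (intro eq_vecI) auto
        then show False using x0 by simp
      qed
      ultimately show ?thesis using xy by (intro bexI[of _ "(e - e') \<cdot>\<^sub>v x"]) auto
    qed
  qed
  then obtain x' where x': "x' \<in> carrier_vec r" "x' \<noteq> 0\<^sub>v r" "x' @\<^sub>v 0\<^sub>v r \<in> N" by blast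
  define N' where "N' = {x \<in> carrier_vec r. x @\<^sub>v 0\<^sub>v r \<in> N}"
  have "unit_vec r 0 \<in> N'"
  proof (rule jordan_block_socle[of N' r \<mu> x'])
    show "N' \<subseteq> carrier_vec r" by (auto simp: N'_def)
    show "x + y \<in> N'" if "x \<in> N'" "y \<in> N'" for x y
    proof -
      have "(x + y) @\<^sub>v 0\<^sub>v r = (x @\<^sub>v 0\<^sub>v r) + (y @\<^sub>v 0\<^sub>v r)" using that by (auto simp: N'_def intro!: eq_vecI)
      then show ?thesis using that sub(3)[of "x @\<^sub>v 0\<^sub>v r" "y @\<^sub>v 0\<^sub>v r"] by (simp add: N'_def)
    qed
    show "c \<cdot>\<^sub>v x \<in> N'" if "x \<in> N'" for c x
    proof -
      have "(c \<cdot>\<^sub>v x) @\<^sub>v 0\<^sub>v r = c \<cdot>\<^sub>v (x @\<^sub>v 0\<^sub>v r)" using that by (auto simp: N'_def intro!: eq_vecI)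
      then show ?thesis using that sub(4)[of "x @\<^sub>v 0\<^sub>v r" c] by (simp add: N'_def)
    qed
    show "?J *\<^sub>v x \<in> N'" if "x \<in> N'" for x
    proof -
      have "?J' *\<^sub>v 0\<^sub>v r = 0\<^sub>v r" by (rule mult_mat_vec_zero[OF c(2)])
      then show ?thesis using aN[of x "0\<^sub>v r"] that mult_mat_vec_carrier[OF c(1), of x] by (simp add: N'_def)
    qed
  qed (use x' in \<open>auto simp: N'_def\<close>)
  then show "?w \<in> N" by (simp add: N'_def)
qed

lemma rotation_joint_eigenvector:
  fixes \<mu> :: "'k::field"
  assumes J: "jordan_block r \<mu> ^\<^sub>m n = 1\<^sub>m r" and r: "0 < r" and n: "1 < n" and l: "l < n"
    and data: "rotation_data n r l \<mu> \<rho> \<delta>"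
  defines "X \<equiv> yd_of_rep (dihedral n) (2 * r) \<rho> \<delta>"
  shows "joint_eigenvector (dihedral n) X (l, False) {(dih_a n, \<mu>)}"
    and "g \<in> carrier (dihedral n) \<Longrightarrow> (dih_a n, c) \<in> S \<Longrightarrow> joint_eigenvector (dihedral n) X g S \<Longrightarrow>
      g = (l, False) \<and> c = \<mu> \<or> g = ((n - l) mod n, False) \<and> c * \<mu> = 1"
proof -
  have n0: "0 < n" using n by simp
  let ?J = "jordan_block r \<mu>" and ?J' = "jordan_block r \<mu> ^\<^sub>m (n - 1)"
  have cJ: "?J \<in> carrier_mat r r" "?J' \<in> carrier_mat r r" by auto
  have \<delta>: "\<delta> i = (if i < r then l else (n - l) mod n, False)" if "i < 2 * r" for i
    using data that by (simp add: rotation_data_def)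
  show "joint_eigenvector (dihedral n) X (l, False) {(dih_a n, \<mu>)}"
    unfolding joint_eigenvector_def
  proof (intro bexI[of _ "unit_vec r 0 @\<^sub>v 0\<^sub>v r"] conjI)
    show "unit_vec r 0 @\<^sub>v 0\<^sub>v r \<in> carrier X" by (simp add: X_def mult_2 carrier_vecI)
    show "unit_vec r 0 @\<^sub>v 0\<^sub>v r \<noteq> \<zero>\<^bsub>X\<^esub>"
      using r by (simp add: X_def unit_vec_neq_0 append_unit_vec_neq_0)
    show "coaction X (unit_vec r 0 @\<^sub>v 0\<^sub>v r) (l, False) = unit_vec r 0 @\<^sub>v 0\<^sub>v r"
      using l by (auto simp: X_def dihedral_simps \<delta> intro!: eq_vecI)
    have "?J *\<^sub>v unit_vec r 0 = \<mu> \<cdot>\<^sub>v unit_vec r 0"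
    proof (rule eq_vecI)
      fix i assume "i < dim_vec (\<mu> \<cdot>\<^sub>v unit_vec r 0)"
      then have "i < r" by simp
      then show "(?J *\<^sub>v unit_vec r 0) $ i = (\<mu> \<cdot>\<^sub>v unit_vec r 0) $ i"
        by (subst jordan_block_mult_vec) auto
    qed simp
    moreover have "?J' *\<^sub>v 0\<^sub>v r = 0\<^sub>v r" by (rule mult_mat_vec_zero[OF cJ(2)])
    ultimately have "\<rho> (dih_a n) *\<^sub>v (unit_vec r 0 @\<^sub>v 0\<^sub>v r) = \<mu> \<cdot>\<^sub>v (unit_vec r 0 @\<^sub>v 0\<^sub>v r)"
      using rotation_action(1)[OF n data, of "unit_vec r 0" "0\<^sub>v r"] by (auto intro!: eq_vecI)
    then show "\<forall>(h, c)\<in>{(dih_a n, \<mu>)}. action X h (unit_vec r 0 @\<^sub>v 0\<^sub>v r) = c \<odot>\<^bsub>X\<^esub> (unit_vec r 0 @\<^sub>v 0\<^sub>v r)"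
      by (simp add: X_def)
  qed
  assume g: "g \<in> carrier (dihedral n)" and S: "(dih_a n, c) \<in> S" and "joint_eigenvector (dihedral n) X g S"
  then obtain z where z: "z \<in> carrier X" "z \<noteq> \<zero>\<^bsub>X\<^esub>" "coaction X z g = z" "action X (dih_a n) z = c \<odot>\<^bsub>X\<^esub> z"
    unfolding joint_eigenvector_def by blast
  obtain x y where xy: "x \<in> carrier_vec r" "y \<in> carrier_vec r" "z = x @\<^sub>v y"
    using append_vec_split[of z r] z(1) by (auto simp: X_def)
  have co: "vec (2 * r) (\<lambda>i. if \<delta> i = g then z $ i else 0) = z" using z(3) g by (simp add: X_def)
  have \<delta>g: "\<delta> q = g" if "q < 2 * r" "z $ q \<noteq> 0" for q
    using arg_cong[OF co, of "\<lambda>v. v $ q"] that by (auto split: if_splits)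
  have Jx: "?J *\<^sub>v x \<in> carrier_vec r" "?J' *\<^sub>v y \<in> carrier_vec r"
    using mult_mat_vec_carrier[OF cJ(1) xy(1)] mult_mat_vec_carrier[OF cJ(2) xy(2)] by simp_all
  have "(?J *\<^sub>v x) @\<^sub>v (?J' *\<^sub>v y) = (c \<cdot>\<^sub>v x) @\<^sub>v (c \<cdot>\<^sub>v y)"
  proof -
    have "c \<cdot>\<^sub>v (x @\<^sub>v y) = (c \<cdot>\<^sub>v x) @\<^sub>v (c \<cdot>\<^sub>v y)" using xy by (auto intro!: eq_vecI)
    then show ?thesis using z(4) rotation_action(1)[OF n data xy(1,2)] xy(3) by (simp add: X_def)
  qed
  then have eig: "?J *\<^sub>v x = c \<cdot>\<^sub>v x" "?J' *\<^sub>v y = c \<cdot>\<^sub>v y"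
    using append_vec_eq[of "?J *\<^sub>v x" r "c \<cdot>\<^sub>v x"] Jx xy by auto
  show "g = (l, False) \<and> c = \<mu> \<or> g = ((n - l) mod n, False) \<and> c * \<mu> = 1"
  proof (cases "x = 0\<^sub>v r")
    case False
    then obtain q where q: "q < r" "x $ q \<noteq> 0" using ex_last_nonzero[OF xy(1)] by blast
    then have "\<delta> q = g" using xy by (intro \<delta>g) auto
    moreover have "c = \<mu>" by (rule jordan_block_eigenvalue[OF xy(1) False eig(1)])
    ultimately show ?thesis using \<delta>[of q] q by auto
  next
    case True
    then have y0: "y \<noteq> 0\<^sub>v r" using z(2) xy append_vec_zero[of r, where 'k = 'k] by (auto simp: X_def)
    then obtain q where q: "q < r" "y $ q \<noteq> 0" using ex_last_nonzero[OF xy(2)] by blast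
    then have "\<delta> (q + r) = g" using xy by (intro \<delta>g) auto
    then have "g = ((n - l) mod n, False)" using \<delta>[of "q + r"] q by auto
    moreover have "c * \<mu> = 1"
    proof -
      have "y = (?J * ?J') *\<^sub>v y" using jordan_inverse[OF J n0] xy by simp
      also have "\<dots> = ?J *\<^sub>v (c \<cdot>\<^sub>v y)" using assoc_mult_mat_vec[OF cJ xy(2)] eig by simp
      also have "\<dots> = c \<cdot>\<^sub>v (?J *\<^sub>v y)" by (rule mult_mat_vec[OF cJ(1) xy(2)])
      finally have cy: "y = c \<cdot>\<^sub>v (?J *\<^sub>v y)" .
      have "c \<noteq> 0"
      proof
        assume "c = 0"
        then have "y $ q = 0" using arg_cong[OF cy, of "\<lambda>v. v $ q"] q cJ by simp
        then show False using q by simp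
      qed
      then have "inverse c \<cdot>\<^sub>v y = ?J *\<^sub>v y"
        using arg_cong[OF cy, of "\<lambda>v. inverse c \<cdot>\<^sub>v v"] Jx by (simp add: smult_smult_assoc)
      then have "inverse c = \<mu>" by (intro jordan_block_eigenvalue[OF xy(2) y0]) simp
      then show ?thesis using \<open>c \<noteq> 0\<close> by auto
    qed
    ultimately show ?thesis by blast
  qed
qed


section \<open>The classification\<close>

context modular_dihedral begin

lemma jordan_block_pow_n: "r \<le> p ^ s \<Longrightarrow> jordan_block r (\<xi> ^ j) ^\<^sub>m n = 1\<^sub>m r"
proof -
  assume r: "r \<le> p ^ s"
  have "(\<xi> ^ j) ^ n = 1" by (simp add: \<xi>_power_eq_1_iff n_eq flip: power_mult)
  then show ?thesis
    using jordan_block_pow_scalar[OF char_p prime_p r, of "\<xi> ^ j" t] by (simp flip: n_eq) (auto intro!: eq_matI)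
qed

lemma jordan_block_1_pow_n: "r \<le> p ^ s \<Longrightarrow> jordan_block r 1 ^\<^sub>m n = (1\<^sub>m r :: 'k mat)"
  using jordan_block_pow_n[of r 0] by simp

text \<open>The labels are regrouped by the three families, together with the parameters that occur in the
  matrices: \<open>W\<close> joins \<open>D(Q)\<close> as the case \<open>l = 0\<close>, and \<open>U\<^sub>j\<close> is replaced by the sign \<open>(-1)\<^sup>j\<close>.\<close>

definition is_uni :: "yd_label \<Rightarrow> nat \<Rightarrow> 'k \<Rightarrow> bool" where
  "is_uni x r \<sigma> \<longleftrightarrow> r \<in> {1..p ^ s} \<and> (x = LabV r \<and> \<sigma> = 1 \<or> x = LabV' r \<and> \<sigma> = - 1)"

definition is_rot :: "yd_label \<Rightarrow> nat \<Rightarrow> nat \<Rightarrow> nat \<Rightarrow> bool" where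
  "is_rot x r l j \<longleftrightarrow> r \<in> {1..p ^ s} \<and> j < t \<and> l \<le> (n - 1) div 2 \<and>
    (x = LabW r j \<and> l = 0 \<and> 1 \<le> j \<and> j \<le> (t - 1) div 2 \<or> x = LabDQ r j l \<and> l \<noteq> 0)"

definition is_refl :: "yd_label \<Rightarrow> 'k \<Rightarrow> bool" where
  "is_refl x \<sigma> \<longleftrightarrow> x = LabDU 1 \<and> \<sigma> = - 1 \<or> x = LabDU 2 \<and> \<sigma> = 1"

lemma label_cases:
  assumes "x \<in> yd_labels p s t"
  obtains (uni) r \<sigma> where "is_uni x r \<sigma>" | (rot) r l j where "is_rot x r l j" | (refl) \<sigma> where "is_refl x \<sigma>"
proof -
  have "(\<exists>r \<sigma>. is_uni x r \<sigma>) \<or> (\<exists>r l j. is_rot x r l j) \<or> (\<exists>\<sigma>. is_refl x \<sigma>)"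
    using assms t_pos unfolding yd_labels_def is_uni_def is_rot_def is_refl_def n_eq[symmetric]
    by (elim UnE) (auto simp: Suc_le_eq)
  then show ?thesis using that by blast
qed

lemma label_in_labels:
  "is_uni x r \<sigma> \<Longrightarrow> x \<in> yd_labels p s t"
  "is_rot x r l j \<Longrightarrow> x \<in> yd_labels p s t"
  "is_refl x \<sigma> \<Longrightarrow> x \<in> yd_labels p s t"
  using t_pos unfolding yd_labels_def is_uni_def is_rot_def is_refl_def n_eq[symmetric]
  by (auto simp: Suc_le_eq)

lemma uni_member:
  assumes "is_uni x r \<sigma>"
  obtains \<rho> \<delta> where "yd_member n \<xi> x = yd_of_rep (dihedral n) r \<rho> \<delta>" "unipotent_data n r \<sigma> \<rho> \<delta>"
  using assms V_mod_data[of n \<xi> r] V'_mod_data[of n \<xi> r] by (auto simp: is_uni_def)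

lemma rot_member:
  assumes "is_rot x r l j"
  obtains \<rho> \<delta> where "yd_member n \<xi> x = yd_of_rep (dihedral n) (2 * r) \<rho> \<delta>" "rotation_data n r l (\<xi> ^ j) \<rho> \<delta>"
proof -
  have r: "r \<le> p ^ s" using assms by (auto simp: is_rot_def)
  have l: "l < n" and n0: "0 < n" using assms n_gt_1 by (auto simp: is_rot_def)
  show ?thesis
    using assms that W_mod_data[OF jordan_block_pow_n[OF r, of j] n0] DQ_mod_data[OF jordan_block_pow_n[OF r, of j] n_gt_1 l]
    by (auto simp: is_rot_def)
qed

lemma refl_member:
  assumes "is_refl x \<sigma>"
  obtains \<rho> \<delta> where "yd_member n \<xi> x = yd_of_rep (dihedral n) n \<rho> \<delta>" "reflection_data n \<sigma> \<rho> \<delta>"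
  using assms DU_mod_data[OF n_gt_1, of 1, where 'k = 'k] DU_mod_data[OF n_gt_1, of 2, where 'k = 'k]
  by (auto simp: is_refl_def)

lemma uni_facts: "is_uni x r \<sigma> \<Longrightarrow> 0 < r" "is_uni x r \<sigma> \<Longrightarrow> r \<le> p ^ s" "is_uni x r \<sigma> \<Longrightarrow> \<sigma> * \<sigma> = 1"
  by (auto simp: is_uni_def)

lemma rot_facts: "is_rot x r l j \<Longrightarrow> 0 < r" "is_rot x r l j \<Longrightarrow> r \<le> p ^ s" "is_rot x r l j \<Longrightarrow> l < n" "is_rot x r l j \<Longrightarrow> j < t"
  using n_gt_1 by (auto simp: is_rot_def)

lemma refl_facts: "is_refl x \<sigma> \<Longrightarrow> \<sigma> * \<sigma> = 1"
  by (auto simp: is_refl_def)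

text \<open>For \<open>l \<noteq> 0\<close> inversion moves the degree, as \<open>n\<close> is odd; for \<open>l = 0\<close> the bound
  \<open>1 \<le> j \<le> (t - 1) div 2\<close> excludes that \<open>t\<close> divides \<open>2 j\<close>, so the eigenvalue is moved.\<close>

lemma rot_distinct:
  assumes "is_rot x r l j"
  shows "(n - l) mod n \<noteq> l \<or> (\<xi> ^ j) ^ (p ^ s) \<noteq> (\<xi> ^ j) ^ (p ^ s * (n - 1))"
proof (cases "l = 0")
  case False
  have "n - l \<noteq> l" "n - l < n" using False assms odd_n rot_facts(3)[OF assms] by (auto simp: is_rot_def)
  then show ?thesis by simp
next
  case True
  then have j: "1 \<le> j" "j \<le> (t - 1) div 2" using assms by (auto simp: is_rot_def)
  have "(\<xi> ^ j) ^ (p ^ s) \<noteq> (\<xi> ^ j) ^ (p ^ s * (n - 1))"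
  proof
    assume eq: "(\<xi> ^ j) ^ (p ^ s) = (\<xi> ^ j) ^ (p ^ s * (n - 1))"
    have "(\<xi> ^ j) ^ (p ^ s) * (\<xi> ^ j) ^ (p ^ s) = (\<xi> ^ j) ^ (p ^ s * (n - 1)) * (\<xi> ^ j) ^ (p ^ s)"
      using eq by simp
    also have "\<dots> = (\<xi> ^ j) ^ (p ^ s * (n - 1) + p ^ s)" by (simp add: power_add)
    also have "p ^ s * (n - 1) + p ^ s = p ^ s * n" using n_gt_1 by (cases n) auto
    also have "(\<xi> ^ j) ^ (p ^ s * n) = 1" by (simp add: \<xi>_power_eq_1_iff n_eq flip: power_mult)
    finally have "(\<xi> ^ j) ^ (p ^ s + p ^ s) = 1" by (simp only: power_add)
    moreover have "j * (p ^ s + p ^ s) = p ^ s * (2 * j)" by simp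
    ultimately have "\<xi> ^ (p ^ s * (2 * j)) = 1" by (simp only: power_mult[symmetric])
    then have "t dvd p ^ s * (2 * j)" by (simp add: \<xi>_power_eq_1_iff)
    moreover have "coprime t (p ^ s)"
      using prime_p not_dvd by (simp add: coprime_commute prime_imp_coprime)
    ultimately have "t dvd 2 * j" by (simp add: coprime_dvd_mult_right_iff)
    then have "t \<le> 2 * j" using j by (intro dvd_imp_le) auto
    then show False using j t_pos by linarith
  qed
  then show ?thesis by simp
qed

lemma member_indecomposable:
  assumes "x \<in> yd_labels p s t"
  shows "vectorspace.fin_dim class_ring (yd_member n \<xi> x) \<and> yd_indecomposable (dihedral n) (yd_member n \<xi> x)"
  using assms
proof (cases rule: label_cases)
  case (uni r \<sigma>)
  then obtain \<rho> \<delta> where X: "yd_member n \<xi> x = yd_of_rep (dihedral n) r \<rho> \<delta>" "unipotent_data n r \<sigma> \<rho> \<delta>"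
    by (rule uni_member)
  show ?thesis unfolding X(1)
    using fin_dim_yd_of_rep(1) unipotent_indecomposable[OF jordan_block_1_pow_n[OF uni_facts(2)[OF uni]]
      n_gt_1 uni_facts(3,1)[OF uni] X(2)]
    by blast
next
  case (rot r l j)
  then obtain \<rho> \<delta> where X: "yd_member n \<xi> x = yd_of_rep (dihedral n) (2 * r) \<rho> \<delta>" "rotation_data n r l (\<xi> ^ j) \<rho> \<delta>"
    by (rule rot_member)
  show ?thesis unfolding X(1)
    using fin_dim_yd_of_rep(1) rotation_indecomposable[OF char_p prime_p rot_facts(1,2)[OF rot]
        jordan_block_pow_n[OF rot_facts(2)[OF rot]] n_gt_1 rot_facts(3)[OF rot] rot_distinct[OF rot] X(2)]
    by blast
next
  case (refl \<sigma>)
  then obtain \<rho> \<delta> where X: "yd_member n \<xi> x = yd_of_rep (dihedral n) n \<rho> \<delta>" "reflection_data n \<sigma> \<rho> \<delta>"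
    by (rule refl_member)
  show ?thesis unfolding X(1)
    using fin_dim_yd_of_rep(1) reflection_indecomposable[OF n_gt_1 odd_n refl_facts[OF refl] X(2)] by blast
qed

text \<open>A homogeneous eigenvector of the first module is transported to the second one, where its degree
  and eigenvalues are already known; the dimension provides \<open>r\<close>. In the rotation family this leaves the
  two possibilities \<open>(l, j)\<close> and \<open>(-l, -j)\<close>, of which only one is listed.\<close>

lemma members_not_isomorphic:
  assumes x: "x \<in> yd_labels p s t" and y: "y \<in> yd_labels p s t"
    and iso: "yd_isomorphic (dihedral n) (yd_member n \<xi> x) (yd_member n \<xi> y)"
  shows "x = y"
proof -
  let ?X = "yd_member n \<xi> x" and ?Y = "yd_member n \<xi> y"
  let ?D = "dihedral n"
  have n0: "0 < n" using n_gt_1 by simp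
  note ab = dihedral_relations(1,2)[OF n0]
  have carr: "(i, e) \<in> carrier ?D \<longleftrightarrow> i < n" for i e by (simp add: dihedral_simps)
  have tr: "joint_eigenvector ?D ?Y g S" if "joint_eigenvector ?D ?X g S" "g \<in> carrier ?D" "fst ` S \<subseteq> carrier ?D" for g S
    by (rule joint_eigenvector_transport[OF iso that(2,3,1)])
  have uniX: "joint_eigenvector ?D (yd_member n \<xi> z) (0, False) {(dih_a n, 1), (dih_b, \<sigma> * (- 1) ^ (r - 1))}"
    and uniY: "\<And>g S. g \<in> carrier ?D \<Longrightarrow> joint_eigenvector ?D (yd_member n \<xi> z) g S \<Longrightarrow> g = (0, False)"
      "\<And>g S c. (dih_a n, c) \<in> S \<Longrightarrow> joint_eigenvector ?D (yd_member n \<xi> z) g S \<Longrightarrow> c = 1"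
      "\<And>g S c. (dih_a n, 1) \<in> S \<Longrightarrow> (dih_b, c) \<in> S \<Longrightarrow> joint_eigenvector ?D (yd_member n \<xi> z) g S \<Longrightarrow>
        c = \<sigma> * (- 1) ^ (r - 1)"
    if uni: "is_uni z r \<sigma>" for z r \<sigma>
  proof -
    obtain \<rho> \<delta> where X: "yd_member n \<xi> z = yd_of_rep (dihedral n) r \<rho> \<delta>" "unipotent_data n r \<sigma> \<rho> \<delta>"
      using uni by (rule uni_member)
    note * = unipotent_joint_eigenvector[OF jordan_block_1_pow_n[OF uni_facts(2)[OF uni]] n_gt_1
      uni_facts(3,1)[OF uni] X(2), folded X(1)]
    show "joint_eigenvector ?D (yd_member n \<xi> z) (0, False) {(dih_a n, 1), (dih_b, \<sigma> * (- 1) ^ (r - 1))}" by (rule *(1))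
    show "g = (0, False)" if "g \<in> carrier ?D" "joint_eigenvector ?D (yd_member n \<xi> z) g S" for g S
      by (rule *(2)[OF that])
    show "c = 1" if "(dih_a n, c) \<in> S" "joint_eigenvector ?D (yd_member n \<xi> z) g S" for g S c
      by (rule *(3)[OF that])
    show "c = \<sigma> * (- 1) ^ (r - 1)"
      if "(dih_a n, 1) \<in> S" "(dih_b, c) \<in> S" "joint_eigenvector ?D (yd_member n \<xi> z) g S" for g S c
      by (rule *(4)[OF that])
  qed
  have rotX: "joint_eigenvector ?D (yd_member n \<xi> z) (l, False) {(dih_a n, \<xi> ^ j)}"
    and rotY: "\<And>g S c. g \<in> carrier ?D \<Longrightarrow> (dih_a n, c) \<in> S \<Longrightarrow> joint_eigenvector ?D (yd_member n \<xi> z) g S \<Longrightarrow>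
      g = (l, False) \<and> c = \<xi> ^ j \<or> g = ((n - l) mod n, False) \<and> c * \<xi> ^ j = 1"
    if rot: "is_rot z r l j" for z r l j
  proof -
    obtain \<rho> \<delta> where X: "yd_member n \<xi> z = yd_of_rep (dihedral n) (2 * r) \<rho> \<delta>" "rotation_data n r l (\<xi> ^ j) \<rho> \<delta>"
      using rot by (rule rot_member)
    note * = rotation_joint_eigenvector[OF jordan_block_pow_n[OF rot_facts(2)[OF rot]] rot_facts(1)[OF rot] n_gt_1
        rot_facts(3)[OF rot] X(2), folded X(1)]
    show "joint_eigenvector ?D (yd_member n \<xi> z) (l, False) {(dih_a n, \<xi> ^ j)}" by (rule *(1))
    show "g = (l, False) \<and> c = \<xi> ^ j \<or> g = ((n - l) mod n, False) \<and> c * \<xi> ^ j = 1"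
      if "g \<in> carrier ?D" "(dih_a n, c) \<in> S" "joint_eigenvector ?D (yd_member n \<xi> z) g S" for g S c
      by (rule *(2)[OF that])
  qed
  have reflX: "joint_eigenvector ?D (yd_member n \<xi> z) (0, True) {(dih_b, \<sigma>)}"
    and reflY: "\<And>g S. g \<in> carrier ?D \<Longrightarrow> joint_eigenvector ?D (yd_member n \<xi> z) g S \<Longrightarrow> snd g"
      "\<And>S c. (dih_b, c) \<in> S \<Longrightarrow> joint_eigenvector ?D (yd_member n \<xi> z) (0, True) S \<Longrightarrow> c = \<sigma>"
    if refl: "is_refl z \<sigma>" for z \<sigma>
  proof -
    obtain \<rho> \<delta> where X: "yd_member n \<xi> z = yd_of_rep (dihedral n) n \<rho> \<delta>" "reflection_data n \<sigma> \<rho> \<delta>"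
      using refl by (rule refl_member)
    note * = reflection_joint_eigenvector[OF n_gt_1 odd_n refl_facts[OF refl] X(2), folded X(1)]
    show "joint_eigenvector ?D (yd_member n \<xi> z) (0, True) {(dih_b, \<sigma>)}" by (rule *(1))
    show "snd g" if "g \<in> carrier ?D" "joint_eigenvector ?D (yd_member n \<xi> z) g S" for g S
      by (rule *(2)[OF that])
    show "c = \<sigma>" if "(dih_b, c) \<in> S" "joint_eigenvector ?D (yd_member n \<xi> z) (0, True) S" for S c
      by (rule *(3)[OF that])
  qed
  have not_trivial: "\<not> (l = 0 \<and> \<xi> ^ j = 1)" if "is_rot z r l j" for z r l j
    using that \<xi>_power_inj[of j 0] t_pos by (auto simp: is_rot_def)
  show ?thesis
    using x
  proof (cases rule: label_cases)
    case (uni r \<sigma>)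
    have ex: "joint_eigenvector ?D ?Y (0, False) {(dih_a n, 1), (dih_b, \<sigma> * (- 1) ^ (r - 1))}"
      by (rule tr[OF uniX[OF uni]]) (use ab n0 in \<open>auto simp: carr\<close>)
    show ?thesis using y
    proof (cases rule: label_cases)
      case (uni r' \<sigma>')
      obtain \<rho> \<delta> where X: "?X = yd_of_rep (dihedral n) r \<rho> \<delta>" using \<open>is_uni x r \<sigma>\<close> by (rule uni_member)
      obtain \<rho>' \<delta>' where Y: "?Y = yd_of_rep (dihedral n) r' \<rho>' \<delta>'" using uni by (rule uni_member)
      have rr: "r = r'" using iso unfolding X Y by (rule yd_isomorphic_dim)
      have "\<sigma> * (- 1) ^ (r - 1) = \<sigma>' * (- 1) ^ (r' - 1)" by (rule uniY(3)[OF uni _ _ ex]) auto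
      then have "\<sigma> = \<sigma>'" using rr by simp
      then show ?thesis using \<open>is_uni x r \<sigma>\<close> uni rr one_neq_minus_one by (auto simp: is_uni_def)
    next
      case (rot r' l j)
      have "(0, False) = (l, False) \<and> 1 = \<xi> ^ j \<or> (0, False) = ((n - l) mod n, False) \<and> 1 * \<xi> ^ j = 1"
        by (rule rotY[OF rot _ _ ex]) (use n0 in \<open>auto simp: carr\<close>)
      then have "l = 0 \<and> \<xi> ^ j = 1" using rot_facts(3)[OF rot] by (cases "l = 0") auto
      then show ?thesis using not_trivial[OF rot] by blast
    next
      case (refl \<sigma>')
      then show ?thesis using reflY(1)[OF refl _ ex] n0 by (simp add: carr)
    qed
  next
    case (rot r l j)
    have ex: "joint_eigenvector ?D ?Y (l, False) {(dih_a n, \<xi> ^ j)}"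
      by (rule tr[OF rotX[OF rot]]) (use ab rot_facts(3)[OF rot] in \<open>auto simp: carr\<close>)
    have lc: "(l, False) \<in> carrier ?D" using rot_facts(3)[OF rot] by (simp add: carr)
    show ?thesis using y
    proof (cases rule: label_cases)
      case (uni r' \<sigma>')
      have "(l, False) = (0, False)" by (rule uniY(1)[OF uni lc ex])
      moreover have "\<xi> ^ j = 1" by (rule uniY(2)[OF uni _ ex]) simp
      ultimately show ?thesis using not_trivial[OF rot] by simp
    next
      case rot': (rot r' l' j')
      obtain \<rho> \<delta> where X: "?X = yd_of_rep (dihedral n) (2 * r) \<rho> \<delta>" using rot by (rule rot_member)
      obtain \<rho>' \<delta>' where Y: "?Y = yd_of_rep (dihedral n) (2 * r') \<rho>' \<delta>'" using rot' by (rule rot_member)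
      have "2 * r = 2 * r'" using iso unfolding X Y by (rule yd_isomorphic_dim)
      then have rr: "r = r'" by simp
      have "(l, False) = (l', False) \<and> \<xi> ^ j = \<xi> ^ j' \<or> (l, False) = ((n - l') mod n, False) \<and> \<xi> ^ j * \<xi> ^ j' = 1"
        by (rule rotY[OF rot' lc _ ex]) simp
      then show ?thesis
      proof
        assume "(l, False) = (l', False) \<and> \<xi> ^ j = \<xi> ^ j'"
        then have "l = l'" "j = j'" using \<xi>_power_inj[of j j'] rot_facts(4)[OF rot] rot_facts(4)[OF rot'] by auto
        then show ?thesis using rot rot' rr by (auto simp: is_rot_def)
      next
        assume *: "(l, False) = ((n - l') mod n, False) \<and> \<xi> ^ j * \<xi> ^ j' = 1"
        have le: "l \<le> (n - 1) div 2" "l' \<le> (n - 1) div 2" using rot rot' by (auto simp: is_rot_def)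
        have "l' = 0"
        proof (rule ccontr)
          assume "l' \<noteq> 0"
          then have "l = n - l'" using * n0 by simp
          then show False using le n0 by linarith
        qed
        then have "l = 0" using * by simp
        then have jj: "1 \<le> j" "j \<le> (t - 1) div 2" "1 \<le> j'" "j' \<le> (t - 1) div 2"
          using \<open>l' = 0\<close> rot rot' by (auto simp: is_rot_def)
        have "t dvd j + j'" using * by (simp flip: \<xi>_power_eq_1_iff power_add)
        then have "t \<le> j + j'" using jj by (intro dvd_imp_le) auto
        then show ?thesis using jj t_pos by linarith
      qed
    next
      case (refl \<sigma>')
      then show ?thesis using reflY(1)[OF refl lc ex] by simp
    qed
  next
    case (refl \<sigma>)
    have ex: "joint_eigenvector ?D ?Y (0, True) {(dih_b, \<sigma>)}"
      by (rule tr[OF reflX[OF refl]]) (use ab n0 in \<open>auto simp: carr\<close>)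
    have bc: "(0, True) \<in> carrier ?D" using n0 by (simp add: carr)
    obtain \<rho> \<delta> where X: "?X = yd_of_rep (dihedral n) n \<rho> \<delta>" using refl by (rule refl_member)
    show ?thesis using y
    proof (cases rule: label_cases)
      case (uni r' \<sigma>')
      then show ?thesis using uniY(1)[OF uni bc ex] by simp
    next
      case (rot r' l' j')
      obtain \<rho>' \<delta>' where Y: "?Y = yd_of_rep (dihedral n) (2 * r') \<rho>' \<delta>'" using rot by (rule rot_member)
      have "n = 2 * r'" using iso unfolding X Y by (rule yd_isomorphic_dim)
      then show ?thesis using odd_n by simp
    next
      case refl': (refl \<sigma>')
      have "\<sigma> = \<sigma>'" by (rule reflY(2)[OF refl' _ ex]) simp
      then show ?thesis using refl refl' one_neq_minus_one by (auto simp: is_refl_def)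
    qed
  qed
qed

text \<open>A non-zero vector has a non-zero projection to a component of degree a reflection or to some
  \<open>comp l j\<close>, and the corresponding families split off a listed module. If \<open>(l, j)\<close> is not among the
  listed pairs, then \<open>(-l, -j)\<close> is, and \<open>b\<close> carries a non-zero vector there.\<close>

lemma indecomposable_is_member:
  fixes M :: "(nat \<times> bool, 'k, 'v) yd_module"
  assumes ind: "yd_indecomposable (dihedral n) M" and fin: "vectorspace.fin_dim class_ring M"
  shows "\<exists>x\<in>yd_labels p s t. yd_isomorphic (dihedral n) M (yd_member n \<xi> x)"
proof -
  have yd: "yetter_drinfeld (dihedral n) M" using ind by (simp add: yd_indecomposable_def)
  interpret M: yetter_drinfeld "dihedral n" M by (rule yd)
  obtain c :: "'v \<Rightarrow> 'v \<Rightarrow> 'k" and d where cd: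
    "\<And>x y. x \<in> carrier M \<Longrightarrow> y \<in> carrier M \<Longrightarrow> c (x \<oplus>\<^bsub>M\<^esub> y) = c x + c y"
    "\<And>k x. x \<in> carrier M \<Longrightarrow> c (k \<odot>\<^bsub>M\<^esub> x) = (\<lambda>v. k * c x v)"
    "\<And>x. d x \<in> carrier M" "\<And>x y. d (x + y) = d x \<oplus>\<^bsub>M\<^esub> d y"
    "\<And>k x. d (\<lambda>v. k * x v) = k \<odot>\<^bsub>M\<^esub> d x" "\<And>x. x \<in> carrier M \<Longrightarrow> d (c x) = x"
    by (rule ex_coordinates[OF M.vectorspace_axioms fin]) (rule that; assumption)
  interpret C: yd_coordinates n M c d
    by (rule yd_coordinates.intro[OF yd], rule yd_coordinates_axioms.intro) (rule odd_n cd; assumption?)+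
  interpret V: modular_dihedral_grading C.sc n C.A C.B C.Pr "c ` carrier M" p s t \<xi>
    by (rule modular_dihedral_grading.intro[OF C.dihedral_grading_coordinates modular_dihedral_axioms])
  have n0: "0 < n" using n_gt_1 by simp
  obtain m where m: "m \<in> carrier M" "m \<noteq> \<zero>\<^bsub>M\<^esub>" using ind M.zero_closed by (auto simp: yd_indecomposable_def)
  have "c m \<noteq> 0"
  proof
    assume "c m = 0"
    then have "d (c m) = d (c \<zero>\<^bsub>M\<^esub>)" by (simp only: C.c_zero)
    then show False using m cd(6) by simp
  qed
  then consider i where "i < n" "C.Pr (i, True) (c m) \<noteq> 0" | l j where "l < n" "j < t" "V.Q l j (c m) \<noteq> 0"
    using V.ex_component[of "c m"] m(1) by blast
  then show ?thesis
  proof cases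
    case 1
    obtain \<sigma> u f where \<sigma>: "\<sigma> \<in> {1, -1}" and sp: "C.W.splits n (\<lambda>i. ((2 * i) mod n, True)) u f"
      and f: "\<And>m i. m \<in> c ` carrier M \<Longrightarrow> i < n \<Longrightarrow> f i (C.A m) = f ((i + n - 1) mod n) m"
        "\<And>m i. m \<in> c ` carrier M \<Longrightarrow> i < n \<Longrightarrow> f i (C.B m) = \<sigma> * f ((n - i) mod n) m"
      using C.W.splits_reflection[OF two_neq_0 imageI[OF m(1)] 1] by blast
    obtain x where x: "is_refl x \<sigma>" using \<sigma> by (auto simp: is_refl_def)
    obtain \<rho> \<delta> where X: "yd_member n \<xi> x = yd_of_rep (dihedral n) n \<rho> \<delta>" "reflection_data n \<sigma> \<rho> \<delta>"
      using x by (rule refl_member)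
    have ydX: "yetter_drinfeld (dihedral n) (yd_of_rep (dihedral n) n \<rho> \<delta>)"
      by (rule reflection_yd[OF n_gt_1 refl_facts[OF x] X(2)])
    have \<rho>: "\<rho> (dih_a n) \<in> carrier_mat n n" "\<rho> dih_b \<in> carrier_mat n n"
      using X(2) dihedral_relations(1,2)[OF n0] by (simp_all add: reflection_data_def)
    have "yd_isomorphic (dihedral n) M (yd_of_rep (dihedral n) n \<rho> \<delta>)"
    proof (rule C.isomorphic_if_splits[OF ind sp n0 ydX])
      show "\<delta> q = (2 * q mod n, True)" if "q < n" for q using X(2) that by (simp add: reflection_data_def)
      fix y assume y: "y \<in> c ` carrier M"
      have v: "vec n (\<lambda>q. f q y) \<in> carrier_vec n" by simp
      show "vec n (\<lambda>q. f q (C.A y)) = \<rho> (dih_a n) *\<^sub>v vec n (\<lambda>q. f q y)"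
        by (rule eq_vecI) (use \<rho> n0 in \<open>simp_all add: f[OF y] reflection_action[OF n_gt_1 X(2) v] del: index_mult_mat_vec\<close>)
      show "vec n (\<lambda>q. f q (C.B y)) = \<rho> dih_b *\<^sub>v vec n (\<lambda>q. f q y)"
        by (rule eq_vecI) (use \<rho> n0 in \<open>simp_all add: f[OF y] reflection_action[OF n_gt_1 X(2) v] del: index_mult_mat_vec\<close>)
    qed
    then show ?thesis using label_in_labels(3)[OF x] by (intro bexI[of _ x]) (simp_all only: X(1))
  next
    case (2 l j)
    define y where "y = V.Q l j (c m)"
    have y: "y \<in> V.comp l j" "y \<noteq> 0" using 2 V.Q_comp[OF imageI[OF m(1)]] by (simp_all add: y_def)
    show ?thesis
    proof (cases "l = 0 \<and> j = 0")
      case True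
      then obtain \<sigma> r u f where \<sigma>: "\<sigma> \<in> {1, -1}" and r: "0 < r" "r \<le> p ^ s"
        and sp: "C.W.splits r (\<lambda>_. (0, False)) u f"
        and f: "\<And>m q. m \<in> c ` carrier M \<Longrightarrow> q < r \<Longrightarrow> f q (C.A m) = f q m + (if Suc q < r then f (Suc q) m else 0)"
          "\<And>m q. m \<in> c ` carrier M \<Longrightarrow> q < r \<Longrightarrow> f q (C.B m) = \<sigma> * (- 1) ^ (r - 1 - q) *
            (\<Sum>i<r. if q \<le> i then of_nat ((r - 1 - q) choose (i - q)) * f i m else 0)"
        using V.splits_unipotent[of y] y by blast
      obtain x where x: "is_uni x r \<sigma>" using \<sigma> r by (auto simp: is_uni_def)
      obtain \<rho> \<delta> where X: "yd_member n \<xi> x = yd_of_rep (dihedral n) r \<rho> \<delta>" "unipotent_data n r \<sigma> \<rho> \<delta>"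
        using x by (rule uni_member)
      note ydX = unipotent_yd[OF jordan_block_1_pow_n[OF r(2)] n_gt_1 uni_facts(3)[OF x] X(2)]
      have "yd_isomorphic (dihedral n) M (yd_of_rep (dihedral n) r \<rho> \<delta>)"
      proof (rule C.isomorphic_if_splits[OF ind sp r(1) ydX(1)])
        show "\<delta> q = (0, False)" if "q < r" for q using X(2) that by (simp add: unipotent_data_def)
        fix y assume y: "y \<in> c ` carrier M"
        have v: "vec r (\<lambda>q. f q y) \<in> carrier_vec r" by simp
        show "vec r (\<lambda>q. f q (C.A y)) = \<rho> (dih_a n) *\<^sub>v vec r (\<lambda>q. f q y)"
          unfolding ydX(2)
          by (rule eq_vecI) (auto simp: f(1)[OF y] jordan_block_mult_vec[OF v] simp del: index_mult_mat_vec)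
        show "vec r (\<lambda>q. f q (C.B y)) = \<rho> dih_b *\<^sub>v vec r (\<lambda>q. f q y)"
          unfolding ydX(3)
        proof (rule eq_vecI)
          fix q assume "q < dim_vec ((\<sigma> \<cdot>\<^sub>m T_mat r) *\<^sub>v vec r (\<lambda>q. f q y))"
          then have q: "q < r" by simp
          have "((\<sigma> \<cdot>\<^sub>m T_mat r) *\<^sub>v vec r (\<lambda>q. f q y)) $ q = (\<Sum>i<r. \<sigma> * T_mat r $$ (q, i) * f i y)"
            using q by (simp add: scalar_prod_def lessThan_atLeast0)
          also have "\<dots> = (\<Sum>i<r. \<sigma> * (- 1) ^ (r - 1 - q) *
              (if q \<le> i then of_nat ((r - 1 - q) choose (i - q)) * f i y else 0))"
            using q by (intro sum.cong) (auto simp: T_mat_index)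
          finally show "vec r (\<lambda>q. f q (C.B y)) $ q = ((\<sigma> \<cdot>\<^sub>m T_mat r) *\<^sub>v vec r (\<lambda>q. f q y)) $ q"
            using q f(2)[OF y q] by (simp add: sum_distrib_left del: index_mult_mat_vec)
        qed simp
      qed
      then show ?thesis using label_in_labels(1)[OF x] by (intro bexI[of _ x]) (simp_all only: X(1))
    next
      case False
      have "\<exists>l j z. z \<in> V.comp l j \<and> z \<noteq> 0 \<and> j < t \<and> l \<le> (n - 1) div 2 \<and> (l \<noteq> 0 \<or> 1 \<le> j \<and> j \<le> (t - 1) div 2)"
      proof (cases "l \<le> (n - 1) div 2 \<and> (l \<noteq> 0 \<or> j \<le> (t - 1) div 2)")
        case True
        then show ?thesis using False y 2 by (intro exI[of _ l] exI[of _ j] exI[of _ y]) auto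
      next
        case swap: False
        have bz: "C.B y \<noteq> 0"
          using C.W.b_b[OF V.comp_M[OF y(1)]] y(2) C.W.add_scale_simps(8) by metis
        have "(n - l) mod n \<le> (n - 1) div 2 \<and> ((n - l) mod n \<noteq> 0 \<or> 1 \<le> (t - j) mod t \<and> (t - j) mod t \<le> (t - 1) div 2)"
        proof (cases "l = 0")
          case True
          then have "j \<noteq> 0" "\<not> j \<le> (t - 1) div 2" using False swap by auto
          then have "(t - j) mod t = t - j" using t_pos by simp
          moreover have "t - j \<le> (t - 1) div 2" using \<open>\<not> j \<le> (t - 1) div 2\<close> odd_t by presburger
          ultimately show ?thesis using True 2 by simp
        next
          case l0: False
          then have "\<not> l \<le> (n - 1) div 2" using swap by simp
          then have "n - l \<le> (n - 1) div 2" using odd_n by presburger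
          then show ?thesis using l0 2 by simp
        qed
        then show ?thesis using V.b_comp[OF y(1) 2(1,2)] bz t_pos
          by (intro exI[of _ "(n - l) mod n"] exI[of _ "(t - j) mod t"] exI[of _ "C.B y"]) auto
      qed
      then obtain l j z where z: "z \<in> V.comp l j" "z \<noteq> 0" and lj: "j < t" "l \<le> (n - 1) div 2"
        "l \<noteq> 0 \<or> 1 \<le> j \<and> j \<le> (t - 1) div 2"
        by blast
      have ln: "l < n" using lj n0 by linarith
      have lj0: "l \<noteq> 0 \<or> j \<noteq> 0" using lj by auto
      obtain r u f where r: "0 < r" "r \<le> p ^ s"
        and sp: "C.W.splits (2 * r) (\<lambda>i. (if i < r then l else (n - l) mod n, False)) u f"
        and f: "\<And>m q. m \<in> c ` carrier M \<Longrightarrow> q < r \<Longrightarrow> f q (C.A m) = \<xi> ^ j * f q m + (if Suc q < r then f (Suc q) m else 0)"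
          "\<And>m q. m \<in> c ` carrier M \<Longrightarrow> q < r \<Longrightarrow> f (r + q) m = f q (C.B m)"
        using V.splits_rotation[OF z ln lj(1) lj0] by blast
      have "is_rot (if l = 0 then LabW r j else LabDQ r j l) r l j" using lj r by (auto simp: is_rot_def)
      then obtain x where x: "is_rot x r l j" by blast
      obtain \<rho> \<delta> where X: "yd_member n \<xi> x = yd_of_rep (dihedral n) (2 * r) \<rho> \<delta>" "rotation_data n r l (\<xi> ^ j) \<rho> \<delta>"
        using x by (rule rot_member)
      let ?J = "jordan_block r (\<xi> ^ j)"
      have J: "?J \<in> carrier_mat r r" by simp
      have ydX: "yetter_drinfeld (dihedral n) (yd_of_rep (dihedral n) (2 * r) \<rho> \<delta>)"
        by (rule rotation_yd[OF jordan_block_pow_n[OF r(2)] n_gt_1 ln X(2)])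
      define R where "R y = vec r (\<lambda>q. f q y)" for y
      have Rc: "R y \<in> carrier_vec r" for y by (simp add: R_def)
      have RA: "R (C.A y) = ?J *\<^sub>v R y" if "y \<in> c ` carrier M" for y
        by (rule eq_vecI) (auto simp: R_def f(1)[OF that] jordan_block_mult_vec[OF Rc[unfolded R_def]] simp
          del: index_mult_mat_vec)
      have RA_pow: "R ((C.A ^^ k) y) = ?J ^\<^sub>m k *\<^sub>v R y" if "y \<in> c ` carrier M" for k y
        using that
      proof (induction k arbitrary: y)
        case 0
        then show ?case by (simp add: Rc)
      next
        case (Suc k)
        have "R ((C.A ^^ Suc k) y) = ?J ^\<^sub>m k *\<^sub>v (?J *\<^sub>v R y)"
          using Suc.IH[OF C.W.a_M[OF Suc.prems]] RA[OF Suc.prems] by (simp add: funpow_swap1)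
        then show ?case using assoc_mult_mat_vec[OF pow_carrier_mat[OF J] J Rc, of k y] by simp
      qed
      have split: "vec (2 * r) (\<lambda>q. f q y) = R y @\<^sub>v R (C.B y)" if "y \<in> c ` carrier M" for y
      proof (rule eq_vecI)
        fix q assume "q < dim_vec (R y @\<^sub>v R (C.B y))"
        then have q: "q < 2 * r" by (simp add: R_def)
        show "vec (2 * r) (\<lambda>q. f q y) $ q = (R y @\<^sub>v R (C.B y)) $ q"
        proof (cases "q < r")
          case False
          then show ?thesis using q f(2)[OF that, of "q - r"] by (simp add: R_def)
        qed (use q in \<open>simp add: R_def\<close>)
      qed (simp add: R_def)
      have "yd_isomorphic (dihedral n) M (yd_of_rep (dihedral n) (2 * r) \<rho> \<delta>)"
      proof (rule C.isomorphic_if_splits[OF ind sp _ ydX])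
        show "0 < 2 * r" using r by simp
        show "\<delta> q = (if q < r then l else (n - l) mod n, False)" if "q < 2 * r" for q
          using X(2) that by (simp add: rotation_data_def)
        fix y assume y: "y \<in> c ` carrier M"
        have "R (C.B (C.A y)) = ?J ^\<^sub>m (n - 1) *\<^sub>v R (C.B y)"
          using RA_pow[OF C.W.b_M[OF y], of "n - 1"] C.W.b_a[OF y] by simp
        then show "vec (2 * r) (\<lambda>q. f q (C.A y)) = \<rho> (dih_a n) *\<^sub>v vec (2 * r) (\<lambda>q. f q y)"
          unfolding split[OF C.W.a_M[OF y]] split[OF y]
          by (simp add: rotation_action(1)[OF n_gt_1 X(2) Rc Rc] RA[OF y])
        show "vec (2 * r) (\<lambda>q. f q (C.B y)) = \<rho> dih_b *\<^sub>v vec (2 * r) (\<lambda>q. f q y)"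
          unfolding split[OF C.W.b_M[OF y]] split[OF y]
          by (simp add: rotation_action(2)[OF n_gt_1 X(2) Rc Rc] C.W.b_b[OF y])
      qed
      then show ?thesis using label_in_labels(2)[OF x] by (intro bexI[of _ x]) (simp_all only: X(1))
    qed
  qed
qed

end

theorem theorem4p1:
  fixes p s t n :: nat and \<xi> :: "'k :: alg_closed_field"
  assumes "CHAR('k) = p" and "odd p"
    and "s \<ge> 1" and "\<not> p dvd t" and "n = p ^ s * t" and "odd n"
    and "\<xi> ^ t = 1" and "\<And>m. 0 < m \<Longrightarrow> m < t \<Longrightarrow> \<xi> ^ m \<noteq> 1"
  shows "(\<forall>x\<in>yd_labels p s t. vectorspace.fin_dim class_ring (yd_member n \<xi> x) \<and>
            yd_indecomposable (dihedral n) (yd_member n \<xi> x)) \<and>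
         (\<forall>x\<in>yd_labels p s t. \<forall>y\<in>yd_labels p s t. x \<noteq> y \<longrightarrow>
            \<not> yd_isomorphic (dihedral n) (yd_member n \<xi> x) (yd_member n \<xi> y)) \<and>
         (\<forall>M :: (nat \<times> bool, 'k, 'v) yd_module.
            yd_indecomposable (dihedral n) M \<and> vectorspace.fin_dim class_ring M \<longrightarrow>
            (\<exists>x\<in>yd_labels p s t. yd_isomorphic (dihedral n) M (yd_member n \<xi> x)))"
proof -
  interpret modular_dihedral p s t n \<xi>
    by (rule modular_dihedral.intro) (fact assms)+
  show ?thesis
    using member_indecomposable members_not_isomorphic indecomposable_is_member by blast
qed

end
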